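(* For any integer $n\ge 2$, the dynamical system $\mathrm{Out}(F_n)\curvearrowright\mathcal G_n$ contains a subsystem (that is, a non-empty, closed, $\mathrm{Out}(F_n)$-invariant subset of $\mathcal G_n$) that does not admit any $\mathrm{Out}(F_n)$-invariant probability measure.
   Context: $F_n$ denotes the free group of rank $n$. An $n$-generated marked group is a pair $(G,X)$ where $G$ is a group and $X=(x_1,\dots,x_n)\in G^n$ is an ordered generating set; $(G,(x_1,\dots,x_n))$ and $(H,(y_1,\dots,y_n))$ are isomorphic as marked groups if there is a group isomorphism $G\to H$ sending $x_i$ to $y_i$ for all $i$. The space $\mathcal G_n$ of isomorphism classes of $n$-generated marked groups is identified with the set of normal subgroups of $F_n$: $(G,X)$ corresponds to the kernel of the homomorphism $F_n\to G$ induced by mapping a fixed basis of $F_n$ to $X$. It carries the topology induced from the product topology on $2^{F_n}$. The group $\mathrm{Aut}(F_n)$ acts on the set of normal subgroups of $F_n$ by $\alpha\cdot N=\alpha(N)$; inner automorphisms act trivially, so this induces an action of $\mathrm{Out}(F_n)$ on $\mathcal G_n$ by homeomorphisms. A probability measure on a topological space $Z$ is a countably additive measure $\mu$ on the Borel $\sigma$-algebra of $Z$ with $\mu(Z)=1$; if a group $\Gamma$ acts continuously on $Z$, then $\mu$ is $\Gamma$-invariant if $\mu(gA)=\mu(A)$ for all Borel $A\subseteq Z$ and $g\in \Gamma$. *)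

theory Defs
  imports
    "HOL-Analysis.Function_Topology"
    "HOL-Probability.Probability_Measure"
    "HOL-Algebra.Group_Action"
begin

section \<open>The free group of rank n\<close>

text \<open>The letter \<open>(i, True)\<close> stands for the basis element \<open>x\<^sub>i\<close>, and \<open>(i, False)\<close> for its inverse.\<close>

type_synonym letter = "nat \<times> bool"

definition flip_letter :: "letter \<Rightarrow> letter" where
  "flip_letter a = (fst a, \<not> snd a)"

definition reduced :: "letter list \<Rightarrow> bool" where
  "reduced w \<longleftrightarrow> successively (\<lambda>a b. b \<noteq> flip_letter a) w"

fun red_cons :: "letter \<Rightarrow> letter list \<Rightarrow> letter list" where
  "red_cons a [] = [a]"
| "red_cons a (b # w) = (if b = flip_letter a then w else a # b # w)"

text \<open>For reduced \<open>v\<close>, the word \<open>foldr red_cons u v\<close> is the reduced form of \<open>u @ v\<close>.\<close>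

definition free_group :: "nat \<Rightarrow> letter list monoid" where
  "free_group n =
    \<lparr>carrier = {w. reduced w \<and> fst ` set w \<subseteq> {..<n}},
     mult = foldr red_cons,
     one = []\<rparr>"

lemma flip_flip [simp]: "flip_letter (flip_letter a) = a"
  by (simp add: flip_letter_def)

lemma fst_flip [simp]: "fst (flip_letter a) = fst a"
  by (simp add: flip_letter_def)

lemma flip_neq [simp]: "flip_letter a \<noteq> a" "a \<noteq> flip_letter a"
  by (simp_all add: flip_letter_def prod_eq_iff)

lemma reduced_Nil [simp]: "reduced []"
  by (simp add: reduced_def)

lemma reduced_Cons:
  "reduced (a # w) \<longleftrightarrow> reduced w \<and> (w = [] \<or> hd w \<noteq> flip_letter a)"
  by (auto simp: reduced_def successively_Cons)

lemma reduced_red_cons: "reduced w \<Longrightarrow> reduced (red_cons a w)"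
  by (cases w) (auto simp: reduced_Cons)

lemma reduced_foldr: "reduced v \<Longrightarrow> reduced (foldr red_cons u v)"
  by (induction u) (auto simp: reduced_red_cons)

lemma set_red_cons: "set (red_cons a w) \<subseteq> insert a (set w)"
  by (cases w) auto

lemma set_foldr: "set (foldr red_cons u v) \<subseteq> set u \<union> set v"
  by (induction u) (use set_red_cons in fastforce)+

lemma red_cons_flip:
  assumes "reduced w" shows "red_cons a (red_cons (flip_letter a) w) = w"
proof (cases w)
  case (Cons b v)
  then show ?thesis using assms by (cases v) (auto simp: reduced_Cons)
qed simp

lemma foldr_red_cons:
  assumes "reduced w"
  shows "foldr red_cons (red_cons a v) w = red_cons a (foldr red_cons v w)"
  using assms by (cases v) (auto simp: red_cons_flip reduced_foldr)

lemma foldr_assoc: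
  assumes "reduced w"
  shows "foldr red_cons (foldr red_cons u v) w = foldr red_cons u (foldr red_cons v w)"
  using assms by (induction u) (auto simp: foldr_red_cons)

lemma foldr_reduced_Nil: "reduced u \<Longrightarrow> foldr red_cons u [] = u"
proof (induction u)
  case (Cons a u)
  then show ?case by (cases u) (auto simp: reduced_Cons)
qed simp

lemma foldr_inverse:
  assumes "reduced v"
  shows "foldr red_cons (rev (map flip_letter u)) (foldr red_cons u v) = v"
  using assms
proof (induction u arbitrary: v)
  case (Cons a u)
  have "red_cons (flip_letter a) (red_cons a (foldr red_cons u v)) = foldr red_cons u v"
    using red_cons_flip[of "foldr red_cons u v" "flip_letter a"] Cons.prems
    by (simp add: reduced_foldr)
  then show ?case using Cons by simp
qed simp

lemma reduced_rev_flip: "reduced u \<Longrightarrow> reduced (rev (map flip_letter u))"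
  unfolding reduced_def successively_rev successively_map
  by (erule successively_mono) (metis flip_flip)

lemma group_free_group: "group (free_group n)"
proof (rule groupI)
  fix x assume x: "x \<in> carrier (free_group n)"
  let ?y = "rev (map flip_letter x)"
  have "?y \<in> carrier (free_group n)"
    using x by (auto simp: free_group_def reduced_rev_flip)
  moreover have "?y \<otimes>\<^bsub>free_group n\<^esub> x = \<one>\<^bsub>free_group n\<^esub>"
    using x foldr_inverse[of "[]" x] by (simp add: free_group_def foldr_reduced_Nil)
  ultimately show "\<exists>y\<in>carrier (free_group n). y \<otimes>\<^bsub>free_group n\<^esub> x = \<one>\<^bsub>free_group n\<^esub>"
    by blast
next
  fix x y assume "x \<in> carrier (free_group n)" "y \<in> carrier (free_group n)"
  then show "x \<otimes>\<^bsub>free_group n\<^esub> y \<in> carrier (free_group n)"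
    using set_foldr[of x y] by (fastforce simp: free_group_def reduced_foldr)
qed (auto simp: free_group_def foldr_assoc)

definition letter_value :: "('g, 'm) monoid_scheme \<Rightarrow> (nat \<Rightarrow> 'g) \<Rightarrow> letter \<Rightarrow> 'g" where
  "letter_value H f a = (if snd a then f (fst a) else inv\<^bsub>H\<^esub> f (fst a))"

definition word_value :: "('g, 'm) monoid_scheme \<Rightarrow> (nat \<Rightarrow> 'g) \<Rightarrow> letter list \<Rightarrow> 'g" where
  "word_value H f w = foldr (\<lambda>a x. letter_value H f a \<otimes>\<^bsub>H\<^esub> x) w \<one>\<^bsub>H\<^esub>"

text \<open>The universal property: \<open>[(0, True)], \<dots>, [(n - 1, True)]\<close> is a basis of \<open>free_group n\<close>.\<close>

theorem free_group_universal:
  fixes H (structure)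
  assumes "group H" and f: "\<And>i. i < n \<Longrightarrow> f i \<in> carrier H"
  shows "word_value H f \<in> hom (free_group n) H"
    and "\<And>i. i < n \<Longrightarrow> word_value H f [(i, True)] = f i"
    and "\<And>h w. h \<in> hom (free_group n) H \<Longrightarrow> (\<And>i. i < n \<Longrightarrow> h [(i, True)] = f i) \<Longrightarrow>
           w \<in> carrier (free_group n) \<Longrightarrow> h w = word_value H f w"
proof -
  interpret group H by fact
  have val: "letter_value H f a \<in> carrier H" if "fst a < n" for a
    using f that by (auto simp: letter_value_def)
  have wval: "word_value H f w \<in> carrier H" if "fst ` set w \<subseteq> {..<n}" for w
    using that by (induction w) (auto simp: word_value_def val)
  have flip: "letter_value H f a \<otimes> (letter_value H f (flip_letter a) \<otimes> x) = x"
    if "fst a < n" "x \<in> carrier H" for a x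
    using that f[of "fst a"]
    by (auto simp: letter_value_def flip_letter_def m_assoc[symmetric])
  have Cons: "word_value H f (a # w) = letter_value H f a \<otimes> word_value H f w" for a w
    by (simp add: word_value_def)
  have step: "word_value H f (red_cons a w) = letter_value H f a \<otimes> word_value H f w"
    if "fst a < n" "fst ` set w \<subseteq> {..<n}" for a w
    using that by (cases w) (auto simp: Cons flip wval)
  have mult: "word_value H f (foldr red_cons u v) = word_value H f u \<otimes> word_value H f v"
    if "fst ` set u \<subseteq> {..<n}" "fst ` set v \<subseteq> {..<n}" for u v
    using that(1)
  proof (induction u)
    case Nil
    then show ?case using wval[OF that(2)] by (simp add: word_value_def)
  next
    case (Cons a u)
    have "fst ` set (foldr red_cons u v) \<subseteq> {..<n}"
      using set_foldr[of u v] Cons.prems that(2) by fastforce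
    then show ?case
      using Cons wval[of u] wval[OF that(2)] val[of a]
      by (simp add: step \<open>\<And>w a. word_value H f (a # w) = _\<close> m_assoc)
  qed
  show "word_value H f \<in> hom (free_group n) H"
    by (auto simp: hom_def free_group_def wval mult)
  show gen: "word_value H f [(i, True)] = f i" if "i < n" for i
    using f[OF that] by (simp add: word_value_def letter_value_def)
  show "h w = word_value H f w" if h: "h \<in> hom (free_group n) H"
    "\<And>i. i < n \<Longrightarrow> h [(i, True)] = f i" and w: "w \<in> carrier (free_group n)" for h w
    using w
  proof (induction w)
    case Nil
    then show ?case
      using hom_one[OF h(1) group_free_group \<open>group H\<close>]
      by (simp add: free_group_def word_value_def)
  next
    case (Cons a w)
    have w: "w \<in> carrier (free_group n)" and a: "fst a < n"
      using Cons.prems by (auto simp: free_group_def reduced_Cons)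
    have ca: "[(fst a, b)] \<in> carrier (free_group n)" for b
      using a by (auto simp: free_group_def reduced_def)
    have "a # w = [a] \<otimes>\<^bsub>free_group n\<^esub> w"
      using Cons.prems by (cases w) (auto simp: free_group_def reduced_Cons)
    then have *: "h (a # w) = h [a] \<otimes> h w"
      using hom_mult[OF h(1) ca[of "snd a"] w] by simp
    have "h [a] = letter_value H f a"
    proof (cases "snd a")
      case True
      then show ?thesis using h(2)[OF a] by (cases a) (simp add: letter_value_def)
    next
      case False
      have "[(fst a, False)] \<otimes>\<^bsub>free_group n\<^esub> [(fst a, True)] = \<one>\<^bsub>free_group n\<^esub>"
        by (simp add: free_group_def flip_letter_def)
      then have "h [(fst a, False)] \<otimes> f (fst a) = \<one>"
        using hom_mult[OF h(1) ca ca] hom_one[OF h(1) group_free_group \<open>group H\<close>] h(2)[OF a]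
        by metis
      then have "h [(fst a, False)] = inv f (fst a)"
        using hom_in_carrier[OF h(1) ca] f[OF a] by (metis inv_equality)
      then show ?thesis using False by (cases a) (simp add: letter_value_def)
    qed
    then show ?case using * Cons.IH[OF w] \<open>\<And>w a. word_value H f (a # w) = _\<close> by simp
  qed
qed


section \<open>Outer automorphisms and their action on normal subgroups\<close>

definition Inn :: "('a, 'b) monoid_scheme \<Rightarrow> ('a \<Rightarrow> 'a) set" where
  "Inn G = (\<lambda>g. \<lambda>h\<in>carrier G. g \<otimes>\<^bsub>G\<^esub> h \<otimes>\<^bsub>G\<^esub> inv\<^bsub>G\<^esub> g) ` carrier G"

definition OutGroup :: "('a, 'b) monoid_scheme \<Rightarrow> ('a \<Rightarrow> 'a) set monoid" where
  "OutGroup G = AutoGroup G Mod Inn G"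

text \<open>All representatives \<open>\<alpha>\<close> of an outer automorphism \<open>c\<close> give the same \<open>\<alpha> ` N\<close>; see
  \<open>out_action_coset\<close> below.\<close>

definition out_action :: "('a, 'b) monoid_scheme \<Rightarrow> ('a \<Rightarrow> 'a) set \<Rightarrow> 'a set \<Rightarrow> 'a set" where
  "out_action G c = (\<lambda>N \<in> {N. N \<lhd> G}. the_elem ((\<lambda>\<alpha>. \<alpha> ` N) ` c))"

context group
begin

lemma AutoGroup_simps:
  "carrier (AutoGroup G) = auto G"
  "\<alpha> \<in> auto G \<Longrightarrow> \<beta> \<in> auto G \<Longrightarrow> \<alpha> \<otimes>\<^bsub>AutoGroup G\<^esub> \<beta> = compose (carrier G) \<alpha> \<beta>"
  "\<one>\<^bsub>AutoGroup G\<^esub> = (\<lambda>x\<in>carrier G. x)"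
proof -
  show "carrier (AutoGroup G) = auto G" and "\<one>\<^bsub>AutoGroup G\<^esub> = (\<lambda>x\<in>carrier G. x)"
    by (simp_all add: AutoGroup_def BijGroup_def)
  show "\<alpha> \<otimes>\<^bsub>AutoGroup G\<^esub> \<beta> = compose (carrier G) \<alpha> \<beta>" if "\<alpha> \<in> auto G" "\<beta> \<in> auto G" for \<alpha> \<beta>
    using that by (simp add: AutoGroup_def BijGroup_def auto_def)
qed

lemma auto_bij: "\<alpha> \<in> auto G \<Longrightarrow> bij_betw \<alpha> (carrier G) (carrier G)"
  by (simp add: auto_def Bij_def)

lemma auto_hom: "\<alpha> \<in> auto G \<Longrightarrow> \<alpha> \<in> hom G G"
  by (simp add: auto_def)

lemma auto_closed: "\<alpha> \<in> auto G \<Longrightarrow> x \<in> carrier G \<Longrightarrow> \<alpha> x \<in> carrier G"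
  by (rule hom_in_carrier[OF auto_hom])

lemma auto_group_hom: "\<alpha> \<in> auto G \<Longrightarrow> group_hom G G \<alpha>"
  by (simp add: group_hom_def group_hom_axioms_def auto_hom is_group)

lemma Inn_subset_auto: "Inn G \<subseteq> auto G"
proof -
  have "(\<lambda>h\<in>carrier G. g \<otimes> h \<otimes> inv g) \<in> hom G G" if "g \<in> carrier G" for g
  proof (rule homI)
    fix x y assume xy: "x \<in> carrier G" "y \<in> carrier G"
    have "inv g \<otimes> (g \<otimes> z) = z" if "z \<in> carrier G" for z
      using that \<open>g \<in> carrier G\<close> by (simp add: m_assoc[symmetric])
    then have "g \<otimes> (x \<otimes> y) \<otimes> inv g = (g \<otimes> x \<otimes> inv g) \<otimes> (g \<otimes> y \<otimes> inv g)"
      using that xy by (simp add: m_assoc)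
    then show "(\<lambda>h\<in>carrier G. g \<otimes> h \<otimes> inv g) (x \<otimes> y) =
        (\<lambda>h\<in>carrier G. g \<otimes> h \<otimes> inv g) x \<otimes> (\<lambda>h\<in>carrier G. g \<otimes> h \<otimes> inv g) y"
      using that xy by simp
  qed (use that in auto)
  then show ?thesis
    using conjugation_is_bij by (auto simp: Inn_def auto_def Bij_def)
qed

lemma Inn_normal: "Inn G \<lhd> AutoGroup G"
proof (rule group.normal_invI[OF AutoGroup])
  have "subgroup ((\<lambda>g. \<lambda>h\<in>carrier G. g \<otimes> h \<otimes> inv g) ` carrier G) (BijGroup (carrier G))"
    using group_action.group_hom[OF action_by_conjugation] subgroup_self
    by (rule group_hom.subgroup_img_is_subgroup)
  then have "subgroup (Inn G) (BijGroup (carrier G))"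
    by (simp add: Inn_def)
  then show "subgroup (Inn G) (AutoGroup G)"
    unfolding AutoGroup_def
    by (rule group.subgroup_incl[OF group_BijGroup _ subgroup_auto Inn_subset_auto])
next
  fix \<alpha> \<iota> assume a: "\<alpha> \<in> carrier (AutoGroup G)" and "\<iota> \<in> Inn G"
  then obtain g where g: "g \<in> carrier G" and i: "\<iota> = (\<lambda>h\<in>carrier G. g \<otimes> h \<otimes> inv g)"
    by (auto simp: Inn_def)
  interpret A: group "AutoGroup G" by (rule AutoGroup)
  let ?\<kappa> = "\<lambda>h\<in>carrier G. \<alpha> g \<otimes> h \<otimes> inv (\<alpha> g)"
  have a': "\<alpha> \<in> auto G" using a by (simp add: AutoGroup_simps)
  interpret a: group_hom G G \<alpha> by (rule auto_group_hom[OF a'])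
  have k: "?\<kappa> \<in> Inn G" using g by (auto simp: Inn_def)
  have ia: "\<iota> \<in> auto G" "?\<kappa> \<in> auto G" using k \<open>\<iota> \<in> Inn G\<close> Inn_subset_auto by blast+
  have "\<alpha> \<otimes>\<^bsub>AutoGroup G\<^esub> \<iota> = ?\<kappa> \<otimes>\<^bsub>AutoGroup G\<^esub> \<alpha>"
    unfolding AutoGroup_simps(2)[OF a' ia(1)] AutoGroup_simps(2)[OF ia(2) a'] compose_def
    by (rule restrict_ext) (use g in \<open>simp add: i\<close>)
  moreover have "\<alpha> \<in> carrier (AutoGroup G)" "?\<kappa> \<in> carrier (AutoGroup G)"
    using a ia unfolding AutoGroup_simps(1) by blast+
  ultimately have "\<alpha> \<otimes>\<^bsub>AutoGroup G\<^esub> \<iota> \<otimes>\<^bsub>AutoGroup G\<^esub> inv\<^bsub>AutoGroup G\<^esub> \<alpha> = ?\<kappa>"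
    by (metis A.inv_solve_right' A.m_closed)
  then show "\<alpha> \<otimes>\<^bsub>AutoGroup G\<^esub> \<iota> \<otimes>\<^bsub>AutoGroup G\<^esub> inv\<^bsub>AutoGroup G\<^esub> \<alpha> \<in> Inn G"
    using k by simp
qed

lemma group_OutGroup: "group (OutGroup G)"
  unfolding OutGroup_def by (rule normal.factorgroup_is_group[OF Inn_normal])

lemma auto_image_normal:
  assumes a: "\<alpha> \<in> auto G" and N: "N \<lhd> G" shows "\<alpha> ` N \<lhd> G"
proof (rule normal_invI)
  interpret a: group_hom G G \<alpha> by (rule auto_group_hom[OF a])
  show "subgroup (\<alpha> ` N) G"
    by (rule a.subgroup_img_is_subgroup[OF normal_imp_subgroup[OF N]])
  fix x h assume x: "x \<in> carrier G" and "h \<in> \<alpha> ` N"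
  then obtain k where k: "k \<in> N" "h = \<alpha> k" by (elim imageE)
  obtain y where y: "y \<in> carrier G" "x = \<alpha> y"
    using x bij_betw_imp_surj_on[OF auto_bij[OF a]] by (metis imageE)
  have kc: "k \<in> carrier G"
    by (rule subgroup.mem_carrier[OF normal_imp_subgroup[OF N] k(1)])
  have "x \<otimes> h \<otimes> inv x = \<alpha> (y \<otimes> k \<otimes> inv y)"
    unfolding y(2) k(2) using y(1) kc by simp
  moreover have "y \<otimes> k \<otimes> inv y \<in> N" using N[unfolded normal_inv_iff] k(1) y(1) by simp
  ultimately show "x \<otimes> h \<otimes> inv x \<in> \<alpha> ` N" by blast
qed

lemma normal_subset: "N \<lhd> G \<Longrightarrow> N \<subseteq> carrier G"
  using normal_imp_subgroup subgroup.subset by blast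

lemma Inn_image:
  assumes i: "\<iota> \<in> Inn G" and N: "N \<lhd> G" shows "\<iota> ` N = N"
proof -
  obtain g where g: "g \<in> carrier G" and i: "\<iota> = (\<lambda>h\<in>carrier G. g \<otimes> h \<otimes> inv g)"
    using i by (auto simp: Inn_def)
  note sub = normal_subset[OF N]
  have conj: "x \<otimes> h \<otimes> inv x \<in> N" if "x \<in> carrier G" "h \<in> N" for x h
    using that N normal_inv_iff by blast
  have "h \<in> \<iota> ` N" if h: "h \<in> N" for h
  proof
    show *: "inv g \<otimes> h \<otimes> g \<in> N" using conj[of "inv g" h] g h by simp
    show "h = \<iota> (inv g \<otimes> h \<otimes> g)"
      using conjugation_is_surj[OF g, of h] sub h * g by (auto simp: i)
  qed
  moreover have "\<iota> ` N \<subseteq> N" using sub g conj by (auto simp: i)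
  ultimately show ?thesis by blast
qed

lemma compose_image: "N \<lhd> G \<Longrightarrow> compose (carrier G) \<alpha> \<beta> ` N = \<alpha> ` \<beta> ` N"
  using normal_subset[of N] by (force simp: compose_def image_iff)

lemma out_action_coset:
  assumes a: "\<alpha> \<in> auto G" and N: "N \<lhd> G"
  shows "out_action G (Inn G #>\<^bsub>AutoGroup G\<^esub> \<alpha>) N = \<alpha> ` N"
proof -
  have "\<beta> ` N = \<alpha> ` N" if "\<beta> \<in> Inn G #>\<^bsub>AutoGroup G\<^esub> \<alpha>" for \<beta>
  proof -
    obtain \<iota> where i: "\<iota> \<in> Inn G" "\<beta> = \<iota> \<otimes>\<^bsub>AutoGroup G\<^esub> \<alpha>"
      using \<open>\<beta> \<in> _\<close> by (auto simp: r_coset_def)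
    then have "\<beta> = compose (carrier G) \<iota> \<alpha>"
      using a Inn_subset_auto by (auto simp: AutoGroup_simps)
    then show ?thesis
      using i N a by (simp add: compose_image Inn_image auto_image_normal)
  qed
  moreover have "\<alpha> \<in> Inn G #>\<^bsub>AutoGroup G\<^esub> \<alpha>"
    using a group.rcos_self[OF AutoGroup _ normal_imp_subgroup[OF Inn_normal]]
    by (simp add: AutoGroup_simps)
  ultimately have "(\<lambda>\<beta>. \<beta> ` N) ` (Inn G #>\<^bsub>AutoGroup G\<^esub> \<alpha>) = {\<alpha> ` N}"
    by blast
  then show ?thesis using N by (simp add: out_action_def)
qed

lemma OutGroup_cases:
  assumes "c \<in> carrier (OutGroup G)"
  obtains \<alpha> where "\<alpha> \<in> auto G" "c = Inn G #>\<^bsub>AutoGroup G\<^esub> \<alpha>"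
  using assms by (auto simp: OutGroup_def carrier_FactGroup AutoGroup_simps)

lemma out_action_closed:
  "c \<in> carrier (OutGroup G) \<Longrightarrow> N \<lhd> G \<Longrightarrow> out_action G c N \<lhd> G"
  by (metis OutGroup_cases out_action_coset auto_image_normal)

lemma out_action_mult:
  assumes "c \<in> carrier (OutGroup G)" "d \<in> carrier (OutGroup G)" and N: "N \<lhd> G"
  shows "out_action G (c \<otimes>\<^bsub>OutGroup G\<^esub> d) N = out_action G c (out_action G d N)"
proof -
  obtain \<alpha> \<beta> where a: "\<alpha> \<in> auto G" "c = Inn G #>\<^bsub>AutoGroup G\<^esub> \<alpha>"
    and b: "\<beta> \<in> auto G" "d = Inn G #>\<^bsub>AutoGroup G\<^esub> \<beta>"
    using assms by (meson OutGroup_cases)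
  have "c \<otimes>\<^bsub>OutGroup G\<^esub> d = Inn G #>\<^bsub>AutoGroup G\<^esub> (\<alpha> \<otimes>\<^bsub>AutoGroup G\<^esub> \<beta>)"
    using a b normal.rcos_sum[OF Inn_normal] by (simp add: OutGroup_def AutoGroup_simps(1))
  moreover have "\<alpha> \<otimes>\<^bsub>AutoGroup G\<^esub> \<beta> \<in> auto G"
    using a b monoid.m_closed[OF group.is_monoid[OF AutoGroup]] AutoGroup_simps(1) by blast
  ultimately show ?thesis
    using a b N by (simp add: out_action_coset auto_image_normal AutoGroup_simps compose_image)
qed

lemma out_action_one:
  assumes N: "N \<lhd> G" shows "out_action G \<one>\<^bsub>OutGroup G\<^esub> N = N"
proof -
  have i: "(\<lambda>x\<in>carrier G. x) \<in> auto G" by (rule id_in_auto)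
  have s: "subgroup (Inn G) (AutoGroup G)" by (rule normal_imp_subgroup[OF Inn_normal])
  have "\<one>\<^bsub>OutGroup G\<^esub> = Inn G #>\<^bsub>AutoGroup G\<^esub> (\<lambda>x\<in>carrier G. x)"
    using group.coset_mult_one[OF AutoGroup subgroup.subset[OF s]]
    by (simp add: OutGroup_def AutoGroup_simps)
  then show ?thesis
    using N i normal_subset[OF N] by (force simp: out_action_coset)
qed

theorem group_action_out_action: "group_action (OutGroup G) {N. N \<lhd> G} (out_action G)"
proof -
  let ?E = "{N. N \<lhd> G}"
  interpret Out: group "OutGroup G" by (rule group_OutGroup)
  have bij: "out_action G c \<in> Bij ?E" if c: "c \<in> carrier (OutGroup G)" for c
  proof -
    let ?d = "inv\<^bsub>OutGroup G\<^esub> c"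
    have d: "?d \<in> carrier (OutGroup G)" using c by simp
    have "out_action G c (out_action G ?d N) = N" "out_action G ?d (out_action G c N) = N"
      if "N \<in> ?E" for N
      using out_action_mult[OF c d, of N] out_action_mult[OF d c, of N] that c out_action_one
      by auto
    then have "bij_betw (out_action G c) ?E ?E"
      by (intro bij_betwI[where g = "out_action G ?d"])
        (use c d out_action_closed in auto)
    then show ?thesis by (auto simp: Bij_def out_action_def)
  qed
  have "out_action G \<in> hom (OutGroup G) (BijGroup ?E)"
  proof (rule homI)
    fix c d assume cd: "c \<in> carrier (OutGroup G)" "d \<in> carrier (OutGroup G)"
    then have "out_action G (c \<otimes>\<^bsub>OutGroup G\<^esub> d) = compose ?E (out_action G c) (out_action G d)"
      using bij[of "c \<otimes>\<^bsub>OutGroup G\<^esub> d"]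
      by (intro extensionalityI[where A = ?E]) (auto simp: Bij_def compose_def out_action_mult)
    then show "out_action G (c \<otimes>\<^bsub>OutGroup G\<^esub> d) =
        out_action G c \<otimes>\<^bsub>BijGroup ?E\<^esub> out_action G d"
      using cd bij by (simp add: BijGroup_def)
  qed (use bij in \<open>simp add: BijGroup_def\<close>)
  then show ?thesis
    by (simp add: group_action_def group_hom_def group_hom_axioms_def group_BijGroup group_OutGroup)
qed

end


section \<open>The space of marked groups\<close>

text \<open>A subset of \<open>carrier G\<close> is identified with its indicator function, a point of the product
  of copies of the discrete two-point space indexed by \<open>carrier G\<close>.\<close>

definition normal_subgroup_space :: "('a, 'b) monoid_scheme \<Rightarrow> 'a set topology" where
  "normal_subgroup_space G =
    pullback_topology {N. N \<lhd> G} (\<lambda>N. \<lambda>g\<in>carrier G. g \<in> N)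
      (product_topology (\<lambda>_. discrete_topology (UNIV :: bool set)) (carrier G))"

text \<open>The isomorphism class of \<open>(G, (x\<^sub>1, \<dots>, x\<^sub>n))\<close> is represented by the kernel of the
  homomorphism from the free group of rank \<open>n\<close> to \<open>G\<close> that maps the basis to \<open>(x\<^sub>1, \<dots>, x\<^sub>n)\<close>.\<close>

definition marked_group_space :: "nat \<Rightarrow> letter list set topology" where
  "marked_group_space n = normal_subgroup_space (free_group n)"

lemma topspace_normal_subgroup_space [simp]:
  "topspace (normal_subgroup_space G) = {N. N \<lhd> G}"
  by (auto simp: normal_subgroup_space_def topspace_pullback_topology)

lemma (in group) continuous_map_out_action:
  assumes "c \<in> carrier (OutGroup G)"
  shows "continuous_map (normal_subgroup_space G) (normal_subgroup_space G) (out_action G c)"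
proof -
  obtain \<alpha> where a: "\<alpha> \<in> auto G" "c = Inn G #>\<^bsub>AutoGroup G\<^esub> \<alpha>"
    using assms OutGroup_cases by blast
  let ?P = "product_topology (\<lambda>_. discrete_topology (UNIV :: bool set)) (carrier G)"
  let ?\<chi> = "\<lambda>N. \<lambda>g\<in>carrier G. g \<in> N"
  let ?\<beta> = "inv_into (carrier G) \<alpha>"
  have b: "?\<beta> g \<in> carrier G" "\<alpha> (?\<beta> g) = g" if "g \<in> carrier G" for g
    using that auto_bij[OF a(1)] by (auto simp: bij_betw_def inv_into_into f_inv_into_f)
  have mem: "g \<in> out_action G c N \<longleftrightarrow> ?\<beta> g \<in> N" if g: "g \<in> carrier G" and N: "N \<lhd> G" for g N
  proof -
    have "g \<in> \<alpha> ` N \<longleftrightarrow> ?\<beta> g \<in> N"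
      using auto_bij[OF a(1)] normal_subset[OF N] b[OF g]
      by (force simp: bij_betw_def inv_into_f_f image_iff)
    then show ?thesis using a N by (simp add: out_action_coset)
  qed
  have "continuous_map (normal_subgroup_space G) (discrete_topology UNIV) (\<lambda>N. g \<in> N)"
    if "g \<in> carrier G" for g
  proof -
    have "continuous_map (normal_subgroup_space G) (discrete_topology UNIV) ((\<lambda>f. f g) \<circ> ?\<chi>)"
      unfolding normal_subgroup_space_def using that
      by (intro continuous_map_pullback continuous_map_product_projection)
    then show ?thesis by (rule continuous_map_eq) (use that in simp)
  qed
  then have "continuous_map (normal_subgroup_space G) ?P (\<lambda>N. \<lambda>g\<in>carrier G. ?\<beta> g \<in> N)"
    using b by (auto simp: continuous_map_componentwise intro: continuous_map_eq)
  then have "continuous_map (normal_subgroup_space G) ?P (?\<chi> \<circ> out_action G c)"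
    by (rule continuous_map_eq) (auto simp: mem fun_eq_iff)
  then show ?thesis
    unfolding normal_subgroup_space_def[of G]
    apply (rule continuous_map_pullback')
    using out_action_closed[OF assms] by (auto simp: topspace_pullback_topology)
qed


section \<open>Subsystems and invariant probability measures\<close>

definition subsystem ::
  "('g, 'm) monoid_scheme \<Rightarrow> ('g \<Rightarrow> 'z \<Rightarrow> 'z) \<Rightarrow> 'z topology \<Rightarrow> 'z set \<Rightarrow> bool" where
  "subsystem \<Gamma> \<phi> T Z \<longleftrightarrow> Z \<noteq> {} \<and> closedin T Z \<and> (\<forall>g\<in>carrier \<Gamma>. \<phi> g ` Z = Z)"

definition borel_algebra :: "'z topology \<Rightarrow> 'z set set" where
  "borel_algebra T = sigma_sets (topspace T) {U. openin T U}"

definition invariant_prob_measure ::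
  "('g, 'm) monoid_scheme \<Rightarrow> ('g \<Rightarrow> 'z \<Rightarrow> 'z) \<Rightarrow> 'z topology \<Rightarrow> 'z measure \<Rightarrow> bool" where
  "invariant_prob_measure \<Gamma> \<phi> T \<mu> \<longleftrightarrow>
    prob_space \<mu> \<and> space \<mu> = topspace T \<and> sets \<mu> = borel_algebra T \<and>
    (\<forall>g\<in>carrier \<Gamma>. \<forall>A\<in>borel_algebra T. emeasure \<mu> (\<phi> g ` A) = emeasure \<mu> A)"

end

theory Submission
  imports Defs "HOL-Library.Poly_Mapping" "HOL-Library.Multiset"
begin

text \<open>Fix rationally independent reals and let \<open>height\<close> be the resulting injective homomorphism from
  the abelianisation of the free group to the reals. The sign pattern of the heights of the first two
  elements of a basis is a paradoxical colouring of the set of bases: one of \<open>(x, y)\<close> and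
  \<open>(x, y\<inverse>)\<close> has equal signs, but at most one of \<open>(x y\<inverse>, y)\<close>, \<open>(y x\<inverse>, x)\<close> and
  \<open>(x y, y\<inverse>)\<close> has. It therefore suffices to find a word \<open>w\<close> and a normal subgroup \<open>N\<close> such that
  \<open>\<alpha> w \<in> N\<close> holds exactly if \<open>\<alpha>\<close> maps the first two generators to elements with heights of
  equal sign: the local rules of the colouring are closed conditions on a normal subgroup, and no
  measure on the subsystem they define is invariant.

  To construct \<open>N\<close>, represent the free group by operators on the tensor product of two exterior
  algebras over the group ring of the reals. An iterated commutator of the elements
  \<open>[x\<^sub>0, x\<^sub>j]\<close> and their conjugates by \<open>x\<^sub>0\<close> acts by its leading term, which is a Laurent
  polynomial in the height of \<open>x\<^sub>0\<close> times \<open>\<Delta>\<close> times the conjugate of \<open>\<Delta>\<close>, where \<open>\<Delta>\<close> is a minor of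
  the Fox Jacobian. For a basis, \<open>\<Delta>\<close> is known up to a unit, and units of the group ring are signed
  monomials, so this leading term depends only on the height of \<open>x\<^sub>0\<close>. An additive functional of the
  leading term reads off the sign of the height.\<close>

section \<open>The group ring of the reals\<close>

type_synonym real_group_ring = "real \<Rightarrow>\<^sub>0 int"

abbreviation tpow :: "real \<Rightarrow> real_group_ring" where
  "tpow r \<equiv> Poly_Mapping.single r 1"

lemma tpow_mult: "tpow r * tpow s = tpow (r + s)"
  by (simp add: mult_single)

lemma tpow_mult_left: "tpow r * (tpow s * z) = tpow (r + s) * z"
  by (metis tpow_mult mult.assoc)

lemma tpow_eq_one_iff: "tpow r = 1 \<longleftrightarrow> r = 0"
  by (metis keys_single one_neq_zero single_one singleton_inject)

text \<open>Differences of basis elements reach 0 and then every element, so an additive identity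
  need only be checked on \<open>tpow r\<close>.\<close>

lemma group_ring_induct [case_names tpow diff]:
  fixes z :: real_group_ring
  assumes "\<And>r. P (tpow r)" and diff: "\<And>x y. P x \<Longrightarrow> P y \<Longrightarrow> P (x - y)"
  shows "P z"
proof -
  have "P 0" using diff[OF assms(1) assms(1), of 0 0] by simp
  then show ?thesis
    by (rule frag_induction[where S = UNIV, OF subset_UNIV]) (use assms in auto)
qed

text \<open>The involution that inverts group elements. Additively the group ring is the free
  abelian group on the reals, so \<open>frag_extend\<close> extends a map of basis elements.\<close>

definition bar :: "real_group_ring \<Rightarrow> real_group_ring" where
  "bar = frag_extend (\<lambda>r. tpow (- r))"

lemma bar_tpow [simp]: "bar (tpow r) = tpow (- r)"
  by (simp add: bar_def)

lemma bar_diff: "bar (x - y) = bar x - bar y"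
  by (simp add: bar_def frag_extend_diff)

lemma bar_0 [simp]: "bar 0 = 0"
  by (simp add: bar_def)

lemma bar_1 [simp]: "bar 1 = 1"
  using bar_tpow[of 0] by simp

lemma bar_minus: "bar (- x) = - bar x"
  using bar_diff[of 0 x] by simp

lemma bar_add: "bar (x + y) = bar x + bar y"
  using bar_diff[of x "- y"] by (simp add: bar_minus)

lemma bar_mult: "bar (x * y) = bar x * bar y"
proof (induction x rule: group_ring_induct)
  case (tpow r)
  show ?case
    by (induction y rule: group_ring_induct)
      (simp_all add: tpow_mult bar_diff right_diff_distrib)
next
  case (diff x y)
  then show ?case by (simp add: bar_diff left_diff_distrib)
qed

lemma bar_sum: "bar (sum f A) = (\<Sum>a\<in>A. bar (f a))"
  by (induction A rule: infinite_finite_induct) (simp_all add: bar_add)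

lemma bar_power: "bar (x ^ k) = bar x ^ k"
  by (induction k) (simp_all add: bar_mult)

text \<open>Under these bounds \<open>(M, N)\<close> is the only pair of exponents with sum
  \<open>M + N\<close>. The bounds may fail to be attained, in which case both sides are 0.\<close>

lemma lookup_mult_Max:
  fixes x y :: real_group_ring
  assumes "\<And>k. k \<in> Poly_Mapping.keys x \<Longrightarrow> k \<le> M" "\<And>k. k \<in> Poly_Mapping.keys y \<Longrightarrow> k \<le> N"
  shows "Poly_Mapping.lookup (x * y) (M + N) = Poly_Mapping.lookup x M * Poly_Mapping.lookup y N"
proof -
  have eq: "Sum_any (\<lambda>q. Poly_Mapping.lookup y q when M + N = k + q) = (Poly_Mapping.lookup y N when k = M)"
    if "k \<in> Poly_Mapping.keys x" for k
  proof -
    have "(Poly_Mapping.lookup y q when M + N = k + q) = ((Poly_Mapping.lookup y N when k = M) when q = N)" for q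
    proof (cases "q \<in> Poly_Mapping.keys y")
      case True
      then show ?thesis using assms(1)[OF that] assms(2)[OF True] by (auto simp: when_def)
    next
      case False
      then show ?thesis by (auto simp: when_def in_keys_iff)
    qed
    then show ?thesis by simp
  qed
  have "Poly_Mapping.lookup (x * y) (M + N) =
      Sum_any (\<lambda>k. Poly_Mapping.lookup x k * Sum_any (\<lambda>q. Poly_Mapping.lookup y q when M + N = k + q))"
    by (rule lookup_mult)
  also have "\<dots> = Sum_any (\<lambda>k. Poly_Mapping.lookup x k * (Poly_Mapping.lookup y N when k = M))"
  proof (rule arg_cong[where f = Sum_any], rule ext)
    fix k
    show "Poly_Mapping.lookup x k * Sum_any (\<lambda>q. Poly_Mapping.lookup y q when M + N = k + q) =
        Poly_Mapping.lookup x k * (Poly_Mapping.lookup y N when k = M)"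
      using eq[of k] by (cases "k \<in> Poly_Mapping.keys x") (auto simp: in_keys_iff)
  qed
  also have "\<dots> = Poly_Mapping.lookup x M * Poly_Mapping.lookup y N"
    by (simp add: mult_when)
  finally show ?thesis .
qed

lemma keys_bar: "Poly_Mapping.keys (bar x) = uminus ` Poly_Mapping.keys x"
proof -
  have sub: "Poly_Mapping.keys (bar x) \<subseteq> uminus ` Poly_Mapping.keys x" for x
    using keys_frag_extend[of "\<lambda>r. tpow (- r)" x] by (auto simp: bar_def)
  have invol: "bar (bar x) = x"
    by (induction x rule: group_ring_induct) (simp_all add: bar_diff)
  have "uminus ` Poly_Mapping.keys x \<subseteq> uminus ` uminus ` Poly_Mapping.keys (bar x)"
    using sub[of "bar x"] by (simp add: invol image_mono)
  then show ?thesis using sub[of x] by (auto simp: image_image)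
qed

text \<open>The units of the group ring of an ordered group are the signed group elements: compare the
  largest and the smallest exponents in \<open>x * y = 1\<close>.\<close>

lemma unit_mult_bar:
  fixes x y :: real_group_ring
  assumes "x * y = 1"
  shows "x * bar x = 1"
proof -
  let ?K = "\<lambda>x::real_group_ring. Poly_Mapping.keys x"
  have nz: "x \<noteq> 0" "y \<noteq> 0" using assms by auto
  then have ne: "?K x \<noteq> {}" "?K y \<noteq> {}" by simp_all
  have top: "Max (?K x) + Max (?K y) = 0 \<and>
      Poly_Mapping.lookup x (Max (?K x)) * Poly_Mapping.lookup y (Max (?K y)) = 1"
    if xy: "x * y = 1" and ne: "?K x \<noteq> {}" "?K y \<noteq> {}" for x y :: real_group_ring
  proof -
    have "Poly_Mapping.lookup (x * y) (Max (?K x) + Max (?K y)) =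
        Poly_Mapping.lookup x (Max (?K x)) * Poly_Mapping.lookup y (Max (?K y))"
      by (rule lookup_mult_Max) simp_all
    moreover have "Poly_Mapping.lookup x (Max (?K x)) \<noteq> 0" "Poly_Mapping.lookup y (Max (?K y)) \<noteq> 0"
      using Max_in[OF finite_keys ne(1)] Max_in[OF finite_keys ne(2)] by (simp_all add: in_keys_iff)
    \<comment> \<open>The product has a nonzero coefficient at the sum of the maxima, and 0 is the
      only exponent occurring in 1.\<close>
    ultimately show ?thesis
      unfolding xy lookup_one by (auto simp: when_def split: if_splits)
  qed
  have min: "Max (uminus ` ?K x) = - Min (?K x)" if "?K x \<noteq> {}" for x
    using that
    by (intro Max_eqI) auto
  \<comment> \<open>\<open>bar\<close> turns minima into maxima, so the minima also sum to 0;
    together with the maxima this leaves a single exponent.\<close>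
  have "bar x * bar y = 1" using assms by (metis bar_1 bar_mult)
  moreover have "?K (bar x) \<noteq> {}" "?K (bar y) \<noteq> {}" unfolding keys_bar using ne by blast+
  ultimately have "Max (?K (bar x)) + Max (?K (bar y)) = 0" using top by blast
  then have "Min (?K x) + Min (?K y) = 0"
    unfolding keys_bar min[OF ne(1)] min[OF ne(2)] by linarith
  moreover have "Min (?K x) \<le> Max (?K x)" "Min (?K y) \<le> Max (?K y)"
    using ne by simp_all
  ultimately have MM: "Min (?K x) = Max (?K x)"
    using top[OF assms ne] by linarith
  define r where "r = Max (?K x)"
  have "k = r" if "k \<in> ?K x" for k
    using Max_ge[OF finite_keys that] Min_le[OF finite_keys that] MM by (simp add: r_def)
  then have x: "x = Poly_Mapping.single r (Poly_Mapping.lookup x r)"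
    by (intro poly_mapping_eqI) (auto simp only: lookup_single when_def in_keys_iff split: if_splits)
  have "Poly_Mapping.lookup x r = 1 \<or> Poly_Mapping.lookup x r = - 1"
    using top[OF assms ne] zmult_eq_1_iff unfolding r_def by blast
  then show ?thesis
  proof
    assume 1: "Poly_Mapping.lookup x r = 1"
    have "x = tpow r" by (rule trans[OF x], unfold 1, rule refl)
    then show ?thesis by (simp add: tpow_mult)
  next
    assume 1: "Poly_Mapping.lookup x r = - 1"
    have "x = - tpow r" by (rule trans[OF x], unfold 1 single_uminus, rule refl)
    then show ?thesis by (simp add: bar_minus tpow_mult)
  qed
qed

section \<open>Additive functionals on the group ring\<close>

definition fsum :: "(real \<Rightarrow> int) \<Rightarrow> real_group_ring \<Rightarrow> int" where
  "fsum f z = (\<Sum>k\<in>Poly_Mapping.keys z. Poly_Mapping.lookup z k * f k)"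

lemma fsum_superset:
  "finite A \<Longrightarrow> Poly_Mapping.keys z \<subseteq> A \<Longrightarrow> fsum f z = (\<Sum>k\<in>A. Poly_Mapping.lookup z k * f k)"
  unfolding fsum_def by (rule sum.mono_neutral_left) (simp_all add: not_in_keys_iff_lookup_eq_zero[symmetric])

lemma fsum_diff: "fsum f (x - y) = fsum f x - fsum f y"
proof -
  let ?A = "Poly_Mapping.keys x \<union> Poly_Mapping.keys y"
  have "Poly_Mapping.keys (x - y) \<subseteq> ?A" by (rule keys_diff)
  then have "fsum f (x - y) = (\<Sum>k\<in>?A. Poly_Mapping.lookup (x - y) k * f k)"
    by (intro fsum_superset) simp_all
  also have "\<dots> = (\<Sum>k\<in>?A. Poly_Mapping.lookup x k * f k) - (\<Sum>k\<in>?A. Poly_Mapping.lookup y k * f k)"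
    by (simp only: lookup_minus left_diff_distrib sum_subtractf)
  also have "\<dots> = fsum f x - fsum f y"
    using fsum_superset[of ?A x f] fsum_superset[of ?A y f] by simp
  finally show ?thesis .
qed

lemma fsum_0 [simp]: "fsum f 0 = 0"
  by (simp add: fsum_def)

lemma fsum_minus: "fsum f (- x) = - fsum f x"
  using fsum_diff[of f 0 x] by simp

lemma fsum_add: "fsum f (x + y) = fsum f x + fsum f y"
  using fsum_diff[of f x "- y"] by (simp add: fsum_minus)

lemma fsum_tpow [simp]: "fsum f (tpow r) = f r"
  by (simp add: fsum_def)

lemma fsum_tpow_mult: "fsum f (tpow s * z) = fsum (\<lambda>k. f (s + k)) z"
  by (induction z rule: group_ring_induct) (simp_all only: tpow_mult right_diff_distrib fsum_diff fsum_tpow)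

lemma fsum_fun_diff: "fsum (\<lambda>k. f k - g k) z = fsum f z - fsum g z"
  by (simp add: fsum_def right_diff_distrib sum_subtractf)

lemma fsum_fun_add: "fsum (\<lambda>k. f k + g k) z = fsum f z + fsum g z"
  by (simp add: fsum_def distrib_left sum.distrib)

definition pos :: "real \<Rightarrow> int" where
  "pos k = (if k > 0 then 1 else 0)"

text \<open>Summing against \<open>second_sum\<close> cancels the factor \<open>(t - 1) (t\<inverse> - 1)\<close> that the minors of
  the Fox Jacobian contribute.\<close>

definition second_sum :: "real \<Rightarrow> int" where
  "second_sum k = (if k > 0 then - (\<lceil>k\<rceil> * (\<lceil>k\<rceil> - 1) div 2) else 0)"

text \<open>For \<open>k > 0\<close> the value \<open>second_sum k\<close> is minus a binomial
  coefficient with lower index 2, whose second difference is constant; the point is the transition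
  at \<open>k = 0\<close>.\<close>

lemma second_sum_diff: "2 * second_sum k - second_sum (k + 1) - second_sum (k - 1) = pos k"
proof (cases "k > 0")
  case True
  define i where "i = \<lceil>k\<rceil>"
  have i: "i \<ge> 1" "\<lceil>k + 1\<rceil> = i + 1" "\<lceil>k - 1\<rceil> = i - 1" "k - 1 > 0 \<or> i = 1"
    using True unfolding i_def by linarith+
  have d: "(j + 1) * j div 2 = j * (j - 1) div 2 + j" for j :: int
  proof -
    have "(j + 1) * j = j * (j - 1) + j * 2" by (simp add: algebra_simps)
    then show ?thesis by simp
  qed
  \<comment> \<open>If \<open>i = 1\<close>, then \<open>k - 1\<close> is at most 0, and the default
    value 0 agrees with the formula.\<close>
  have b: "second_sum (k - 1) = - ((i - 1) * (i - 2) div 2)"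
    using i by (auto simp: second_sum_def)
  have "second_sum k = - (i * (i - 1) div 2)" "second_sum (k + 1) = - ((i + 1) * i div 2)"
    using i True by (simp_all add: second_sum_def i_def[symmetric])
  then show ?thesis
    using True b d[of i] d[of "i - 1"] by (simp add: pos_def)
next
  case False
  have "\<lceil>k + 1\<rceil> = 1" if "k + 1 > 0" using that False by linarith
  then show ?thesis using False by (auto simp: second_sum_def pos_def)
qed

text \<open>With \<open>t = tpow 1\<close> the factor is \<open>2 - t - t\<inverse>\<close>, and
  multiplying by it is dual to taking the negative second difference of the function summed
  against.\<close>

lemma fsum_second_sum:
  "fsum second_sum ((tpow 1 - 1) * bar (tpow 1 - 1) * z) = fsum pos z"
proof -
  have "(tpow 1 - 1) * bar (tpow 1 - 1) = 2 - tpow 1 - tpow (- 1)"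
    by (simp add: bar_diff algebra_simps tpow_mult)
  then have eq: "(tpow 1 - 1) * bar (tpow 1 - 1) * z = (z + z) - tpow 1 * z - tpow (- 1) * z"
    by (simp only:) (simp add: algebra_simps)
  have "fsum second_sum ((tpow 1 - 1) * bar (tpow 1 - 1) * z) =
      fsum (\<lambda>k. second_sum k + second_sum k - second_sum (1 + k) - second_sum (- 1 + k)) z"
    unfolding eq fsum_diff fsum_add fsum_tpow_mult fsum_fun_diff fsum_fun_add ..
  moreover have "(\<lambda>k. second_sum k + second_sum k - second_sum (1 + k) - second_sum (- 1 + k)) = pos"
  proof
    show "second_sum k + second_sum k - second_sum (1 + k) - second_sum (- 1 + k) = pos k" for k
      using second_sum_diff[of k] by (simp add: add.commute)
  qed
  ultimately show ?thesis by (simp only:)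
qed

lemma lookup_bar: "Poly_Mapping.lookup (bar x) k = Poly_Mapping.lookup x (- k)"
proof (induction x rule: group_ring_induct)
  case (tpow r)
  show ?case by (auto simp: lookup_single when_def)
qed (simp add: bar_diff lookup_minus)

lemma fsum_cong:
  "(\<And>k. k \<in> Poly_Mapping.keys z \<Longrightarrow> f k = g k) \<Longrightarrow> fsum f z = fsum g z"
  unfolding fsum_def by (rule sum.cong) auto

lemma fsum_delta: "fsum (\<lambda>j. if j = k then 1 else 0) z = Poly_Mapping.lookup z k"
proof (induction z rule: group_ring_induct)
  case (tpow r)
  show ?case by (simp add: lookup_single when_def)
qed (simp add: fsum_diff lookup_minus)

lemma lookup_power_Max:
  fixes x :: real_group_ring
  assumes "\<And>k. k \<in> Poly_Mapping.keys x \<Longrightarrow> k \<le> M" "Poly_Mapping.lookup x M = 1"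
  shows "(\<forall>k\<in>Poly_Mapping.keys (x ^ m). k \<le> real m * M) \<and> Poly_Mapping.lookup (x ^ m) (real m * M) = 1"
proof (induction m)
  case (Suc m)
  have "k \<le> M + real m * M" if "k \<in> Poly_Mapping.keys (x * x ^ m)" for k
  proof -
    from that obtain a b where "k = a + b" "a \<in> Poly_Mapping.keys x" "b \<in> Poly_Mapping.keys (x ^ m)"
      using keys_mult[of x "x ^ m"] by auto
    then show ?thesis using assms(1)[of a] Suc by (auto intro: add_mono)
  qed
  moreover have "Poly_Mapping.lookup (x * x ^ m) (M + real m * M) = 1"
    using lookup_mult_Max[of x M "x ^ m" "real m * M"] assms Suc by simp
  moreover have "real (Suc m) * M = M + real m * M" by (simp add: algebra_simps)
  ultimately show ?case by simp
qed (simp add: keys_one lookup_one)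

section \<open>Exterior products and minors\<close>

definition wedge_sign :: "nat \<Rightarrow> nat set \<Rightarrow> 'a::comm_ring_1" where
  "wedge_sign i S = (- 1) ^ card {j \<in> S. j < i}"

text \<open>Left exterior multiplication by the vector \<open>a\<close>. Elements of the exterior
  algebra are given by their coefficients at increasing products of basis vectors; at infinite
  \<open>S\<close> the sum defaults to 0.\<close>

definition wedge :: "(nat \<Rightarrow> 'a) \<Rightarrow> (nat set \<Rightarrow> 'a) \<Rightarrow> nat set \<Rightarrow> 'a::comm_ring_1" where
  "wedge a v S = (\<Sum>i\<in>S. wedge_sign i S * a i * v (S - {i}))"

lemma wedge_infinite: "infinite S \<Longrightarrow> wedge a v S = 0"
  by (simp add: wedge_def)

text \<open>For \<open>i < j\<close>, deleting \<open>i\<close> flips the sign of \<open>j\<close>,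
  while deleting \<open>j\<close> leaves the sign of \<open>i\<close> unchanged.\<close>

lemma wedge_sign_swap:
  assumes "finite S" "i \<in> S" "j \<in> S" "i \<noteq> j"
  shows "wedge_sign i S * wedge_sign j (S - {i}) = - (wedge_sign j S * wedge_sign i (S - {j}) :: 'a::comm_ring_1)"
proof -
  have less: "wedge_sign i S * wedge_sign j (S - {i}) = - (wedge_sign j S * wedge_sign i (S - {j}) :: 'a)"
    if "i \<in> S" "j \<in> S" "i < j" for i j
  proof -
    have "{k \<in> S. k < j} = insert i {k \<in> S - {i}. k < j}" using that by auto
    then have "wedge_sign j S = - (wedge_sign j (S - {i}) :: 'a)"
      using assms(1) by (simp add: wedge_sign_def)
    moreover have "{k \<in> S - {j}. k < i} = {k \<in> S. k < i}" using that by auto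
    then have "wedge_sign i (S - {j}) = (wedge_sign i S :: 'a)"
      by (simp add: wedge_sign_def)
    ultimately show ?thesis by (simp add: mult.commute)
  qed
  show ?thesis
    using less[OF assms(2,3)] less[OF assms(3,2)] assms(4) by (cases "i < j") auto
qed

text \<open>Both sides are sums over ordered pairs of distinct indices; exchanging the entries of
  the pair costs one sign.\<close>

lemma wedge_anticommute: "wedge a (wedge b v) S = - wedge b (wedge a v) S"
proof (cases "finite S")
  case True
  let ?P = "Sigma S (\<lambda>i. S - {i})"
  have exp: "wedge a (wedge b v) S =
      (\<Sum>(i, j)\<in>?P. wedge_sign i S * wedge_sign j (S - {i}) * (a i * b j * v (S - {i} - {j})))" for a b
    using True unfolding wedge_def
    by (subst sum.Sigma[symmetric]) (auto simp: sum_distrib_left mult_ac intro!: sum.cong)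
  have "wedge a (wedge b v) S =
      (\<Sum>(i, j)\<in>?P. wedge_sign j S * wedge_sign i (S - {j}) * (a j * b i * v (S - {j} - {i})))"
    unfolding exp by (rule sum.reindex_bij_witness[of _ prod.swap prod.swap]) auto
  also have "\<dots> = (\<Sum>(i, j)\<in>?P. - (wedge_sign i S * wedge_sign j (S - {i}) * (b i * a j * v (S - {i} - {j}))))"
  proof (rule sum.cong[OF refl])
    fix p assume "p \<in> ?P"
    then obtain i j where p: "p = (i, j)" "i \<in> S" "j \<in> S" "i \<noteq> j" by auto
    have "S - {j} - {i} = S - {i} - {j}" by auto
    then show "(case p of (i, j) \<Rightarrow> wedge_sign j S * wedge_sign i (S - {j}) * (a j * b i * v (S - {j} - {i}))) =
        (case p of (i, j) \<Rightarrow> - (wedge_sign i S * wedge_sign j (S - {i}) * (b i * a j * v (S - {i} - {j}))))"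
      using wedge_sign_swap[OF True p(3,2) p(4)[symmetric], where 'a = 'a] p(1)
      by (simp add: mult.assoc[symmetric])
  qed
  also have "\<dots> = - wedge b (wedge a v) S"
    unfolding exp by (simp add: case_prod_unfold sum_negf)
  finally show ?thesis .
qed (simp add: wedge_infinite)

lemma wedge_wedge_same: "wedge a (wedge a v) S = (0 :: 'a :: {idom, ring_char_0})"
  using wedge_anticommute[of a a v S] by simp

lemma wedge_sum_left:
  "wedge (\<lambda>i. \<Sum>j\<in>J. K j * a j i) v S = (\<Sum>j\<in>J. K j * wedge (a j) v S)"
  unfolding wedge_def sum_distrib_left sum_distrib_right
  by (subst sum.swap) (simp add: mult_ac)

lemma wedge_sum_right:
  "wedge a (\<lambda>S. \<Sum>j\<in>J. K j * v j S) S = (\<Sum>j\<in>J. K j * wedge a (v j) S)"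
  unfolding wedge_def sum_distrib_left sum_distrib_right
  by (subst sum.swap) (simp add: mult_ac)

lemma wedge_diff_left:
  "wedge (\<lambda>i. p * a i - q * b i) v S = p * wedge a v S - q * wedge b v S"
  by (simp add: wedge_def sum_distrib_left sum_subtractf[symmetric] algebra_simps)

lemma wedge_add_left: "wedge (\<lambda>i. a i + b i) v S = wedge a v S + wedge b v S"
  by (simp add: wedge_def sum.distrib[symmetric] algebra_simps)

lemma wedge_scale_left: "wedge (\<lambda>i. p * a i) v S = p * wedge a v S"
  by (simp add: wedge_def sum_distrib_left mult_ac)

lemma wedge_add_right: "wedge a (\<lambda>S. v S + w S) S = wedge a v S + wedge a w S"
  by (simp add: wedge_def sum.distrib[symmetric] algebra_simps)

lemma wedge_scale_right: "wedge a (\<lambda>S. p * v S) S = p * wedge a v S"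
  by (simp add: wedge_def sum_distrib_left mult_ac)

lemma foldr_wedge_scale: "foldr wedge as (\<lambda>S. p * v S) = (\<lambda>S. p * foldr wedge as v S)"
  by (induction as) (auto simp: wedge_scale_right)

lemma foldr_wedge_sum:
  "foldr wedge as (\<lambda>S. \<Sum>j\<in>J. K j * v j S) = (\<lambda>S. \<Sum>j\<in>J. K j * foldr wedge as (v j) S)"
  by (induction as) (auto simp: wedge_sum_right)

lemma foldr_wedge_diff:
  "foldr wedge as (\<lambda>S. p * v S - q * w S) = (\<lambda>S. p * foldr wedge as v S - q * foldr wedge as w S)"
  by (induction as)
    (auto simp: wedge_def sum_distrib_left sum_subtractf[symmetric] algebra_simps)

lemma wedge_foldr:
  "wedge a (foldr wedge bs v) = (\<lambda>S. (- 1) ^ length bs * foldr wedge bs (wedge a v) S)"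
proof (induction bs)
  case (Cons b bs)
  have "wedge a (wedge b (foldr wedge bs v)) = (\<lambda>S. - wedge b (wedge a (foldr wedge bs v)) S)"
    by (rule ext) (rule wedge_anticommute)
  then show ?case by (simp add: Cons wedge_scale_right)
qed simp

text \<open>For a list of \<open>d\<close> vectors and a set of \<open>d\<close> coordinates this is the determinant of the
  corresponding square matrix, in its Laplace expansion along the first row.\<close>

definition minor :: "(nat \<Rightarrow> 'a) list \<Rightarrow> nat set \<Rightarrow> 'a::comm_ring_1" where
  "minor as = foldr wedge as (\<lambda>S. if S = {} then 1 else 0)"

lemma minor_Nil: "minor [] S = (if S = {} then 1 else 0)"
  by (simp add: minor_def)

lemma minor_Cons: "minor (a # as) = wedge a (minor as)"
  by (simp add: minor_def)

lemma minor_append: "minor (as @ bs) = foldr wedge as (minor bs)"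
  by (simp add: minor_def)

lemma minor_move: "minor (as @ a # bs) S = (- 1) ^ length as * minor (a # as @ bs) S"
  by (simp add: minor_append minor_Cons wedge_foldr flip: power_add mult.assoc)

lemma minor_linear:
  "minor (as @ (\<lambda>i. \<Sum>j\<in>J. K j * b j i) # bs) S = (\<Sum>j\<in>J. K j * minor (as @ b j # bs) S)"
proof -
  have "wedge (\<lambda>i. \<Sum>j\<in>J. K j * b j i) (minor bs) = (\<lambda>S. \<Sum>j\<in>J. K j * wedge (b j) (minor bs) S)"
    by (rule ext) (rule wedge_sum_left)
  then show ?thesis by (simp add: minor_append minor_Cons foldr_wedge_sum)
qed

lemma minor_repeat:
  fixes a :: "nat \<Rightarrow> 'a::{idom, ring_char_0}"
  shows "minor (as @ a # bs @ a # cs) S = 0"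
proof -
  have "minor (a # as @ bs @ a # cs) T = 0" for T
  proof -
    have "wedge a (wedge a v) = (\<lambda>S. 0)" for v :: "nat set \<Rightarrow> 'a"
      by (rule ext) (rule wedge_wedge_same)
    moreover have "foldr wedge xs (\<lambda>S. 0::'a) = (\<lambda>S. 0)" for xs
      using foldr_wedge_scale[of xs 0 "\<lambda>S. 0"] by simp
    moreover have "minor (a # as @ bs @ a # cs) = wedge a (foldr wedge (as @ bs) (wedge a (minor cs)))"
      by (simp add: minor_Cons minor_append)
    ultimately show ?thesis by (simp add: wedge_foldr)
  qed
  then show ?thesis using minor_move[of as a "bs @ a # cs" S] by simp
qed

lemma minor_diff:
  fixes a :: "nat \<Rightarrow> 'a::{idom, ring_char_0}"
  shows "minor (as @ (\<lambda>i. p * a i - q * b i) # bs) S = p * minor (as @ a # bs) S - q * minor (as @ b # bs) S"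
proof -
  have "wedge (\<lambda>i. p * a i - q * b i) (minor bs) =
      (\<lambda>S. p * wedge a (minor bs) S - q * wedge b (minor bs) S)"
    by (rule ext) (rule wedge_diff_left)
  then show ?thesis by (simp add: minor_append minor_Cons foldr_wedge_diff)
qed

text \<open>Induction on \<open>as\<close>, moving its head to the front of \<open>bs\<close> by
  \<open>minor_move\<close>. One factor serves all coordinate sets.\<close>

lemma minor_perm:
  fixes as :: "(nat \<Rightarrow> 'a::comm_ring_1) list"
  assumes "mset as = mset bs"
  shows "\<exists>c. \<forall>S. minor as S = c * minor bs S"
  using assms
proof (induction as arbitrary: bs)
  case Nil
  then have "bs = []" by simp
  then show ?case by (intro exI[of _ 1]) simp
next
  case (Cons a as)
  then have "a \<in> set bs" by (metis list.set_intros(1) set_mset_mset)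
  then obtain us vs where bs: "bs = us @ a # vs" by (meson split_list)
  then have "mset as = mset (us @ vs)" using Cons.prems by simp
  then obtain c where c: "minor as S = c * minor (us @ vs) S" for S
    using Cons.IH by blast
  have sq: "(- 1) ^ length us * (- 1) ^ length us = (1::'a)"
    by (simp flip: power_add)
  have "minor (a # as) S = (c * (- 1) ^ length us) * minor bs S" for S
  proof -
    have "minor (a # as) S = wedge a (\<lambda>S. c * minor (us @ vs) S) S"
      unfolding minor_Cons using c by presburger
    also have "\<dots> = c * ((- 1) ^ length us * (- 1) ^ length us) * minor (a # us @ vs) S"
      unfolding sq minor_Cons wedge_scale_right by simp
    finally show ?thesis unfolding bs minor_move[of us] by (simp add: mult.assoc)
  qed
  then show ?case by blast
qed

text \<open>The exponent depends on the length alone, so a single sign serves all automorphisms in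
  \<open>chain_value\<close>.\<close>

lemma minor_rev:
  "\<exists>e. \<forall>(as :: (nat \<Rightarrow> 'a::comm_ring_1) list) S. length as = k \<longrightarrow> minor (rev as) S = (- 1) ^ e * minor as S"
proof (induction k)
  case 0
  show ?case by (auto intro: exI[of _ 0])
next
  case (Suc k)
  then obtain e where e: "length as = k \<Longrightarrow> minor (rev as) S = (- 1) ^ e * minor as S"
    for as :: "(nat \<Rightarrow> 'a) list" and S
    by blast
  have "minor (rev as) S = (- 1) ^ (k + e) * minor as S"
    if "length as = Suc k" for as :: "(nat \<Rightarrow> 'a) list" and S
  proof -
    obtain a bs where as: "as = a # bs" "length bs = k" using \<open>length as = Suc k\<close> by (cases as) auto
    have "minor (rev as) S = (- 1) ^ k * wedge a (minor (rev bs)) S"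
      using minor_move[of "rev bs" a "[]" S] as by (simp add: minor_Cons)
    also have "minor (rev bs) = (\<lambda>S. (- 1) ^ e * minor bs S)"
      using e[OF as(2)] by auto
    finally show ?thesis using as(1) by (simp add: wedge_scale_right minor_Cons power_add mult.assoc)
  qed
  then show ?case by blast
qed

text \<open>The divisibility contained in the product rule for determinants. Rows are expanded one
  at a time by linearity, and \<open>l\<close> lists the indices chosen so far. A repeated index
  gives 0; a full list without repetition is a permutation.\<close>

lemma minor_dvd:
  fixes a :: "nat \<Rightarrow> nat \<Rightarrow> 'a::{idom, ring_char_0}"
  assumes "length bs = n" and "\<forall>b\<in>set bs. \<exists>K. b = (\<lambda>i. \<Sum>j<n. K j * a j i)"
  shows "minor (map a [0..<n]) S dvd minor bs S"
proof -
  have "minor (map a [0..<n]) S dvd minor (map a l @ bs) S"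
    if "length l + length bs = n" "set l \<subseteq> {..<n}" "\<forall>b\<in>set bs. \<exists>K. b = (\<lambda>i. \<Sum>j<n. K j * a j i)" for l
    using that
  proof (induction bs arbitrary: l)
    case Nil
    show ?case
    proof (cases "distinct l")
      case True
      then have "set l = {..<n}"
        using Nil by (intro card_subset_eq) (auto simp: distinct_card)
      then have "mset l = mset [0..<n]"
        using True set_eq_iff_mset_eq_distinct[of l "[0..<n]"] by (simp add: atLeast0LessThan)
      then have "mset (map a l) = mset (map a [0..<n])" by simp
      then obtain c where "minor (map a l) S = c * minor (map a [0..<n]) S"
        using minor_perm by blast
      then show ?thesis by simp
    next
      case False
      then obtain us x vs ws where "l = us @ [x] @ vs @ [x] @ ws"
        using not_distinct_decomp by blast
      then show ?thesis by (simp add: minor_repeat)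
    qed
  next
    case (Cons b bs)
    then obtain K where b: "b = (\<lambda>i. \<Sum>j<n. K j * a j i)" by auto
    have "minor (map a [0..<n]) S dvd minor (map a l @ a j # bs) S" if "j < n" for j
      using Cons.IH[of "l @ [j]"] Cons.prems that by simp
    then show ?case
      unfolding b minor_linear by (intro dvd_sum dvd_mult) simp
  qed
  from this[of "[]"] assms show ?thesis by simp
qed

text \<open>Elimination in column 0 with pivot row \<open>a\<close>: every other row is multiplied
  by \<open>a 0\<close> before a multiple of the pivot row is subtracted.\<close>

lemma minor_row_reduce:
  fixes a :: "nat \<Rightarrow> 'a::{idom, ring_char_0}"
  shows "minor (a # map (\<lambda>b i. a 0 * b i - b 0 * a i) bs) S = a 0 ^ length bs * minor (a # bs) S"
proof -
  have "minor (a # as @ map (\<lambda>b i. a 0 * b i - b 0 * a i) bs) S =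
      a 0 ^ length bs * minor (a # as @ bs) S" for as
  proof (induction bs arbitrary: as)
    case (Cons b bs)
    let ?cs = "map (\<lambda>b i. a 0 * b i - b 0 * a i) bs"
    have "minor (a # as @ map (\<lambda>b i. a 0 * b i - b 0 * a i) (b # bs)) S =
        a 0 * minor (a # as @ b # ?cs) S - b 0 * minor (a # as @ a # ?cs) S"
      using minor_diff[of "a # as" "a 0" b "b 0" a ?cs S] by simp
    also have "minor (a # as @ a # ?cs) S = 0"
      using minor_repeat[of "[]" a as ?cs S] by simp
    also have "minor (a # as @ b # ?cs) S = a 0 ^ length bs * minor (a # as @ b # bs) S"
      using Cons[of "as @ [b]"] by simp
    finally show ?case by simp
  qed simp
  from this[of "[]"] show ?thesis by simp
qed

lemma minor_zero_column:
  assumes "\<forall>c\<in>set cs. c k = 0" "k \<in> S"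
  shows "minor cs S = 0"
  using assms
proof (induction cs arbitrary: S)
  case (Cons c cs)
  have "wedge_sign i S * c i * minor cs (S - {i}) = 0" if "i \<in> S" for i
    using Cons that by (cases "i = k") auto
  then show ?case by (simp add: minor_Cons wedge_def)
qed (auto simp: minor_Nil)

lemma minor_Cons_zero_column:
  assumes "\<forall>c\<in>set cs. c 0 = 0" "finite T" "0 \<notin> T"
  shows "minor (a # cs) (insert 0 T) = a 0 * minor cs T"
proof -
  have "minor (a # cs) (insert 0 T) =
      (\<Sum>i\<in>{0}. wedge_sign i (insert 0 T) * a i * minor cs (insert 0 T - {i}))"
    unfolding minor_Cons wedge_def
  proof (rule sum.mono_neutral_right)
    show "\<forall>i\<in>insert 0 T - {0}. wedge_sign i (insert 0 T) * a i * minor cs (insert 0 T - {i}) = 0"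
      using minor_zero_column[OF assms(1)] by auto
  qed (use assms in auto)
  also have "\<dots> = a 0 * minor cs T"
    using assms(3) by (simp add: wedge_sign_def)
  finally show ?thesis .
qed

section \<open>Operators on a tensor product of exterior algebras\<close>

type_synonym fock = "nat set \<Rightarrow> nat set \<Rightarrow> real_group_ring"

definition fock_linear :: "(fock \<Rightarrow> fock) \<Rightarrow> bool" where
  "fock_linear T \<longleftrightarrow>
    (\<forall>p q v w. T (\<lambda>S S'. p * v S S' + q * w S S') = (\<lambda>S S'. p * T v S S' + q * T w S S'))"

lemma fock_linearD:
  "fock_linear T \<Longrightarrow> T (\<lambda>S S'. p * v S S' + q * w S S') = (\<lambda>S S'. p * T v S S' + q * T w S S')"
  by (simp add: fock_linear_def)

lemma fock_linear_add:
  "fock_linear T \<Longrightarrow> T (\<lambda>S S'. v S S' + w S S') = (\<lambda>S S'. T v S S' + T w S S')"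
  using fock_linearD[of T 1 v 1 w] by simp

lemma fock_linear_scale:
  "fock_linear T \<Longrightarrow> T (\<lambda>S S'. c * v S S') = (\<lambda>S S'. c * T v S S')"
  using fock_linearD[of T c v 0 v] by simp

text \<open>As a type the endomorphisms form a noncommutative ring under composition, so commutators
  can be computed by ring identities.\<close>

typedef operator = "{T :: fock \<Rightarrow> fock. fock_linear T}"
  morphisms app Abs_operator
  by (rule exI[of _ "\<lambda>v. v"]) (simp add: fock_linear_def)

setup_lifting type_definition_operator

lemma app_linear: "fock_linear (app T)"
  using app by blast

lemma operator_eqI: "(\<And>v S S'. app T v S S' = app U v S S') \<Longrightarrow> T = U"
  by (metis app_inject ext)

instantiation operator :: ring_1
begin

lift_definition zero_operator :: operator is "\<lambda>v S S'. 0"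
  by (simp add: fock_linear_def)

lift_definition one_operator :: operator is "\<lambda>v. v"
  by (simp add: fock_linear_def)

lift_definition plus_operator :: "operator \<Rightarrow> operator \<Rightarrow> operator" is
  "\<lambda>T U v S S'. T v S S' + U v S S'"
  by (simp add: fock_linear_def algebra_simps)

lift_definition minus_operator :: "operator \<Rightarrow> operator \<Rightarrow> operator" is
  "\<lambda>T U v S S'. T v S S' - U v S S'"
  by (simp add: fock_linear_def algebra_simps)

lift_definition uminus_operator :: "operator \<Rightarrow> operator" is
  "\<lambda>T v S S'. - T v S S'"
  by (simp add: fock_linear_def algebra_simps)

lift_definition times_operator :: "operator \<Rightarrow> operator \<Rightarrow> operator" is
  "\<lambda>T U v. T (U v)"
  by (simp add: fock_linear_def)

instance
proof
  show "(0::operator) \<noteq> 1"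
  proof
    assume "(0::operator) = 1"
    then have "app 0 (\<lambda>S S'. 1) {} {} = app 1 (\<lambda>S S'. 1) {} {}" by simp
    then show False by (simp add: zero_operator.rep_eq one_operator.rep_eq)
  qed
  show "a * (b + c) = a * b + a * c" for a b c :: operator
    by transfer (simp add: fock_linear_add)
qed (transfer; simp add: algebra_simps fun_eq_iff)+

end

lemmas app_simps = zero_operator.rep_eq one_operator.rep_eq plus_operator.rep_eq
  minus_operator.rep_eq uminus_operator.rep_eq times_operator.rep_eq

definition scal :: "real_group_ring \<Rightarrow> operator" where
  "scal c = Abs_operator (\<lambda>v S S'. c * v S S')"

text \<open>A grading operator: conjugation by it scales \<open>create\<close> by
  \<open>tpow r\<close> but \<open>create'\<close> by \<open>tpow (- r)\<close>, which separates the
  leading terms of conjugate words.\<close>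

definition weight :: "real \<Rightarrow> operator" where
  "weight r = Abs_operator (\<lambda>v S S'. tpow (r * (real (card S) - real (card S'))) * v S S')"

definition create :: "(nat \<Rightarrow> real_group_ring) \<Rightarrow> operator" where
  "create a = Abs_operator (\<lambda>v S S'. wedge a (\<lambda>S. v S S') S)"

text \<open>Exterior multiplication in the second factor, cut off on components with nonempty
  \<open>S\<close>. The cut-off is what makes \<open>create'_create\<close> hold.\<close>

definition create' :: "(nat \<Rightarrow> real_group_ring) \<Rightarrow> operator" where
  "create' a = Abs_operator (\<lambda>v S S'. if S = {} then wedge a (v {}) S' else 0)"

lemma app_scal: "app (scal c) v S S' = c * v S S'"
  unfolding scal_def by (subst Abs_operator_inverse) (simp_all add: fock_linear_def algebra_simps)

lemma app_scal_fun: "app (scal c) v = (\<lambda>S S'. c * v S S')"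
  by (intro ext) (rule app_scal)

lemma app_weight: "app (weight r) v S S' = tpow (r * (real (card S) - real (card S'))) * v S S'"
  unfolding weight_def by (subst Abs_operator_inverse) (simp_all add: fock_linear_def algebra_simps)

lemma app_create: "app (create a) v S S' = wedge a (\<lambda>S. v S S') S"
  unfolding create_def
  by (subst Abs_operator_inverse) (simp_all add: fock_linear_def wedge_add_right wedge_scale_right)

lemma app_create': "app (create' a) v S S' = (if S = {} then wedge a (v {}) S' else 0)"
  unfolding create'_def
  by (subst Abs_operator_inverse)
    (simp_all add: fock_linear_def wedge_add_right wedge_scale_right fun_eq_iff)

lemma scal_commute: "T * scal c = scal c * T"
  by (rule operator_eqI) (simp add: app_simps app_scal_fun fock_linear_scale[OF app_linear])

lemma scal_mult: "scal c * scal d = scal (c * d)"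
  by (rule operator_eqI) (simp add: app_simps app_scal mult.assoc)

lemma scal_add: "scal (c + d) = scal c + scal d"
  by (rule operator_eqI) (simp add: app_simps app_scal distrib_right)

lemma scal_diff: "scal (c - d) = scal c - scal d"
  by (rule operator_eqI) (simp add: app_simps app_scal left_diff_distrib)

lemma scal_minus: "scal (- c) = - scal c"
  by (rule operator_eqI) (simp add: app_simps app_scal)

lemma weight_0 [simp]: "weight 0 = 1"
  by (rule operator_eqI) (simp add: app_simps app_weight)

lemma weight_add: "weight r * weight s = weight (r + s)"
  by (rule operator_eqI) (simp add: app_simps app_weight tpow_mult_left distrib_right)

lemma weight_cancel: "weight r * (weight (- r) * T) = T" "weight (- r) * (weight r * T) = T"
  by (simp_all add: weight_add flip: mult.assoc)

text \<open>The wedge factor raises the degree by 1; \<open>x\<close> is the degree in the other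
  exterior factor.\<close>

lemma tpow_wedge:
  fixes v :: "nat set \<Rightarrow> real_group_ring"
  shows "tpow (r * (real (card S) - x)) * wedge a v S =
    tpow r * wedge a (\<lambda>S. tpow (r * (real (card S) - x)) * v S) S"
proof (cases "finite S")
  case True
  show ?thesis
    unfolding wedge_def sum_distrib_left
  proof (rule sum.cong[OF refl])
    fix i assume i: "i \<in> S"
    have "real (card S) = 1 + real (card (S - {i}))"
      using True i by (metis card_Suc_Diff1 of_nat_Suc)
    then have "r * (real (card S) - x) = r + r * (real (card (S - {i})) - x)"
      by (simp add: algebra_simps)
    then have "tpow (r * (real (card S) - x)) = tpow r * tpow (r * (real (card (S - {i})) - x))"
      by (simp only: tpow_mult)
    then show "tpow (r * (real (card S) - x)) * (wedge_sign i S * a i * v (S - {i})) =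
        tpow r * (wedge_sign i S * a i * (tpow (r * (real (card (S - {i})) - x)) * v (S - {i})))"
      by (simp only: mult_ac)
  qed
qed (simp add: wedge_infinite)

lemma weight_create: "weight r * create a = scal (tpow r) * create a * weight r"
  by (rule operator_eqI) (simp add: app_simps app_weight app_create app_scal tpow_wedge)

lemma weight_create': "weight r * create' a = scal (tpow (- r)) * create' a * weight r"
proof (rule operator_eqI)
  fix v :: fock and S S' :: "nat set"
  have "app (weight r) v {} = (\<lambda>S. tpow (- r * (real (card S) - 0)) * v {} S)"
    by (rule ext) (simp add: app_weight)
  then show "app (weight r * create' a) v S S' = app (scal (tpow (- r)) * create' a * weight r) v S S'"
    using tpow_wedge[of "- r" S' 0 a "v {}"] by (simp add: app_simps app_weight app_create' app_scal)
qed

lemma create_same: "create a * create a = 0"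
  by (rule operator_eqI) (simp add: app_simps app_create wedge_wedge_same)

lemma create'_same: "create' a * create' a = 0"
proof (rule operator_eqI)
  fix v :: fock and S S' :: "nat set"
  have "app (create' a) v {} = wedge a (v {})"
    by (rule ext) (simp add: app_create')
  then show "app (create' a * create' a) v S S' = app 0 v S S'"
    by (simp add: app_simps app_create' wedge_wedge_same)
qed

text \<open>Only the products \<open>create a * create' b\<close> in this order survive; this asymmetry is what keeps
  the iterated commutators below from vanishing.\<close>

lemma create'_create: "create' b * create a = 0"
  by (rule operator_eqI) (simp add: app_simps app_create app_create' wedge_def)

lemma create_add_scale: "create (\<lambda>i. a i + c * b i) = create a + scal c * create b"
  by (rule operator_eqI)
    (simp add: app_simps app_create app_scal wedge_add_left wedge_scale_left)

lemma create'_add_scale: "create' (\<lambda>i. a i + c * b i) = create' a + scal c * create' b"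
  by (rule operator_eqI)
    (simp add: app_simps app_create' app_scal wedge_add_left wedge_scale_left)

text \<open>The degree filtration of vectors. Infinite index sets have \<open>card\<close> 0 and so
  count as degree 0; wedge products vanish there, so creation operators still raise the
  degree.\<close>

definition fock_vanish :: "nat \<Rightarrow> fock \<Rightarrow> bool" where
  "fock_vanish j v \<longleftrightarrow> (\<forall>S S'. card S + card S' < j \<longrightarrow> v S S' = 0)"

text \<open>A multiplicative filtration of the operator ring by the amount the degree is
  raised.\<close>

definition filt :: "nat \<Rightarrow> operator set" where
  "filt k = {T. \<forall>j v. fock_vanish j v \<longrightarrow> fock_vanish (j + k) (app T v)}"

lemma filt_mono: "k \<le> l \<Longrightarrow> T \<in> filt l \<Longrightarrow> T \<in> filt k"
  by (auto simp: filt_def fock_vanish_def)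

lemma filt_zero [simp]: "0 \<in> filt k"
  by (simp add: filt_def fock_vanish_def app_simps)

lemma filt_one [simp]: "1 \<in> filt 0"
  by (simp add: filt_def app_simps)

lemma filt_add: "T \<in> filt k \<Longrightarrow> U \<in> filt k \<Longrightarrow> T + U \<in> filt k"
  by (simp add: filt_def fock_vanish_def app_simps)

lemma filt_diff: "T \<in> filt k \<Longrightarrow> U \<in> filt k \<Longrightarrow> T - U \<in> filt k"
  by (simp add: filt_def fock_vanish_def app_simps)

lemma filt_mult: "T \<in> filt k \<Longrightarrow> U \<in> filt l \<Longrightarrow> T * U \<in> filt (k + l)"
proof -
  assume T: "T \<in> filt k" and U: "U \<in> filt l"
  have "fock_vanish (j + l + k) (app T (app U v))" if "fock_vanish j v" for j v
    using T U that unfolding filt_def by blast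
  then show ?thesis by (simp add: filt_def app_simps ac_simps)
qed

lemma filt_scal [simp]: "scal c \<in> filt 0"
  by (simp add: filt_def fock_vanish_def app_scal)

lemma filt_weight [simp]: "weight r \<in> filt 0"
  by (simp add: filt_def fock_vanish_def app_weight)

lemma filt_create: "create a \<in> filt 1"
proof -
  have *: "wedge a (\<lambda>S. v S S') S = 0" if v: "fock_vanish j v" and c: "card S + card S' < j + 1" for j v S S'
  proof (cases "finite S")
    case True
    have "v (S - {i}) S' = 0" if "i \<in> S" for i
      using v c True that card_Suc_Diff1[OF True that] unfolding fock_vanish_def by simp
    then show ?thesis by (simp add: wedge_def)
  qed (simp add: wedge_infinite)
  show ?thesis
    unfolding filt_def mem_Collect_eq
  proof (intro allI impI)
    fix j v assume "fock_vanish j v"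
    then show "fock_vanish (j + 1) (app (create a) v)"
      using * unfolding fock_vanish_def[of "j + 1"] app_create by auto
  qed
qed

lemma filt_create': "create' a \<in> filt 1"
proof -
  have *: "wedge a (v {}) S' = 0" if v: "fock_vanish j v" and c: "card S' < j + 1" for j v S'
  proof (cases "finite S'")
    case True
    have "v {} (S' - {i}) = 0" if "i \<in> S'" for i
      using v c True that card_Suc_Diff1[OF True that] unfolding fock_vanish_def by simp
    then show ?thesis by (simp add: wedge_def)
  qed (simp add: wedge_infinite)
  show ?thesis
    unfolding filt_def mem_Collect_eq
  proof (intro allI impI)
    fix j v assume "fock_vanish j v"
    then show "fock_vanish (j + 1) (app (create' a) v)"
      using * unfolding fock_vanish_def[of "j + 1"] app_create' by auto
  qed
qed

lemmas filt_create_Suc [simp] = filt_create[unfolded One_nat_def] filt_create'[unfolded One_nat_def]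

section \<open>The matrix coefficient in top degree\<close>

definition vacuum :: fock where
  "vacuum S S' = (if S = {} \<and> S' = {} then 1 else 0)"

text \<open>Coordinate 0 is left out because commutators have derivative 0 there.\<close>

definition corner :: "nat \<Rightarrow> operator \<Rightarrow> real_group_ring" where
  "corner d T = app T vacuum {1..d} {1..d}"

lemma corner_add: "corner d (T + U) = corner d T + corner d U"
  by (simp add: corner_def app_simps)

lemma corner_diff: "corner d (T - U) = corner d T - corner d U"
  by (simp add: corner_def app_simps)

lemma corner_scal: "corner d (scal c * T) = c * corner d T"
  by (simp add: corner_def app_simps app_scal)

lemma corner_filt: "T \<in> filt (2 * d + 1) \<Longrightarrow> corner d T = 0"
proof -
  assume "T \<in> filt (2 * d + 1)"
  moreover have "fock_vanish 0 vacuum" by (simp add: fock_vanish_def)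
  ultimately have "fock_vanish (0 + (2 * d + 1)) (app T vacuum)"
    unfolding filt_def by blast
  then show ?thesis by (simp add: fock_vanish_def corner_def)
qed

text \<open>Weights act as 1 on the vacuum and on components whose two degrees agree.\<close>

lemma corner_weight: "corner d (weight r * T * weight s) = corner d T"
proof -
  have "app (weight s) vacuum = vacuum"
    by (intro ext) (simp add: app_weight vacuum_def)
  then show ?thesis by (simp add: corner_def app_simps app_weight)
qed

text \<open>The second-factor operators act first, while \<open>S\<close> is still empty, so the
  cut-off in \<open>create'\<close> does not interfere.\<close>

lemma corner_create:
  "corner d (prod_list (map create as) * prod_list (map create' bs)) = minor as {1..d} * minor bs {1..d}"
proof -
  have bs: "app (prod_list (map create' bs)) vacuum = (\<lambda>S S'. if S = {} then minor bs S' else 0)"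
  proof (induction bs)
    case Nil
    show ?case by (simp add: app_simps vacuum_def minor_Nil fun_eq_iff)
  next
    case (Cons b bs)
    then have "app (prod_list (map create' bs)) vacuum {} = minor bs" by simp
    then have "app (create' b) (app (prod_list (map create' bs)) vacuum) S S' =
        (if S = {} then wedge b (minor bs) S' else 0)" for S S'
      by (simp only: app_create')
    then show ?case unfolding minor_Cons by (simp add: app_simps)
  qed
  have as: "app (prod_list (map create as)) v S S' = foldr wedge as (\<lambda>S. v S S') S" for v S S'
  proof (induction as arbitrary: S)
    case (Cons a as)
    then have "(\<lambda>S. app (prod_list (map create as)) v S S') = foldr wedge as (\<lambda>S. v S S')" by auto
    then show ?case by (simp add: app_simps app_create)
  qed (simp add: app_simps)
  have "foldr wedge as (\<lambda>S. if S = {} then c else 0) T = c * minor as T" for c T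
  proof -
    have "(\<lambda>S::nat set. if S = {} then c else 0) = (\<lambda>S. c * (if S = {} then 1 else 0))" by auto
    then show ?thesis by (simp only: minor_def foldr_wedge_scale)
  qed
  then show ?thesis
    by (simp only: corner_def app_simps as bs mult.commute)
qed

section \<open>Fox derivatives and the operator representation\<close>

definition gcomm :: "('a, 'b) monoid_scheme \<Rightarrow> 'a \<Rightarrow> 'a \<Rightarrow> 'a" where
  "gcomm G u v = u \<otimes>\<^bsub>G\<^esub> v \<otimes>\<^bsub>G\<^esub> inv\<^bsub>G\<^esub> u \<otimes>\<^bsub>G\<^esub> inv\<^bsub>G\<^esub> v"

definition gconj :: "('a, 'b) monoid_scheme \<Rightarrow> 'a \<Rightarrow> 'a \<Rightarrow> 'a" where
  "gconj G g u = g \<otimes>\<^bsub>G\<^esub> u \<otimes>\<^bsub>G\<^esub> inv\<^bsub>G\<^esub> g"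

context group
begin

lemma gcomm_closed [simp]: "u \<in> carrier G \<Longrightarrow> v \<in> carrier G \<Longrightarrow> gcomm G u v \<in> carrier G"
  by (simp add: gcomm_def)

lemma gconj_closed [simp]: "g \<in> carrier G \<Longrightarrow> u \<in> carrier G \<Longrightarrow> gconj G g u \<in> carrier G"
  by (simp add: gconj_def)

end

lemma (in group_hom) hom_gcomm:
  "u \<in> carrier G \<Longrightarrow> v \<in> carrier G \<Longrightarrow> h (gcomm G u v) = gcomm H (h u) (h v)"
  by (simp add: gcomm_def)

lemma (in group_hom) hom_gconj:
  "u \<in> carrier G \<Longrightarrow> v \<in> carrier G \<Longrightarrow> h (gconj G u v) = gconj H (h u) (h v)"
  by (simp add: gconj_def)

lemma mult_free_group: "u \<otimes>\<^bsub>free_group n\<^esub> v = foldr red_cons u v"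
  by (simp add: free_group_def)

lemma one_free_group: "\<one>\<^bsub>free_group n\<^esub> = []"
  by (simp add: free_group_def)

abbreviation gen :: "nat \<Rightarrow> letter list" where
  "gen j \<equiv> [(j, True)]"

lemma gen_carrier [simp]: "j < n \<Longrightarrow> gen j \<in> carrier (free_group n)"
  by (simp add: free_group_def reduced_def)

lemma inv_gen: "j < n \<Longrightarrow> inv\<^bsub>free_group n\<^esub> gen j = [(j, False)]"
  by (rule group.inv_equality[OF group_free_group])
    (simp_all add: free_group_def reduced_def flip_letter_def)

lemma free_group_induct [consumes 1, case_names one gen inv_gen]:
  assumes w: "w \<in> carrier (free_group n)"
    and "P []"
    and gen: "\<And>j w. j < n \<Longrightarrow> w \<in> carrier (free_group n) \<Longrightarrow> P w \<Longrightarrow> P (gen j \<otimes>\<^bsub>free_group n\<^esub> w)"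
    and inv: "\<And>j w. j < n \<Longrightarrow> w \<in> carrier (free_group n) \<Longrightarrow> P w \<Longrightarrow>
      P (inv\<^bsub>free_group n\<^esub> gen j \<otimes>\<^bsub>free_group n\<^esub> w)"
  shows "P w"
  using w
proof (induction w)
  case (Cons a w)
  have w: "w \<in> carrier (free_group n)" and a: "fst a < n"
    using Cons.prems by (auto simp: free_group_def reduced_Cons)
  have "a # w = [a] \<otimes>\<^bsub>free_group n\<^esub> w"
    using Cons.prems by (cases w) (auto simp: free_group_def reduced_Cons)
  moreover have "[a] = gen (fst a) \<or> [a] = inv\<^bsub>free_group n\<^esub> gen (fst a)"
    using inv_gen[OF a] by (cases a) auto
  ultimately show ?case
    using gen[OF a w] inv[OF a w] Cons.IH[OF w] by auto
qed (use \<open>P []\<close> in simp)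

definition eval_word :: "(letter \<Rightarrow> 'a::monoid_mult) \<Rightarrow> letter list \<Rightarrow> 'a" where
  "eval_word R w = prod_list (map R w)"

lemma eval_word_mult:
  assumes "\<And>a. R a * R (flip_letter a) = 1"
  shows "eval_word R (foldr red_cons u v) = eval_word R u * eval_word R v"
proof (induction u)
  case (Cons a u)
  have "eval_word R (red_cons a w) = R a * eval_word R w" for w
    by (cases w) (use assms in \<open>auto simp: eval_word_def mult.assoc[symmetric]\<close>)
  then show ?case using Cons by (simp add: eval_word_def mult.assoc)
qed (simp add: eval_word_def)

text \<open>No assumption on \<open>\<theta>\<close> is built in, so that exponent sums can later be
  treated as heights for indicator frequencies.\<close>

locale frequencies =
  fixes \<theta> :: "nat \<Rightarrow> real" and n :: nat
begin

abbreviation F where "F \<equiv> free_group n"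

definition letter_height :: "letter \<Rightarrow> real" where
  "letter_height a = (if snd a then \<theta> (fst a) else - \<theta> (fst a))"

definition height :: "letter list \<Rightarrow> real" where
  "height w = sum_list (map letter_height w)"

lemma height_Cons: "height (a # w) = letter_height a + height w"
  by (simp add: height_def)

lemma letter_height_flip [simp]: "letter_height (flip_letter a) = - letter_height a"
  by (simp add: letter_height_def flip_letter_def)

lemma height_mult: "height (u \<otimes>\<^bsub>F\<^esub> v) = height u + height v"
proof -
  have "height (red_cons a w) = letter_height a + height w" for a w
    by (cases w) (auto simp: height_def)
  then show ?thesis unfolding mult_free_group
    by (induction u) (simp_all add: height_def)
qed

text \<open>The coordinates \<open>1, \<dots>, n - 1\<close> of \<open>fox\<close> are Fox derivatives; the coordinate \<open>0\<close> is the
  principal derivation, whose presence makes the Jacobian of an automorphism invertible up to the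
  factor \<open>tpow (\<theta> 0) - 1\<close>.\<close>

definition fox_gen :: "nat \<Rightarrow> nat \<Rightarrow> real_group_ring" where
  "fox_gen j i = (if i = 0 then tpow (\<theta> j) - 1 else if i = j then 1 else 0)"

definition fox_letter :: "letter \<Rightarrow> nat \<Rightarrow> real_group_ring" where
  "fox_letter a i = (if snd a then fox_gen (fst a) i else - tpow (- \<theta> (fst a)) * fox_gen (fst a) i)"

fun fox :: "letter list \<Rightarrow> nat \<Rightarrow> real_group_ring" where
  "fox [] i = 0"
| "fox (a # w) i = fox_letter a i + tpow (letter_height a) * fox w i"

lemma fox_letter_flip: "fox_letter a i + tpow (letter_height a) * fox_letter (flip_letter a) i = 0"
  by (simp add: fox_letter_def letter_height_def flip_letter_def tpow_mult flip: mult.assoc)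

lemma fox_mult: "fox (u \<otimes>\<^bsub>F\<^esub> v) i = fox u i + tpow (height u) * fox v i"
proof -
  have "fox (red_cons a w) i = fox_letter a i + tpow (letter_height a) * fox w i" for a w
  proof (cases w)
    case (Cons b w')
    show ?thesis
    proof (cases "b = flip_letter a")
      case True
      have "fox_letter a i + tpow (letter_height a) * fox w i =
          (fox_letter a i + tpow (letter_height a) * fox_letter (flip_letter a) i) + fox w' i"
        using Cons True by (simp add: distrib_left tpow_mult_left)
      then show ?thesis using Cons True by (simp add: fox_letter_flip)
    qed (simp add: Cons)
  qed simp
  then show ?thesis unfolding mult_free_group
    by (induction u) (simp_all add: height_def distrib_left tpow_mult_left add.assoc)
qed

lemma fox_gen_eq [simp]: "fox (gen j) i = fox_gen j i"
  by (simp add: fox_letter_def)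

lemma fox_0: "fox w 0 = tpow (height w) - 1"
proof (induction w)
  case (Cons a w)
  have "fox_letter a 0 = tpow (letter_height a) - 1"
    by (simp add: fox_letter_def letter_height_def fox_gen_def algebra_simps tpow_mult)
  then show ?case by (simp add: height_Cons Cons.IH right_diff_distrib tpow_mult)
qed (simp add: height_def)

definition lead :: "(nat \<Rightarrow> real_group_ring) \<Rightarrow> operator" where
  "lead a = create a + create' (\<lambda>i. bar (a i))"

text \<open>Since \<open>e * e\<close>, \<open>f * f\<close> and \<open>f * e\<close> vanish, the
  geometric series for the inverse of \<open>1 + e + f\<close> stops after the square of
  \<open>e + f\<close>, which is \<open>e * f\<close>.\<close>

definition rho_letter :: "letter \<Rightarrow> operator" where
  "rho_letter a =
    (let e = create (fox_gen (fst a)); f = create' (\<lambda>i. bar (fox_gen (fst a) i)) in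
     if snd a then (1 + e + f) * weight (\<theta> (fst a)) else weight (- \<theta> (fst a)) * (1 - e - f + e * f))"

definition rho :: "letter list \<Rightarrow> operator" where
  "rho = eval_word rho_letter"

lemma rho_letter_flip: "rho_letter a * rho_letter (flip_letter a) = 1"
proof -
  define e where "e = create (fox_gen (fst a))"
  define f where "f = create' (\<lambda>i. bar (fox_gen (fst a) i))"
  have z: "e * e = 0" "f * f = 0" "f * e = 0" "e * (e * f) = 0" "f * (e * f) = 0"
    "e * (f * f) = 0" "e * (f * e) = 0"
    by (simp_all add: e_def f_def create_same create'_same create'_create flip: mult.assoc)
  have 1: "(1 + e + f) * (1 - e - f + e * f) = 1" "(1 - e - f + e * f) * (1 + e + f) = 1"
    by (simp_all add: algebra_simps z)
  show ?thesis
  proof (cases "snd a")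
    case True
    have "rho_letter a * rho_letter (flip_letter a) =
        (1 + e + f) * (weight (\<theta> (fst a)) * (weight (- \<theta> (fst a)) * (1 - e - f + e * f)))"
      using True by (simp only: rho_letter_def Let_def flip_letter_def fst_conv snd_conv e_def f_def
        mult.assoc if_True not_True_eq_False if_False)
    then show ?thesis by (simp only: weight_cancel 1)
  next
    case False
    have "rho_letter a * rho_letter (flip_letter a) =
        weight (- \<theta> (fst a)) * ((1 - e - f + e * f) * (1 + e + f)) * weight (\<theta> (fst a))"
      using False by (simp only: rho_letter_def Let_def flip_letter_def fst_conv snd_conv e_def f_def
        mult.assoc if_True not_False_eq_True if_False)
    then show ?thesis by (simp add: 1 weight_add)
  qed
qed

lemma rho_mult: "rho (u \<otimes>\<^bsub>F\<^esub> v) = rho u * rho v"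
  unfolding mult_free_group rho_def using rho_letter_flip by (rule eval_word_mult)

lemma rho_Nil [simp]: "rho [] = 1"
  by (simp add: rho_def eval_word_def)

lemma rho_Cons: "rho (a # w) = rho_letter a * rho w"
  by (simp add: rho_def eval_word_def)

lemma rho_inv:
  assumes "u \<in> carrier F"
  shows "rho (inv\<^bsub>F\<^esub> u) * rho u = 1" "rho u * rho (inv\<^bsub>F\<^esub> u) = 1"
  using assms rho_mult group.l_inv[OF group_free_group] group.r_inv[OF group_free_group]
  by (metis one_free_group rho_Nil)+

lemma height_inv: "u \<in> carrier F \<Longrightarrow> height (inv\<^bsub>F\<^esub> u) = - height u"
  using height_mult[of "inv\<^bsub>F\<^esub> u" u] group.l_inv[OF group_free_group, of u n]
  by (simp add: one_free_group height_def)

lemma fox_inv: "u \<in> carrier F \<Longrightarrow> fox (inv\<^bsub>F\<^esub> u) i = - tpow (- height u) * fox u i"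
  using fox_mult[of "inv\<^bsub>F\<^esub> u" u i] group.l_inv[OF group_free_group, of u n]
  by (simp add: one_free_group height_inv eq_neg_iff_add_eq_0)

end

section \<open>Leading terms of commutators\<close>

context frequencies
begin

text \<open>The chain rule for Fox derivatives with unnamed coefficients; the span of the rows is
  what enters \<open>minor_dvd\<close>.\<close>

lemma fox_hom_span:
  assumes h: "h \<in> hom F F" and w: "w \<in> carrier F"
  shows "\<exists>K. fox (h w) = (\<lambda>i. \<Sum>j<n. K j * fox (h (gen j)) i)"
  using w
proof (induction w rule: free_group_induct)
  case one
  have "h [] = []"
    using hom_one[OF h group_free_group group_free_group] by (simp add: one_free_group)
  then show ?case by (intro exI[of _ "\<lambda>_. 0"]) auto
next
  case (gen j w)
  then obtain K where K: "fox (h w) = (\<lambda>i. \<Sum>j<n. K j * fox (h (gen j)) i)" by blast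
  have "h (gen j \<otimes>\<^bsub>F\<^esub> w) = h (gen j) \<otimes>\<^bsub>F\<^esub> h w"
    using gen by (intro hom_mult[OF h]) auto
  moreover have "(\<Sum>k<n. (if k = j then 1 else 0) * fox (h (gen k)) i) = fox (h (gen j)) i" for i
    using gen by (simp add: if_distrib[of "\<lambda>x. x * _"] cong: if_cong)
  \<comment> \<open>The product rule twists all coefficients by the height of
    \<open>h (gen j)\<close> and adds 1 at \<open>j\<close>.\<close>
  ultimately have "fox (h (gen j \<otimes>\<^bsub>F\<^esub> w)) i =
      (\<Sum>k<n. ((if k = j then 1 else 0) + tpow (height (h (gen j))) * K k) * fox (h (gen k)) i)" for i
    unfolding distrib_right sum.distrib mult.assoc sum_distrib_left[symmetric]
    by (simp add: fox_mult K)
  then show ?case by (intro exI ext)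
next
  case (inv_gen j w)
  then obtain K where K: "fox (h w) = (\<lambda>i. \<Sum>j<n. K j * fox (h (gen j)) i)" by blast
  have hc: "h (gen j) \<in> carrier F" using inv_gen h by (auto intro: hom_in_carrier)
  have "h (inv\<^bsub>F\<^esub> gen j) = inv\<^bsub>F\<^esub> h (gen j)"
    using group_hom.hom_inv[of F F h "gen j"] inv_gen h group_free_group
    by (simp add: group_hom_def group_hom_axioms_def)
  moreover have "h (inv\<^bsub>F\<^esub> gen j \<otimes>\<^bsub>F\<^esub> w) = h (inv\<^bsub>F\<^esub> gen j) \<otimes>\<^bsub>F\<^esub> h w"
    using inv_gen group.inv_closed[OF group_free_group] by (intro hom_mult[OF h]) auto
  moreover have "(\<Sum>k<n. (if k = j then - c else 0) * fox (h (gen k)) i) = - c * fox (h (gen j)) i" for i c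
    using inv_gen by (simp add: if_distrib[of "\<lambda>x. x * _"] cong: if_cong)
  ultimately have "fox (h (inv\<^bsub>F\<^esub> gen j \<otimes>\<^bsub>F\<^esub> w)) i =
      (\<Sum>k<n. ((if k = j then - tpow (- height (h (gen j))) else 0) + tpow (- height (h (gen j))) * K k) *
        fox (h (gen k)) i)" for i
    unfolding distrib_right sum.distrib mult.assoc sum_distrib_left[symmetric]
    by (simp add: fox_mult K fox_inv[OF hc] height_inv[OF hc])
  then show ?case by (intro exI ext)
qed

lemma lead_filt: "lead a \<in> filt 1"
  by (simp add: lead_def filt_add)

lemmas lead_filt_Suc [simp] = lead_filt[unfolded One_nat_def]

lemma lead_add_tpow:
  "lead (\<lambda>i. a i + tpow r * b i) = lead a + scal (tpow r) * create b + scal (tpow (- r)) * create' (\<lambda>i. bar (b i))"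
  using create'_add_scale[of "\<lambda>i. bar (a i)" "tpow (- r)" "\<lambda>i. bar (b i)"]
  by (simp add: lead_def create_add_scale bar_add bar_mult)

lemma weight_lead:
  "weight r * lead a = (scal (tpow r) * create a + scal (tpow (- r)) * create' (\<lambda>i. bar (a i))) * weight r"
  by (simp add: lead_def distrib_left distrib_right weight_create weight_create')

lemma filt_mult_le: "T \<in> filt k \<Longrightarrow> U \<in> filt l \<Longrightarrow> m \<le> k + l \<Longrightarrow> T * U \<in> filt m"
  using filt_mult filt_mono by blast

text \<open>For a generator the difference is 0; for an inverse letter it is the quadratic term
  \<open>e * f\<close> up to a weight.\<close>

lemma rho_letter_lead:
  "rho_letter a - (1 + lead (fox_letter a)) * weight (letter_height a) \<in> filt 2"
proof (cases "snd a")
  case True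
  then show ?thesis
    by (simp add: rho_letter_def letter_height_def fox_letter_def[abs_def] lead_def Let_def add.assoc)
next
  case False
  let ?g = "fox_gen (fst a)" and ?r = "\<theta> (fst a)"
  define e where "e = create ?g"
  define f where "f = create' (\<lambda>i. bar (?g i))"
  have c0: "create (\<lambda>i. 0) = 0" "create' (\<lambda>i. 0) = 0"
    by (rule operator_eqI; simp add: app_create app_create' app_simps wedge_def)+
  have "create (fox_letter a) = - (scal (tpow (- ?r)) * e)"
    using create_add_scale[of "\<lambda>i. 0" "- tpow (- ?r)" ?g] False
    by (simp add: c0 e_def scal_minus fox_letter_def[abs_def])
  moreover have "create' (\<lambda>i. bar (fox_letter a i)) = - (scal (tpow ?r) * f)"
    using create'_add_scale[of "\<lambda>i. 0" "- tpow ?r" "\<lambda>i. bar (?g i)"] False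
    by (simp add: c0 f_def scal_minus fox_letter_def[abs_def] bar_minus bar_mult)
  ultimately have "rho_letter a - (1 + lead (fox_letter a)) * weight (letter_height a) =
      weight (- ?r) * (e * f)"
    using False weight_create[of "- ?r" ?g] weight_create'[of "- ?r" "\<lambda>i. bar (?g i)"]
    by (simp add: rho_letter_def letter_height_def lead_def Let_def e_def f_def algebra_simps)
  moreover have "weight (- ?r) * (e * f) \<in> filt 2"
    unfolding e_def f_def by (intro filt_mult_le[OF filt_weight, of _ 2] filt_mult_le[of _ 1 _ 1]) simp_all
  ultimately show ?thesis by simp
qed

text \<open>Moving the weight of the first letter past the linear part of the rest twists that part
  exactly as the product rule for \<open>fox\<close> does; products of two linear parts have degree
  2.\<close>

lemma rho_lead: "rho w - (1 + lead (fox w)) * weight (height w) \<in> filt 2"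
proof (induction w)
  case Nil
  have "lead (fox []) = 0"
    by (rule operator_eqI) (simp add: lead_def app_simps app_create app_create' wedge_def)
  then show ?case by (simp add: height_def del: fox.simps)
next
  case (Cons a w)
  define A where "A = 1 + lead (fox_letter a)"
  define B where "B = 1 + lead (fox w)"
  define r where "r = letter_height a"
  define s where "s = height w"
  define X where "X = rho_letter a - A * weight r"
  define Y where "Y = rho w - B * weight s"
  define L where "L = scal (tpow r) * create (fox w) + scal (tpow (- r)) * create' (\<lambda>i. bar (fox w i))"
  have X: "X \<in> filt 2" and Y: "Y \<in> filt 2"
    using rho_letter_lead[of a] Cons by (simp_all add: X_def Y_def A_def B_def r_def s_def)
  have A: "A \<in> filt 0" and B: "B \<in> filt 0"
    unfolding A_def B_def by (simp_all add: filt_add filt_mono[OF _ lead_filt])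
  have L: "L \<in> filt 1"
    unfolding L_def by (intro filt_add filt_mult_le[OF filt_scal, of _ 1]) simp_all
  have fox: "fox (a # w) = (\<lambda>i. fox_letter a i + tpow r * fox w i)"
    by (simp add: r_def fun_eq_iff)
  have AB: "A * (1 + L) - (1 + lead (fox (a # w))) = lead (fox_letter a) * L"
    unfolding fox lead_add_tpow by (simp add: A_def L_def algebra_simps)
  have "weight r * B = (1 + L) * weight r"
    by (simp add: B_def L_def distrib_left distrib_right weight_lead)
  then have "A * weight r * (B * weight s) = A * (1 + L) * weight (r + s)"
    by (metis (no_types, lifting) mult.assoc weight_add)
  then have "rho (a # w) - (1 + lead (fox (a # w))) * weight (height (a # w)) =
      X * (Y + B * weight s) + A * weight r * Y + lead (fox_letter a) * L * weight (r + s)"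
    unfolding AB[symmetric]
    by (simp add: rho_Cons height_Cons X_def Y_def r_def[symmetric] s_def[symmetric] algebra_simps)
  moreover have "X * (Y + B * weight s) \<in> filt 2"
    by (intro filt_mult_le[OF X, of _ 0] filt_add filt_mono[OF _ Y] filt_mult_le[OF B, of _ 0]) simp_all
  moreover have "A * weight r * Y \<in> filt 2"
    by (intro filt_mult_le[OF _ Y, of _ 0] filt_mult_le[OF A, of _ 0]) simp_all
  moreover have "lead (fox_letter a) * L * weight (r + s) \<in> filt 2"
    by (intro filt_mult_le[of _ 2 _ 0] filt_mult_le[OF lead_filt L]) simp_all
  ultimately show ?case by (simp only: filt_add)
qed

lemma rho_weight: "rho w - weight (height w) \<in> filt 1"
proof -
  have "rho w - weight (height w) =
      (rho w - (1 + lead (fox w)) * weight (height w)) + lead (fox w) * weight (height w)"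
    by (simp add: algebra_simps)
  moreover have "lead (fox w) * weight (height w) \<in> filt 1"
    by (rule filt_mult_le[OF lead_filt filt_weight]) simp
  moreover have "rho w - (1 + lead (fox w)) * weight (height w) \<in> filt 1"
    by (rule filt_mono[OF _ rho_lead]) simp
  ultimately show ?thesis by (metis filt_add)
qed

lemma rho_filt [simp]: "rho w \<in> filt 0"
  using filt_add[OF filt_mono[OF _ rho_weight, of 0 w] filt_weight[of "height w"]] by simp

text \<open>\<open>X\<close> represents the class of \<open>rho u - 1\<close> modulo
  \<open>filt (k + 1)\<close>; it is not unique and may be 0.\<close>

definition leading :: "nat \<Rightarrow> letter list \<Rightarrow> operator \<Rightarrow> bool" where
  "leading k u X \<longleftrightarrow> u \<in> carrier F \<and> X \<in> filt k \<and> rho u - 1 - X \<in> filt (k + 1)"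

lemma leading_height_0:
  assumes "u \<in> carrier F" "height u = 0"
  shows "leading 1 u (lead (fox u))"
  using rho_lead[of u] assms by (simp add: leading_def numeral_2_eq_2 algebra_simps)

lemma leading_filt: "leading k u X \<Longrightarrow> rho u - 1 \<in> filt k"
  using filt_add[of X k "rho u - 1 - X"] filt_mono[of k "k + 1"] by (simp add: leading_def)

text \<open>The correspondence between group commutators and Lie brackets known from the Magnus
  embedding.\<close>

lemma leading_gcomm:
  assumes u: "leading j u X" and v: "leading k v Y" and jk: "j > 0" "k > 0"
  shows "leading (j + k) (gcomm F u v) (X * Y - Y * X)"
proof -
  interpret F: group F by (rule group_free_group)
  have c: "u \<in> carrier F" "v \<in> carrier F" and X: "X \<in> filt j" and Y: "Y \<in> filt k"
    using u v by (simp_all add: leading_def)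
  define U where "U = rho u - 1"
  define V where "V = rho v - 1"
  define Q where "Q = rho (inv\<^bsub>F\<^esub> u) * rho (inv\<^bsub>F\<^esub> v)"
  have U: "U \<in> filt j" "U - X \<in> filt (j + 1)" and V: "V \<in> filt k" "V - Y \<in> filt (k + 1)"
    using leading_filt[OF u] leading_filt[OF v] u v by (simp_all add: U_def V_def leading_def)
  have Q0: "Q \<in> filt 0"
    unfolding Q_def by (rule filt_mult_le[of _ 0 _ 0]) simp_all
  have i: "rho (inv\<^bsub>F\<^esub> u) * rho u = 1" "rho (inv\<^bsub>F\<^esub> v) * rho v = 1"
    "rho u * rho (inv\<^bsub>F\<^esub> u) = 1" "rho v * rho (inv\<^bsub>F\<^esub> v) = 1"
    using rho_inv c by simp_all
  have vu: "rho v * rho u * Q = 1"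
    unfolding Q_def by (metis i(3,4) mult.assoc mult_1_right)
  have "rho (gcomm F u v) = rho u * rho v * Q"
    by (simp add: gcomm_def rho_mult Q_def mult.assoc)
  then have "rho (gcomm F u v) - 1 = (rho u * rho v - rho v * rho u) * Q"
    by (simp add: left_diff_distrib vu)
  also have "rho u * rho v - rho v * rho u = U * V - V * U"
    by (simp add: U_def V_def algebra_simps)
  \<comment> \<open>\<open>Q\<close> is 1 modulo degree 1, as shown next, so it does not affect the
    leading term of this product.\<close>
  finally have eq: "rho (gcomm F u v) - 1 = (U * V - V * U) * Q" .
  have "rho v * rho u - 1 = U + V + V * U"
    by (simp add: U_def V_def algebra_simps)
  moreover have "U + V + V * U \<in> filt 1"
    using jk by (intro filt_add filt_mult_le[OF V(1) U(1)] filt_mono[OF _ U(1)] filt_mono[OF _ V(1)]) simp_all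
  ultimately have "(rho v * rho u - 1) * Q \<in> filt 1"
    using filt_mult_le[OF _ Q0, of _ 1 1] by simp
  then have Q1: "1 - Q \<in> filt 1" by (simp add: left_diff_distrib vu)
  have UV: "U * V \<in> filt (j + k)" "V * U \<in> filt (j + k)"
    by (auto intro: filt_mult_le[OF U(1) V(1)] filt_mult_le[OF V(1) U(1)])
  have "rho (gcomm F u v) - 1 - (X * Y - Y * X) =
      ((U - X) * V + X * (V - Y)) - ((V - Y) * U + Y * (U - X)) - (U * V - V * U) * (1 - Q)"
    unfolding eq by (simp add: algebra_simps)
  also have "\<dots> \<in> filt (j + k + 1)"
    by (intro filt_diff filt_add filt_mult_le[OF U(2) V(1)] filt_mult_le[OF X V(2)]
        filt_mult_le[OF V(2) U(1)] filt_mult_le[OF Y U(2)] filt_mult_le[OF filt_diff[OF UV] Q1]) simp_all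
  finally have "rho (gcomm F u v) - 1 - (X * Y - Y * X) \<in> filt (j + k + 1)" .
  moreover have "X * Y - Y * X \<in> filt (j + k)"
    by (intro filt_diff filt_mult_le[OF X Y] filt_mult_le[OF Y X]) simp_all
  ultimately show ?thesis using c by (simp add: leading_def)
qed

text \<open>Modulo degree 1 every word acts as its weight, so conjugation changes the leading term
  through the height alone.\<close>

lemma leading_gconj:
  assumes g: "g \<in> carrier F" and u: "leading k u X"
  shows "leading k (gconj F g u) (weight (height g) * X * weight (- height g))"
proof -
  interpret F: group F by (rule group_free_group)
  let ?g' = "inv\<^bsub>F\<^esub> g"
  have c: "u \<in> carrier F" and X: "X \<in> filt k" and u': "rho u - 1 - X \<in> filt (k + 1)"
    using u by (simp_all add: leading_def)
  have g1: "rho g - weight (height g) \<in> filt 1" "rho ?g' - weight (- height g) \<in> filt 1"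
    using rho_weight[of g] rho_weight[of ?g'] by (simp_all add: height_inv[OF g])
  have "rho (gconj F g u) - 1 - weight (height g) * X * weight (- height g) =
      rho g * (rho u - 1 - X) * rho ?g' + (rho g - weight (height g)) * X * rho ?g'
        + weight (height g) * X * (rho ?g' - weight (- height g))"
    using rho_inv(2)[OF g] by (simp add: gconj_def rho_mult algebra_simps)
  also have "\<dots> \<in> filt (k + 1)"
    by (intro filt_add filt_mult_le[OF filt_mult[OF rho_filt u'] rho_filt]
        filt_mult_le[OF filt_mult[OF g1(1) X] rho_filt] filt_mult_le[OF filt_mult[OF filt_weight X] g1(2)])
      simp_all
  finally have "rho (gconj F g u) - 1 - weight (height g) * X * weight (- height g) \<in> filt (k + 1)" .
  moreover have "weight (height g) * X * weight (- height g) \<in> filt k"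
    by (rule filt_mult_le[OF filt_mult[OF filt_weight X] filt_weight]) simp
  ultimately show ?thesis using g c by (simp add: leading_def)
qed

lemma weight_lead_conj:
  "weight r * lead a * weight (- r) = scal (tpow r) * create a + scal (tpow (- r)) * create' (\<lambda>i. bar (a i))"
  by (simp add: weight_lead mult.assoc weight_add)

end

text \<open>The elements used are \<open>y 0, ..., y (k + 1)\<close>, so \<open>k = n - 2\<close>
  exhausts a basis. Conjugation by powers of \<open>y 0\<close> puts its height into the leading
  coefficient; with \<open>r = 0\<close> the innermost commutator would be trivial.\<close>

fun chain :: "('a, 'b) monoid_scheme \<Rightarrow> (nat \<Rightarrow> 'a) \<Rightarrow> nat \<Rightarrow> nat \<Rightarrow> 'a" where
  "chain G y r 0 = gcomm G (gcomm G (y 0) (y 1)) (gconj G (y 0 [^]\<^bsub>G\<^esub> r) (gcomm G (y 0) (y 1)))"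
| "chain G y r (Suc k) =
    gcomm G (gcomm G (chain G y r k) (gcomm G (y 0) (y (k + 2)))) (gconj G (y 0) (gcomm G (y 0) (y (k + 2))))"

lemma (in group) chain_closed:
  "y ` {..k + 1} \<subseteq> carrier G \<Longrightarrow> chain G y r k \<in> carrier G"
  by (induction k) (auto simp: image_subset_iff)

lemma (in group_hom) hom_chain:
  "y ` {..k + 1} \<subseteq> carrier G \<Longrightarrow> h (chain G y r k) = chain H (h \<circ> y) r k"
  by (induction k) (auto simp: image_subset_iff hom_gcomm hom_gconj hom_nat_pow G.chain_closed)

text \<open>\<open>X\<close> is the leading term so far, \<open>e + f\<close> that of a new
  commutator and \<open>s * e + t * f\<close> that of its conjugate. The relations kill every term
  except those with \<open>e\<close> in front of \<open>E\<close> and \<open>f\<close> behind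
  \<open>F\<close>.\<close>

lemma double_commutator:
  fixes e f E F z s t :: "'a::ring_1"
  assumes central: "\<And>x. x * z = z * x" "\<And>x. x * s = s * x" "\<And>x. x * t = t * x"
    and zero: "f * E = 0" "F * e = 0" "e * e = 0" "f * f = 0" "f * e = 0"
  defines "X \<equiv> z * (E * F)"
  shows "(X * (e + f) - (e + f) * X) * (s * e + t * f) - (s * e + t * f) * (X * (e + f) - (e + f) * X) =
    z * - (s + t) * (e * E * (F * f))"
proof -
  have zero': "f * (E * x) = 0" "F * (e * x) = 0" "e * (e * x) = 0" "f * (f * x) = 0" "f * (e * x) = 0" for x
    using zero by (simp_all flip: mult.assoc)
  have pull: "x * (z * w) = z * (x * w)" "x * (s * w) = s * (x * w)" "x * (t * w) = t * (x * w)" for x w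
    by (metis central mult.assoc)+
  define A where "A = E * (F * f) - e * (E * F)"
  have X: "X * (e + f) - (e + f) * X = z * A"
    unfolding X_def A_def by (simp add: distrib_left distrib_right right_diff_distrib mult.assoc pull(1) zero zero')
  have "A * (s * e + t * f) = - (t * (e * (E * (F * f))))"
    unfolding A_def by (simp add: distrib_left left_diff_distrib mult.assoc pull(2,3) zero zero')
  moreover have "(s * e + t * f) * A = s * (e * (E * (F * f)))"
    unfolding A_def by (simp add: distrib_right right_diff_distrib mult.assoc zero zero')
  ultimately have "z * (A * (s * e + t * f) - (s * e + t * f) * A) = z * - (s + t) * (e * E * (F * f))"
    by (simp add: algebra_simps)
  moreover have "z * A * (s * e + t * f) - (s * e + t * f) * (z * A) =
      z * (A * (s * e + t * f) - (s * e + t * f) * A)"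
    by (simp only: right_diff_distrib pull(1) mult.assoc)
  ultimately show ?thesis unfolding X by (simp only:)
qed

section \<open>The leading term of the iterated commutator\<close>

context frequencies
begin

lemma height_gcomm:
  assumes "u \<in> carrier F" "v \<in> carrier F"
  shows "height (gcomm F u v) = 0"
  using assms by (simp add: gcomm_def height_mult height_inv)

lemma fox_gcomm:
  assumes "u \<in> carrier F" "v \<in> carrier F"
  shows "fox (gcomm F u v) i = fox u 0 * fox v i - fox v 0 * fox u i"
  using assms
  by (simp add: gcomm_def fox_mult fox_inv height_mult height_inv fox_0 algebra_simps tpow_mult tpow_mult_left)

lemma height_pow:
  assumes "u \<in> carrier F"
  shows "height (u [^]\<^bsub>F\<^esub> r) = real r * height u"
proof -
  interpret F: group F by (rule group_free_group)
  have "height \<one>\<^bsub>F\<^esub> = 0" by (simp add: one_free_group height_def)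
  then show ?thesis by (induction r) (simp_all add: height_mult algebra_simps)
qed

text \<open>The first factor comes from the innermost commutator, the power from the
  \<open>k\<close> double commutators around it; \<open>v\<close> is the height of
  \<open>y 0\<close>.\<close>

definition chain_coeff :: "real \<Rightarrow> nat \<Rightarrow> nat \<Rightarrow> real_group_ring" where
  "chain_coeff v r k = (tpow (- (real r * v)) - tpow (real r * v)) * (- (tpow v + tpow (- v))) ^ k"

lemma leading_chain:
  assumes y: "y ` {..k + 1} \<subseteq> carrier F"
  defines "a \<equiv> \<lambda>j. fox (gcomm F (y 0) (y j))"
  shows "leading (2 * (k + 1)) (chain F y r k)
    (scal (chain_coeff (height (y 0)) r k) *
      (prod_list (map create (rev (map a [1..<k + 2]))) *
       prod_list (map create' (map (\<lambda>j i. bar (a j i)) [1..<k + 2]))))"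
  using y
proof (induction k)
  case 0
  interpret F: group F by (rule group_free_group)
  let ?v = "height (y 0)"
  let ?e = "create (a 1)" and ?f = "create' (\<lambda>i. bar (a 1 i))"
  have y: "y 0 \<in> carrier F" "y 1 \<in> carrier F" using 0 by auto
  have l: "leading 1 (gcomm F (y 0) (y 1)) (?e + ?f)"
    using leading_height_0[of "gcomm F (y 0) (y 1)"] y
    by (simp add: height_gcomm a_def lead_def)
  have l': "leading 1 (gconj F (y 0 [^]\<^bsub>F\<^esub> r) (gcomm F (y 0) (y 1)))
      (scal (tpow (real r * ?v)) * ?e + scal (tpow (- (real r * ?v))) * ?f)"
    using leading_gconj[OF _ l, of "y 0 [^]\<^bsub>F\<^esub> r"] y weight_lead_conj[of "real r * ?v" "a 1"]
    by (simp add: height_pow lead_def)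
  have z: "create b * (scal c * T) = scal c * (create b * T)"
    "create' b * (scal c * T) = scal c * (create' b * T)" for b c T
    by (metis mult.assoc scal_commute)+
  have "leading 2 (chain F y r 0) (scal (tpow (- (real r * ?v)) - tpow (real r * ?v)) * (?e * ?f))"
    using leading_gcomm[OF l l']
    by (simp add: distrib_left distrib_right mult.assoc z create_same create'_same create'_create
        scal_diff left_diff_distrib numeral_2_eq_2)
  then show ?case by (simp add: chain_coeff_def)
next
  case (Suc k)
  interpret F: group F by (rule group_free_group)
  let ?v = "height (y 0)" and ?j = "k + 2"
  let ?e = "create (a ?j)" and ?f = "create' (\<lambda>i. bar (a ?j i))"
  define z where "z = scal (chain_coeff ?v r k)"
  define E where "E = prod_list (map create (rev (map a [1..<k + 2])))"
  define F' where "F' = prod_list (map create' (map (\<lambda>j i. bar (a j i)) [1..<k + 2]))"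
  have y: "y 0 \<in> carrier F" "y ?j \<in> carrier F" and y': "y ` {..k + 1} \<subseteq> carrier F"
    using Suc.prems by auto
  have IH: "leading (2 * (k + 1)) (chain F y r k) (z * (E * F'))"
    using Suc.IH[OF y'] by (simp add: z_def E_def F'_def)
  have l: "leading 1 (gcomm F (y 0) (y ?j)) (?e + ?f)"
    using leading_height_0[of "gcomm F (y 0) (y ?j)"] y
    by (simp add: height_gcomm a_def lead_def)
  have l': "leading 1 (gconj F (y 0) (gcomm F (y 0) (y ?j))) (scal (tpow ?v) * ?e + scal (tpow (- ?v)) * ?f)"
    using leading_gconj[OF y(1) l] weight_lead_conj[of ?v "a ?j"]
    by (simp add: lead_def)
  \<comment> \<open>\<open>E\<close> starts with a \<open>create\<close> and \<open>F'\<close> ends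
    with a \<open>create'\<close>; this gives the two vanishing products needed below.\<close>
  have "[1..<k + 2] = [1..<k + 1] @ [k + 1]" by simp
  then have E: "E = create (a (k + 1)) * prod_list (map create (rev (map a [1..<k + 1])))"
    and F': "F' = prod_list (map create' (map (\<lambda>j i. bar (a j i)) [1..<k + 1])) * create' (\<lambda>i. bar (a (k + 1) i))"
    by (simp_all add: E_def F'_def)
  have "?f * E = 0" unfolding E by (simp add: create'_create flip: mult.assoc)
  moreover have "F' * ?e = 0" unfolding F' by (simp add: create'_create mult.assoc)
  ultimately have X: "(z * (E * F') * (?e + ?f) - (?e + ?f) * (z * (E * F'))) *
        (scal (tpow ?v) * ?e + scal (tpow (- ?v)) * ?f) -
      (scal (tpow ?v) * ?e + scal (tpow (- ?v)) * ?f) *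
        (z * (E * F') * (?e + ?f) - (?e + ?f) * (z * (E * F'))) =
      z * - (scal (tpow ?v) + scal (tpow (- ?v))) * (?e * E * (F' * ?f))"
    unfolding z_def
    by (intro double_commutator) (simp_all add: create_same create'_same create'_create scal_commute)
  have "z * - (scal (tpow ?v) + scal (tpow (- ?v))) = scal (chain_coeff ?v r (Suc k))"
  proof -
    have "chain_coeff ?v r (Suc k) = chain_coeff ?v r k * - (tpow ?v + tpow (- ?v))"
      unfolding chain_coeff_def power_Suc by (simp only: mult_ac)
    then show ?thesis unfolding z_def by (simp only: scal_mult[symmetric] scal_add scal_minus)
  qed
  moreover have "?e * E = prod_list (map create (rev (map a [1..<Suc k + 2])))"
    "F' * ?f = prod_list (map create' (map (\<lambda>j i. bar (a j i)) [1..<Suc k + 2]))"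
    by (simp_all add: E_def F'_def mult.assoc)
  moreover have "leading (2 * (k + 1) + 1 + 1) (chain F y r (Suc k))
      (z * - (scal (tpow ?v) + scal (tpow (- ?v))) * (?e * E * (F' * ?f)))"
    unfolding X[symmetric] chain.simps
    by (intro leading_gcomm IH l l') simp_all
  ultimately show ?case by simp
qed

text \<open>The corner sees only the leading term. The rows of the first factor are reversed because
  new \<open>create\<close> operators are multiplied on the left.\<close>

lemma corner_chain:
  assumes y: "y ` {..<n} \<subseteq> carrier F" and n: "n \<ge> 2"
  defines "a \<equiv> \<lambda>j. fox (gcomm F (y 0) (y j))"
  shows "corner (n - 1) (rho (chain F y r (n - 2)) - 1) =
    chain_coeff (height (y 0)) r (n - 2) *
      (minor (rev (map a [1..<n])) {1..n - 1} * bar (minor (map a [1..<n]) {1..n - 1}))"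
proof -
  have bar: "minor (map (\<lambda>j i. bar (a j i)) js) S = bar (minor (map a js) S)" for js S
  proof (induction js arbitrary: S)
    case (Cons j js)
    have "bar (wedge_sign i S) = wedge_sign i S" for i
      by (simp add: wedge_sign_def bar_power bar_minus)
    then show ?case by (simp add: minor_Cons wedge_def bar_sum bar_mult Cons)
  qed (simp add: minor_Nil)
  have n': "n - 2 + 2 = n" "2 * (n - 2 + 1) + 1 = 2 * (n - 1) + 1" "{..n - 2 + 1} = {..<n}"
    using n by auto
  have "leading (2 * (n - 2 + 1)) (chain F y r (n - 2))
    (scal (chain_coeff (height (y 0)) r (n - 2)) *
      (prod_list (map create (rev (map a [1..<n]))) *
       prod_list (map create' (map (\<lambda>j i. bar (a j i)) [1..<n]))))"
    using leading_chain[of y "n - 2" r] y unfolding n' a_def by blast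
  then have "corner (n - 1) (rho (chain F y r (n - 2)) - 1 -
      scal (chain_coeff (height (y 0)) r (n - 2)) *
      (prod_list (map create (rev (map a [1..<n]))) *
       prod_list (map create' (map (\<lambda>j i. bar (a j i)) [1..<n])))) = 0"
    unfolding leading_def n' by (intro corner_filt) blast
  then show ?thesis
    unfolding corner_diff[of _ "rho _ - 1"] corner_scal corner_create bar by (simp only: right_minus_eq)
qed

text \<open>By \<open>fox_gcomm\<close> the rows of the commutators arise from the Jacobian by
  elimination in column 0 with pivot row \<open>fox (y 0)\<close>.\<close>

lemma minor_fox_gcomm:
  assumes y: "y ` {..<n} \<subseteq> carrier F" and n: "n \<ge> 1"
  shows "fox (y 0) 0 * minor (map (\<lambda>j. fox (gcomm F (y 0) (y j))) [1..<n]) {1..n - 1} =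
    fox (y 0) 0 ^ (n - 1) * minor (map (\<lambda>j. fox (y j)) [0..<n]) {0..<n}"
proof -
  let ?cs = "map (\<lambda>j. fox (gcomm F (y 0) (y j))) [1..<n]" and ?bs = "map (\<lambda>j. fox (y j)) [1..<n]"
  have cs: "?cs = map (\<lambda>b i. fox (y 0) 0 * b i - b 0 * fox (y 0) i) ?bs"
    using y n by (auto simp: fox_gcomm fun_eq_iff image_subset_iff)
  have S: "{0..<n} = insert 0 {1..n - 1}" using n by auto
  have l: "map (\<lambda>j. fox (y j)) [0..<n] = fox (y 0) # ?bs"
    using n by (simp add: upt_conv_Cons)
  have "minor (fox (y 0) # ?cs) {0..<n} = fox (y 0) 0 * minor ?cs {1..n - 1}"
    unfolding S
    by (rule minor_Cons_zero_column) (use y n in \<open>auto simp: fox_gcomm image_subset_iff\<close>)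
  moreover have "minor (fox (y 0) # ?cs) {0..<n} = fox (y 0) 0 ^ (n - 1) * minor (fox (y 0) # ?bs) {0..<n}"
    unfolding cs using minor_row_reduce[of "fox (y 0)" ?bs "{0..<n}"] by simp
  ultimately show ?thesis unfolding l by simp
qed

text \<open>The Jacobian of the identity is lower triangular, with diagonal entries
  \<open>tpow (\<theta> 0) - 1\<close> and otherwise 1.\<close>

lemma minor_fox_gen:
  assumes "n \<ge> 1"
  shows "minor (map (\<lambda>j. fox (gen j)) [0..<n]) {0..<n} = tpow (\<theta> 0) - 1"
proof -
  have unit: "minor (map fox_gen [k..<n]) {k..<n} = 1" if "k \<ge> 1" "k \<le> n" for k
    using that(2,1)
  proof (induction k rule: inc_induct)
    case base
    show ?case by (simp add: minor_Nil)
  next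
    case (step k)
    have "minor (map fox_gen [k..<n]) {k..<n} = wedge (fox_gen k) (minor (map fox_gen [Suc k..<n])) {k..<n}"
      using step by (simp add: upt_conv_Cons minor_Cons)
    also have "\<dots> = (\<Sum>i\<in>{k}. wedge_sign i {k..<n} * fox_gen k i * minor (map fox_gen [Suc k..<n]) ({k..<n} - {i}))"
      unfolding wedge_def by (rule sum.mono_neutral_right) (use step in \<open>auto simp: fox_gen_def\<close>)
    also have "\<dots> = minor (map fox_gen [Suc k..<n]) ({k..<n} - {k})"
    proof -
      have "{j \<in> {k..<n}. j < k} = {}" by auto
      then have "wedge_sign k {k..<n} = (1 :: real_group_ring)"
        by (simp only: wedge_sign_def card.empty power_0)
      moreover have "fox_gen k k = 1" using step by (simp add: fox_gen_def)
      ultimately show ?thesis by simp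
    qed
    also have "{k..<n} - {k} = {Suc k..<n}" by auto
    finally show ?case using step by simp
  qed
  have "minor (map (\<lambda>j. fox (gen j)) [0..<n]) {0..<n} =
      wedge (fox_gen 0) (minor (map fox_gen [1..<n])) {0..<n}"
  proof -
    have "map (\<lambda>j. fox (gen j)) [0..<n] = fox_gen 0 # map fox_gen [1..<n]"
      using assms by (simp add: upt_conv_Cons fun_eq_iff del: fox.simps)
    then show ?thesis by (simp only: minor_Cons)
  qed
  also have "\<dots> = (\<Sum>i\<in>{0}. wedge_sign i {0..<n} * fox_gen 0 i * minor (map fox_gen [1..<n]) ({0..<n} - {i}))"
    unfolding wedge_def
    by (rule sum.mono_neutral_right) (use assms in \<open>auto simp: fox_gen_def\<close>)
  also have "\<dots> = fox_gen 0 0 * minor (map fox_gen [1..<n]) ({0..<n} - {0})"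
    by (simp add: wedge_sign_def)
  also have "{0..<n} - {0} = {1..<n}" by auto
  also have "minor (map fox_gen [1..<n]) {1..<n} = 1" using assms by (intro unit) simp_all
  finally show ?thesis by (simp only: fox_gen_def refl if_True mult_1_right simp_thms)
qed

lemma auto_inverse_word:
  assumes "\<alpha> \<in> auto F" "w \<in> carrier F"
  obtains w' where "w' \<in> carrier F" "\<alpha> w' = w"
proof -
  have "\<alpha> ` carrier F = carrier F"
    using group.auto_bij[OF group_free_group assms(1)] by (rule bij_betw_imp_surj_on)
  then have "w \<in> \<alpha> ` carrier F" using assms(2) by blast
  then show ?thesis using that by (auto elim!: imageE)
qed

text \<open>The Jacobian rows of \<open>\<alpha>\<close> and of the identity lie in each other's
  span, so the two determinants divide each other. Cancelling the nonzero
  \<open>tpow (\<theta> 0) - 1\<close> leaves a unit, to which \<open>unit_mult_bar\<close>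
  applies.\<close>

lemma minor_fox_auto:
  assumes \<alpha>: "\<alpha> \<in> auto F" and n: "n \<ge> 1" and \<theta>: "\<theta> 0 \<noteq> 0"
  shows "\<exists>u. minor (map (\<lambda>j. fox (\<alpha> (gen j))) [0..<n]) {0..<n} = u * (tpow (\<theta> 0) - 1) \<and> u * bar u = 1"
proof -
  let ?D = "minor (map (\<lambda>j. fox (\<alpha> (gen j))) [0..<n]) {0..<n}"
  note hom = group.auto_hom[OF group_free_group \<alpha>]
  have id: "(\<lambda>w. w) \<in> hom F F" by (auto simp: hom_def)
  have "\<exists>K. fox (\<alpha> (gen j)) = (\<lambda>i. \<Sum>k<n. K k * fox (gen k) i)" if "j < n" for j
    using fox_hom_span[OF id, of "\<alpha> (gen j)"] that group.auto_closed[OF group_free_group \<alpha>] by simp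
  then have "minor (map (\<lambda>j. fox (gen j)) [0..<n]) {0..<n} dvd ?D"
    by (intro minor_dvd) auto
  then obtain u where u: "?D = (tpow (\<theta> 0) - 1) * u"
    unfolding minor_fox_gen[OF n] by blast
  have "\<exists>K. fox (gen j) = (\<lambda>i. \<Sum>k<n. K k * fox (\<alpha> (gen k)) i)" if j: "j < n" for j
  proof -
    obtain w where "w \<in> carrier F" "\<alpha> w = gen j"
      using auto_inverse_word[OF \<alpha> gen_carrier[OF j]] .
    then show ?thesis using fox_hom_span[OF hom, of w] by simp
  qed
  then have "?D dvd minor (map (\<lambda>j. fox (gen j)) [0..<n]) {0..<n}"
    by (intro minor_dvd) auto
  then obtain u' where "tpow (\<theta> 0) - 1 = ?D * u'"
    unfolding minor_fox_gen[OF n] by blast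
  then have "(tpow (\<theta> 0) - 1) * (u * u' - 1) = 0"
    unfolding u by (simp add: algebra_simps)
  then have "u * u' = 1" using \<theta> by (simp add: tpow_eq_one_iff)
  then show ?thesis using u unit_mult_bar[of u u'] by (intro exI[of _ u]) (simp add: mult.commute)
qed

end

section \<open>Closed systems defined by a paradoxical word\<close>

text \<open>Membership of a fixed element is a coordinate of the product space with values in a
  discrete space.\<close>

lemma (in group) closedin_member:
  assumes "u \<in> carrier G"
  shows "closedin (normal_subgroup_space G) {N. N \<lhd> G \<and> u \<in> N}"
    and "closedin (normal_subgroup_space G) {N. N \<lhd> G \<and> u \<notin> N}"
    and "openin (normal_subgroup_space G) {N. N \<lhd> G \<and> u \<in> N}"
proof -
  let ?T = "normal_subgroup_space G"
  let ?P = "product_topology (\<lambda>_. discrete_topology (UNIV :: bool set)) (carrier G)"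
  let ?ind = "\<lambda>N. \<lambda>g\<in>carrier G. g \<in> N"
  have "continuous_map ?T (discrete_topology UNIV) ((\<lambda>f. f u) \<circ> ?ind)"
    unfolding normal_subgroup_space_def using assms
    by (intro continuous_map_pullback continuous_map_product_projection)
  then have cont: "continuous_map ?T (discrete_topology UNIV) (\<lambda>N. u \<in> N)"
    by (rule continuous_map_eq) (use assms in simp)
  have "openin ?T {N \<in> topspace ?T. (u \<in> N) \<in> {b}}" for b
    by (rule openin_continuous_map_preimage[OF cont]) simp
  from this[of True] this[of False]
  have o: "openin ?T {N. N \<lhd> G \<and> u \<in> N}" "openin ?T {N. N \<lhd> G \<and> u \<notin> N}" by simp_all
  have "{N. N \<lhd> G} - {N. N \<lhd> G \<and> u \<in> N} = {N. N \<lhd> G \<and> u \<notin> N}"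
    "{N. N \<lhd> G} - {N. N \<lhd> G \<and> u \<notin> N} = {N. N \<lhd> G \<and> u \<in> N}" by auto
  then show "closedin ?T {N. N \<lhd> G \<and> u \<in> N}" "closedin ?T {N. N \<lhd> G \<and> u \<notin> N}"
    "openin ?T {N. N \<lhd> G \<and> u \<in> N}"
    using o by (auto simp: closedin_def)
qed

lemma (in group) auto_inverse:
  assumes "\<alpha> \<in> auto G"
  shows "\<exists>\<beta>\<in>auto G. \<forall>x\<in>carrier G. \<alpha> (\<beta> x) = x \<and> \<beta> (\<alpha> x) = x"
proof -
  interpret A: group "AutoGroup G" by (rule AutoGroup)
  let ?\<beta> = "inv\<^bsub>AutoGroup G\<^esub> \<alpha>"
  have b: "?\<beta> \<in> auto G" using assms A.inv_closed[of \<alpha>] unfolding AutoGroup_simps by blast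
  have "compose (carrier G) \<alpha> ?\<beta> = (\<lambda>x\<in>carrier G. x)" "compose (carrier G) ?\<beta> \<alpha> = (\<lambda>x\<in>carrier G. x)"
    using A.r_inv[of \<alpha>] A.l_inv[of \<alpha>] assms b by (simp_all add: AutoGroup_simps)
  then have "\<alpha> (?\<beta> x) = x \<and> ?\<beta> (\<alpha> x) = x" if "x \<in> carrier G" for x
    using that by (metis compose_eq restrict_apply')
  then show ?thesis using b by blast
qed

lemma (in group) auto_compose:
  "\<alpha> \<in> auto G \<Longrightarrow> \<beta> \<in> auto G \<Longrightarrow> compose (carrier G) \<alpha> \<beta> \<in> auto G"
  using monoid.m_closed[OF group.is_monoid[OF AutoGroup], of \<alpha> \<beta>] by (simp add: AutoGroup_simps)

text \<open>Two translates of the clopen set of normal subgroups containing \<open>w\<close> cover the subsystem, while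
  three translates are disjoint, so its measure would be at least \<open>1/2\<close> and at most \<open>1/3\<close>.\<close>

lemma (in group) subsystem_without_invariant_measure:
  assumes w: "w \<in> carrier G" and N0: "N0 \<lhd> G"
    and autos: "\<sigma> \<in> auto G" "\<beta>1 \<in> auto G" "\<beta>2 \<in> auto G" "\<beta>3 \<in> auto G"
    and cover: "\<And>\<alpha>. \<alpha> \<in> auto G \<Longrightarrow> \<alpha> w \<in> N0 \<or> \<alpha> (\<sigma> w) \<in> N0"
    and disj12: "\<And>\<alpha>. \<alpha> \<in> auto G \<Longrightarrow> \<alpha> (\<beta>1 w) \<notin> N0 \<or> \<alpha> (\<beta>2 w) \<notin> N0"
    and disj13: "\<And>\<alpha>. \<alpha> \<in> auto G \<Longrightarrow> \<alpha> (\<beta>1 w) \<notin> N0 \<or> \<alpha> (\<beta>3 w) \<notin> N0"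
    and disj23: "\<And>\<alpha>. \<alpha> \<in> auto G \<Longrightarrow> \<alpha> (\<beta>2 w) \<notin> N0 \<or> \<alpha> (\<beta>3 w) \<notin> N0"
  shows "\<exists>Z. subsystem (OutGroup G) (out_action G) (normal_subgroup_space G) Z \<and>
    \<not> (\<exists>\<mu>. invariant_prob_measure (OutGroup G) (out_action G) (subtopology (normal_subgroup_space G) Z) \<mu>)"
proof -
  let ?T = "normal_subgroup_space G"
  define Q where "Q N \<alpha> \<longleftrightarrow> (\<alpha> w \<in> N \<or> \<alpha> (\<sigma> w) \<in> N) \<and> (\<alpha> (\<beta>1 w) \<notin> N \<or> \<alpha> (\<beta>2 w) \<notin> N) \<and>
    (\<alpha> (\<beta>1 w) \<notin> N \<or> \<alpha> (\<beta>3 w) \<notin> N) \<and> (\<alpha> (\<beta>2 w) \<notin> N \<or> \<alpha> (\<beta>3 w) \<notin> N)"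
    for N :: "'a set" and \<alpha>
  \<comment> \<open>Imposing the rules for every automorphism makes the set invariant, and it stays
    closed as an intersection of closed sets.\<close>
  define Z where "Z = {N. N \<lhd> G \<and> (\<forall>\<alpha>\<in>auto G. Q N \<alpha>)}"
  have wc: "\<sigma> w \<in> carrier G" "\<beta>1 w \<in> carrier G" "\<beta>2 w \<in> carrier G" "\<beta>3 w \<in> carrier G"
    using w autos auto_closed by auto
  have id: "(\<lambda>x\<in>carrier G. x) \<in> auto G" by (rule id_in_auto)
  have mem: "\<gamma> u \<in> \<gamma> ` N \<longleftrightarrow> u \<in> N" if "\<gamma> \<in> auto G" "u \<in> carrier G" "N \<lhd> G" for \<gamma> u N
    using that normal_subset[of N] auto_bij[of \<gamma>] by (auto simp: bij_betw_def inj_on_def)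
  have image: "\<gamma> ` N \<in> Z" if \<gamma>: "\<gamma> \<in> auto G" and N: "N \<in> Z" for \<gamma> N
  proof -
    have n: "N \<lhd> G" using N by (simp add: Z_def)
    obtain \<delta> where \<delta>: "\<delta> \<in> auto G" "\<And>x. x \<in> carrier G \<Longrightarrow> \<gamma> (\<delta> x) = x"
      using auto_inverse[OF \<gamma>] by blast
    have "Q (\<gamma> ` N) \<alpha>" if \<alpha>: "\<alpha> \<in> auto G" for \<alpha>
    proof -
      \<comment> \<open>Replacing \<open>N\<close> by its image under \<open>\<gamma>\<close>
        amounts to replacing \<open>\<alpha>\<close> by its composition with the inverse of
        \<open>\<gamma>\<close>.\<close>
      have "\<alpha> u \<in> \<gamma> ` N \<longleftrightarrow> compose (carrier G) \<delta> \<alpha> u \<in> N" if u: "u \<in> carrier G" for u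
        using mem[OF \<gamma> _ n, of "\<delta> (\<alpha> u)"] \<delta> u auto_closed[OF \<alpha> u] auto_closed[OF \<delta>(1)]
        by (simp add: compose_eq)
      moreover have "Q N (compose (carrier G) \<delta> \<alpha>)"
        using N auto_compose[OF \<delta>(1) \<alpha>] by (simp add: Z_def)
      ultimately show ?thesis using w wc by (simp add: Q_def)
    qed
    then show ?thesis using auto_image_normal[OF \<gamma> n] by (simp add: Z_def)
  qed
  have act: "out_action G c ` Z = Z" if c: "c \<in> carrier (OutGroup G)" for c
  proof -
    obtain \<gamma> where \<gamma>: "\<gamma> \<in> auto G" "c = Inn G #>\<^bsub>AutoGroup G\<^esub> \<gamma>" using c by (rule OutGroup_cases)
    obtain \<delta> where \<delta>: "\<delta> \<in> auto G" "\<And>x. x \<in> carrier G \<Longrightarrow> \<gamma> (\<delta> x) = x"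
      using auto_inverse[OF \<gamma>(1)] by blast
    have eq: "out_action G c N = \<gamma> ` N" if "N \<in> Z" for N
      using that \<gamma> by (simp add: out_action_coset Z_def)
    have "N \<in> out_action G c ` Z" if N: "N \<in> Z" for N
    proof -
      have "\<gamma> ` \<delta> ` N = N"
      proof -
        have "N \<subseteq> carrier G" using N normal_subset by (simp add: Z_def)
        then have "(\<lambda>x. \<gamma> (\<delta> x)) ` N = (\<lambda>x. x) ` N" using \<delta>(2) by (intro image_cong) auto
        then show ?thesis by (simp add: image_image)
      qed
      then show ?thesis using eq[OF image[OF \<delta>(1) N]] image[OF \<delta>(1) N] by (metis imageI)
    qed
    then show ?thesis using eq image[OF \<gamma>(1)] by auto
  qed
  have closed: "closedin ?T Z"
  proof -
    let ?A = "\<lambda>u. {N. N \<lhd> G \<and> u \<in> N}" and ?B = "\<lambda>u. {N. N \<lhd> G \<and> u \<notin> N}"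
    have "closedin ?T ((?A (\<alpha> w) \<union> ?A (\<alpha> (\<sigma> w))) \<inter> (?B (\<alpha> (\<beta>1 w)) \<union> ?B (\<alpha> (\<beta>2 w))) \<inter>
        (?B (\<alpha> (\<beta>1 w)) \<union> ?B (\<alpha> (\<beta>3 w))) \<inter> (?B (\<alpha> (\<beta>2 w)) \<union> ?B (\<alpha> (\<beta>3 w))))"
      if "\<alpha> \<in> auto G" for \<alpha>
    proof -
      have "\<alpha> u \<in> carrier G" if "u \<in> carrier G" for u
        using that \<open>\<alpha> \<in> auto G\<close> by (rule auto_closed[rotated])
      note closedin_member(1)[OF this] closedin_member(2)[OF this]
      from this[OF w] this[OF wc(1)] this[OF wc(2)] this[OF wc(3)] this[OF wc(4)]
      show ?thesis by (intro closedin_Int closedin_Un) assumption+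
    qed
    then have "closedin ?T (\<Inter>\<alpha>\<in>auto G. (?A (\<alpha> w) \<union> ?A (\<alpha> (\<sigma> w))) \<inter>
        (?B (\<alpha> (\<beta>1 w)) \<union> ?B (\<alpha> (\<beta>2 w))) \<inter>
        (?B (\<alpha> (\<beta>1 w)) \<union> ?B (\<alpha> (\<beta>3 w))) \<inter> (?B (\<alpha> (\<beta>2 w)) \<union> ?B (\<alpha> (\<beta>3 w))))"
      using id by (intro closedin_INT) auto
    moreover have "\<dots> = Z" using id by (auto simp: Z_def Q_def)
    ultimately show ?thesis by simp
  qed
  have "N0 \<in> Z" using N0 cover disj12 disj13 disj23 by (simp add: Z_def Q_def)
  then have sub: "subsystem (OutGroup G) (out_action G) ?T Z"
    using closed act by (auto simp: subsystem_def)
  have False if \<mu>: "invariant_prob_measure (OutGroup G) (out_action G) (subtopology ?T Z) \<mu>" for \<mu>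
  proof -
    interpret prob_space \<mu> using \<mu> by (simp add: invariant_prob_measure_def)
    have top: "topspace (subtopology ?T Z) = Z" by (auto simp: Z_def)
    have space: "space \<mu> = Z" and sets: "sets \<mu> = borel_algebra (subtopology ?T Z)"
      using \<mu> unfolding invariant_prob_measure_def top by blast+
    define U where "U u = {N \<in> Z. u \<in> N}" for u
    have "U u = {N. N \<lhd> G \<and> u \<in> N} \<inter> Z" for u by (auto simp: U_def Z_def)
    then have "openin (subtopology ?T Z) (U u)" if "u \<in> carrier G" for u
      using closedin_member(3)[OF that] by (auto simp: openin_subtopology)
    then have borel: "U u \<in> borel_algebra (subtopology ?T Z)" if "u \<in> carrier G" for u
      using that by (auto simp: borel_algebra_def intro: sigma_sets.Basic)
    then have Us: "U u \<in> sets \<mu>" if "u \<in> carrier G" for u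
      using that by (simp add: sets)
    have inv: "measure \<mu> (U (\<gamma> u)) = measure \<mu> (U u)" if \<gamma>: "\<gamma> \<in> auto G" and u: "u \<in> carrier G" for \<gamma> u
    proof -
      let ?c = "Inn G #>\<^bsub>AutoGroup G\<^esub> \<gamma>"
      have c: "?c \<in> carrier (OutGroup G)"
        using \<gamma> by (auto simp: OutGroup_def carrier_FactGroup AutoGroup_simps)
      have eq: "out_action G ?c N = \<gamma> ` N" if "N \<in> Z" for N
        using that \<gamma> by (simp add: out_action_coset Z_def)
      have "out_action G ?c ` U u = U (\<gamma> u)"
      proof
        show "out_action G ?c ` U u \<subseteq> U (\<gamma> u)"
          using eq image[OF \<gamma>] by (auto simp: U_def)
        show "U (\<gamma> u) \<subseteq> out_action G ?c ` U u"
        proof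
          fix N assume N: "N \<in> U (\<gamma> u)"
          then obtain M where M: "M \<in> Z" "N = out_action G ?c M"
            using act[OF c] by (auto simp: U_def)
          then have "u \<in> M" using N eq mem[OF \<gamma> u, of M] by (simp add: U_def Z_def)
          then show "N \<in> out_action G ?c ` U u" using M by (auto simp: U_def)
        qed
      qed
      moreover have "emeasure \<mu> (out_action G ?c ` U u) = emeasure \<mu> (U u)"
        using \<mu> c borel[OF u] unfolding invariant_prob_measure_def by blast
      ultimately show ?thesis by (simp add: measure_def)
    qed
    \<comment> \<open>The rules at the identity already give the covering and the
      disjointness.\<close>
    have Q: "Q N (\<lambda>x\<in>carrier G. x)" if "N \<in> Z" for N using that id by (simp add: Z_def)
    have "Z = U w \<union> U (\<sigma> w)"
      using Q w wc by (auto simp: U_def Q_def)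
    then have "1 \<le> measure \<mu> (U w) + measure \<mu> (U (\<sigma> w))"
      using measure_Un_le[OF Us[OF w] Us[OF wc(1)]] prob_space by (simp add: space)
    moreover have "measure \<mu> (U (\<beta>1 w) \<union> U (\<beta>2 w) \<union> U (\<beta>3 w)) =
        measure \<mu> (U (\<beta>1 w)) + measure \<mu> (U (\<beta>2 w)) + measure \<mu> (U (\<beta>3 w))"
      using Q w wc Us by (subst finite_measure_Union, auto simp: U_def Q_def)+
    moreover have "measure \<mu> (U (\<beta>1 w) \<union> U (\<beta>2 w) \<union> U (\<beta>3 w)) \<le> 1" by (rule prob_le_1)
    ultimately show False using inv[OF _ w] autos by simp
  qed
  with sub show ?thesis by blast
qed

section \<open>A normal subgroup detecting signs of heights\<close>

text \<open>The exponent \<open>r\<close> is the span of the second factor, so that only its two extreme coefficients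
  and its coefficient sum \<open>0\<close> matter.\<close>

lemma fsum_pos_chain_coeff:
  fixes m :: nat
  defines "r \<equiv> if m = 0 then 1 else 2 * m"
  shows "\<exists>c::int. c \<noteq> 0 \<and> (\<forall>v. v \<noteq> 0 \<longrightarrow>
    fsum pos (frequencies.chain_coeff v r m * ((tpow v - 1) * bar (tpow v - 1)) ^ m) = (if v > 0 then c else - c))"
proof -
  define z where "z v = frequencies.chain_coeff v r m * ((tpow v - 1) * bar (tpow v - 1)) ^ m" for v
  \<comment> \<open>One factor for each double commutator. It is invariant under \<open>bar\<close>
    and even in \<open>v\<close>, so \<open>z\<close> is odd in \<open>v\<close> and only
    \<open>v > 0\<close> has to be computed.\<close>
  define w where "w v = - (tpow v + tpow (- v)) * ((tpow v - 1) * bar (tpow v - 1))" for v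
  have z: "z v = tpow (- (real r * v)) * w v ^ m - tpow (real r * v) * w v ^ m" for v
    unfolding z_def frequencies.chain_coeff_def w_def power_mult_distrib
    by (simp only: left_diff_distrib mult.assoc)
  have wbar: "bar (w v) = w v" "w (- v) = w v" for v
    by (simp_all add: w_def bar_mult bar_minus bar_add bar_diff mult_ac add_ac)
  have odd: "z (- v) = - z v" for v
    unfolding z wbar by simp
  have "\<exists>c::int. c \<noteq> 0 \<and> (\<forall>v>0. fsum pos (z v) = c)"
  proof (cases "m = 0")
    case True
    have "fsum pos (z v) = - 1" if "v > 0" for v
      unfolding z using True that by (simp add: r_def fsum_diff pos_def)
    then show ?thesis by (intro exI[of _ "- 1"]) simp
  next
    case False
    have "fsum pos (z v) = 1" if v: "v > 0" for v
    proof -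
      define K where "K = real m * (2 * v)"
      have rv: "real r * v = K" using False by (simp add: r_def K_def)
      let ?s = "w v ^ m"
      have "w v = tpow (2 * v) - tpow v - tpow v + (tpow 0 + tpow 0) - tpow (- v) - tpow (- v) + tpow (- (2 * v))"
        by (simp add: w_def bar_diff algebra_simps tpow_mult)
      then have "Poly_Mapping.lookup (w v) k = Poly_Mapping.lookup (tpow (2 * v) - tpow v - tpow v
          + (tpow 0 + tpow 0) - tpow (- v) - tpow (- v) + tpow (- (2 * v))) k" for k
        by (rule arg_cong)
      then have lw: "Poly_Mapping.lookup (w v) k = (1 when 2 * v = k) - (1 when v = k) - (1 when v = k)
          + ((1 when 0 = k) + (1 when 0 = k)) - (1 when - v = k) - (1 when - v = k) + (1 when - (2 * v) = k)" for k
        by (simp only: lookup_add lookup_minus lookup_single)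
      have "k \<le> 2 * v" if "k \<in> Poly_Mapping.keys (w v)" for k
      proof (rule ccontr)
        assume "\<not> k \<le> 2 * v"
        then have "Poly_Mapping.lookup (w v) k = 0" using v unfolding lw by (simp add: when_def)
        then show False using that by (simp add: in_keys_iff)
      qed
      moreover have "Poly_Mapping.lookup (w v) (2 * v) = 1"
        using v unfolding lw by (simp add: when_def)
      ultimately have top: "\<And>k. k \<in> Poly_Mapping.keys ?s \<Longrightarrow> k \<le> K" "Poly_Mapping.lookup ?s K = 1"
        using lookup_power_Max[of "w v" "2 * v" m] unfolding K_def by auto
      have bar: "bar ?s = ?s" by (simp add: bar_power wbar)
      have bot: "\<And>k. k \<in> Poly_Mapping.keys ?s \<Longrightarrow> - K \<le> k"
        using top(1) keys_bar[of ?s] unfolding bar by force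
      have lbot: "Poly_Mapping.lookup ?s (- K) = 1"
        using lookup_bar[of ?s "- K"] top(2) unfolding bar by simp
      \<comment> \<open>A factor \<open>tpow v - 1\<close> is split off from \<open>?s\<close>; it
        forces the coefficient sum to be 0.\<close>
      define y where "y = - (tpow v + tpow (- v)) * bar (tpow v - 1)"
      define x where "x = y * w v ^ (m - 1)"
      have "w v = (tpow v - 1) * y"
        unfolding w_def y_def by (simp only: mult_ac)
      moreover have "?s = w v * w v ^ (m - 1)" using False by (cases m) simp_all
      ultimately have "?s = (tpow v - 1) * x" unfolding x_def by (metis mult.assoc)
      then have "?s = tpow v * x - x" by (simp only: left_diff_distrib mult_1_left)
      then have "fsum (\<lambda>_. 1) ?s = fsum (\<lambda>_. 1) (tpow v * x) - fsum (\<lambda>_. 1) x"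
        by (simp only: fsum_diff)
      then have one: "fsum (\<lambda>_. 1) ?s = 0" by (simp only: fsum_tpow_mult diff_self)
      \<comment> \<open>After the shift by \<open>- K\<close> no exponent is positive.\<close>
      have "fsum pos (tpow (- K) * ?s) = fsum (\<lambda>_. 0) ?s"
        unfolding fsum_tpow_mult by (rule fsum_cong) (auto simp: pos_def dest: top(1))
      moreover have "fsum (\<lambda>_. 0) ?s = 0" by (simp add: fsum_def)
      \<comment> \<open>After the shift by \<open>K\<close> all exponents are positive except that
        of the lowest term, whose coefficient is 1.\<close>
      moreover have "fsum pos (tpow K * ?s) = fsum (\<lambda>k. 1 - (if k = - K then 1 else 0)) ?s"
        unfolding fsum_tpow_mult by (rule fsum_cong) (auto simp: pos_def dest: bot)
      moreover have "\<dots> = - 1"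
        unfolding fsum_fun_diff fsum_delta one lbot by simp
      ultimately show ?thesis unfolding z rv fsum_diff by simp
    qed
    then show ?thesis by (intro exI[of _ 1]) simp
  qed
  then obtain c :: int where c: "c \<noteq> 0" "\<And>v. v > 0 \<Longrightarrow> fsum pos (z v) = c" by blast
  have "fsum pos (z v) = - c" if "v < 0" for v
    using c(2)[of "- v"] that odd[of v] by (simp add: fsum_minus)
  with c show ?thesis unfolding z_def[symmetric]
    by (metis linorder_neqE_linordered_idom order_less_asym)
qed

section \<open>The largest normal subgroup on whose cosets a given function is constant\<close>

context group
begin

definition syntactic_kernel :: "('a \<Rightarrow> 'c) \<Rightarrow> 'a set" where
  "syntactic_kernel \<psi> = {u \<in> carrier G. \<forall>p\<in>carrier G. \<forall>q\<in>carrier G. \<psi> (p \<otimes> u \<otimes> q) = \<psi> (p \<otimes> q)}"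

lemma syntactic_kernel_normal: "syntactic_kernel \<psi> \<lhd> G"
proof (rule normal_invI)
  show "subgroup (syntactic_kernel \<psi>) G"
  proof
    fix u v assume u: "u \<in> syntactic_kernel \<psi>" and v: "v \<in> syntactic_kernel \<psi>"
    have "\<psi> (p \<otimes> (u \<otimes> v) \<otimes> q) = \<psi> (p \<otimes> q)" if "p \<in> carrier G" "q \<in> carrier G" for p q
    proof -
      have "\<psi> (p \<otimes> (u \<otimes> v) \<otimes> q) = \<psi> ((p \<otimes> u) \<otimes> v \<otimes> q)"
        using u v that by (simp add: syntactic_kernel_def m_assoc)
      then show ?thesis using u v that by (simp add: syntactic_kernel_def)
    qed
    then show "u \<otimes> v \<in> syntactic_kernel \<psi>" using u v by (simp add: syntactic_kernel_def)
  next
    fix u assume u: "u \<in> syntactic_kernel \<psi>"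
    have "\<psi> (p \<otimes> inv u \<otimes> q) = \<psi> (p \<otimes> q)" if "p \<in> carrier G" "q \<in> carrier G" for p q
    proof -
      have "\<psi> (p \<otimes> inv u \<otimes> q) = \<psi> (p \<otimes> inv u \<otimes> u \<otimes> q)"
        using u that by (simp add: syntactic_kernel_def)
      then show ?thesis using u that by (simp add: syntactic_kernel_def m_assoc)
    qed
    then show "inv u \<in> syntactic_kernel \<psi>" using u by (simp add: syntactic_kernel_def)
  qed (auto simp: syntactic_kernel_def)
next
  fix x u assume x: "x \<in> carrier G" and u: "u \<in> syntactic_kernel \<psi>"
  have "\<psi> (p \<otimes> (x \<otimes> u \<otimes> inv x) \<otimes> q) = \<psi> (p \<otimes> q)" if "p \<in> carrier G" "q \<in> carrier G" for p q
  proof -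
    have "\<psi> (p \<otimes> (x \<otimes> u \<otimes> inv x) \<otimes> q) = \<psi> ((p \<otimes> x) \<otimes> u \<otimes> (inv x \<otimes> q))"
      using u x that by (simp add: syntactic_kernel_def m_assoc)
    also have "\<dots> = \<psi> ((p \<otimes> x) \<otimes> (inv x \<otimes> q))"
      using u x that by (simp add: syntactic_kernel_def)
    also have "(p \<otimes> x) \<otimes> (inv x \<otimes> q) = p \<otimes> q"
      using x that by (metis inv_closed m_assoc m_closed r_inv r_one)
    finally show ?thesis .
  qed
  then show "x \<otimes> u \<otimes> inv x \<in> syntactic_kernel \<psi>" using x u by (simp add: syntactic_kernel_def)
qed

end

context frequencies
begin

text \<open>In degree \<open>2 * d\<close> only the weights of \<open>p\<close> and \<open>q\<close>
  act, and the corner ignores them. This settles the condition defining the kernel for all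
  \<open>p\<close> and \<open>q\<close> at once.\<close>

lemma corner_rho:
  assumes E: "E \<in> filt (2 * d)"
  shows "corner d (rho p * E * rho q) = corner d E"
proof -
  let ?P = "weight (height p)" and ?Q = "weight (height q)"
  have "rho p * E * rho q = (rho p - ?P) * E * rho q + ?P * E * (rho q - ?Q) + ?P * E * ?Q"
    by (simp add: algebra_simps)
  moreover have "(rho p - ?P) * E * rho q \<in> filt (2 * d + 1)"
    by (rule filt_mult_le[OF filt_mult[OF rho_weight E] rho_filt]) simp
  moreover have "?P * E * (rho q - ?Q) \<in> filt (2 * d + 1)"
    by (rule filt_mult_le[OF filt_mult[OF filt_weight E] rho_weight]) simp
  ultimately show ?thesis
    by (simp only: corner_add corner_filt corner_weight add_0)
qed

lemma fsum_sign_mult: "fsum f ((- 1) ^ e * z) = (- 1) ^ e * fsum f z"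
  by (cases "even e") (simp_all add: fsum_minus)

text \<open>The determinant enters as \<open>\<Delta> * bar \<Delta>\<close>, in which the unit
  \<open>u\<close> disappears, so only the height of \<open>\<alpha> (gen 0)\<close> is left. By
  \<open>\<theta> 0 = 1\<close> the factor \<open>q * bar q\<close> is the one that
  \<open>second_sum\<close> cancels.\<close>

lemma chain_value:
  assumes n: "n \<ge> 2" and \<theta>: "\<theta> 0 = 1"
  defines "r \<equiv> if n = 2 then 1 else 2 * (n - 2)"
  shows "\<exists>c::int. c \<noteq> 0 \<and> (\<forall>\<alpha>\<in>auto F. height (\<alpha> (gen 0)) \<noteq> 0 \<longrightarrow>
    fsum second_sum (corner (n - 1) (rho (chain F (\<lambda>j. \<alpha> (gen j)) r (n - 2)) - 1)) =
      (if height (\<alpha> (gen 0)) > 0 then c else - c))"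
proof -
  obtain e where e: "length as = n - 1 \<Longrightarrow> minor (rev as) S = (- 1) ^ e * minor as S"
    for as :: "(nat \<Rightarrow> real_group_ring) list" and S
    using minor_rev by blast
  have r: "r = (if n - 2 = 0 then 1 else 2 * (n - 2))" using n by (auto simp: r_def)
  obtain c :: int where c: "c \<noteq> 0" "v \<noteq> 0 \<Longrightarrow>
      fsum pos (chain_coeff v r (n - 2) * ((tpow v - 1) * bar (tpow v - 1)) ^ (n - 2)) = (if v > 0 then c else - c)" for v
    using fsum_pos_chain_coeff[of "n - 2"] unfolding r by blast
  have "fsum second_sum (corner (n - 1) (rho (chain F (\<lambda>j. \<alpha> (gen j)) r (n - 2)) - 1)) =
      (if height (\<alpha> (gen 0)) > 0 then (- 1) ^ e * c else - ((- 1) ^ e * c))"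
    if \<alpha>: "\<alpha> \<in> auto F" and v: "height (\<alpha> (gen 0)) \<noteq> 0" for \<alpha>
  proof -
    define y where "y = (\<lambda>j. \<alpha> (gen j))"
    define v where "v = height (y 0)"
    define p where "p = tpow v - 1"
    define q where "q = tpow 1 - 1"
    define \<Delta> where "\<Delta> = minor (map (\<lambda>j. fox (gcomm F (y 0) (y j))) [1..<n]) {1..n - 1}"
    have y: "y ` {..<n} \<subseteq> carrier F"
      using group.auto_closed[OF group_free_group \<alpha>] by (auto simp: y_def)
    have v0: "v \<noteq> 0" using v by (simp add: v_def y_def)
    then have p0: "p \<noteq> 0" by (simp add: p_def tpow_eq_one_iff)
    obtain u where u: "minor (map (\<lambda>j. fox (y j)) [0..<n]) {0..<n} = u * q" "u * bar u = 1"
      using minor_fox_auto[OF \<alpha>] n \<theta> by (auto simp: y_def q_def)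
    have "p * \<Delta> = p ^ (n - 1) * (u * q)"
      using minor_fox_gcomm[OF y] n u(1) by (simp add: \<Delta>_def fox_0 p_def v_def)
    moreover have "p ^ (n - 1) = p * p ^ (n - 2)"
      using n by (metis Suc_diff_le diff_Suc_Suc numeral_2_eq_2 One_nat_def power_Suc)
    ultimately have "\<Delta> = p ^ (n - 2) * (u * q)" using p0 by (simp add: mult.assoc)
    then have "\<Delta> * bar \<Delta> = (p * bar p) ^ (n - 2) * (u * bar u) * (q * bar q)"
      by (simp add: bar_mult bar_power power_mult_distrib mult_ac)
    then have DD: "\<Delta> * bar \<Delta> = q * bar q * (p * bar p) ^ (n - 2)"
      by (simp add: u(2) mult_ac)
    have "corner (n - 1) (rho (chain F y r (n - 2)) - 1) =
        chain_coeff v r (n - 2) * ((- 1) ^ e * \<Delta> * bar \<Delta>)"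
      unfolding corner_chain[OF y n] \<Delta>_def v_def by (subst e) simp_all
    also have "\<dots> = (- 1) ^ e * (q * bar q * (chain_coeff v r (n - 2) * (p * bar p) ^ (n - 2)))"
      unfolding mult.assoc[of _ \<Delta>] DD by (simp only: mult_ac)
    finally have "fsum second_sum (corner (n - 1) (rho (chain F y r (n - 2)) - 1)) =
        (- 1) ^ e * fsum pos (chain_coeff v r (n - 2) * (p * bar p) ^ (n - 2))"
      by (simp only: fsum_sign_mult q_def fsum_second_sum)
    then show ?thesis using c(2)[OF v0] by (simp add: p_def v_def y_def)
  qed
  then show ?thesis using c(1) by (intro exI[of _ "(- 1) ^ e * c"]) simp
qed

end

section \<open>The test word and changes of basis\<close>

definition swap01 :: "(nat \<Rightarrow> 'a) \<Rightarrow> nat \<Rightarrow> 'a" where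
  "swap01 y = y(0 := y 1, 1 := y 0)"

text \<open>The first chain detects the sign of the height of \<open>y 0\<close>, the second that of
  \<open>y 1\<close>.\<close>

definition test_word :: "('a, 'b) monoid_scheme \<Rightarrow> nat \<Rightarrow> nat \<Rightarrow> (nat \<Rightarrow> 'a) \<Rightarrow> 'a" where
  "test_word G r m y = chain G y r m \<otimes>\<^bsub>G\<^esub> inv\<^bsub>G\<^esub> chain G (swap01 y) r m"

text \<open>Endomorphisms inverse to each other on the generators are inverse everywhere, by
  uniqueness in the universal property. The map is restricted because members of \<open>auto\<close>
  are extensional.\<close>

lemma free_group_auto:
  defines "F n \<equiv> free_group n"
  assumes f: "\<And>i. i < n \<Longrightarrow> f i \<in> carrier (F n)" and g: "\<And>i. i < n \<Longrightarrow> g i \<in> carrier (F n)"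
    and fg: "\<And>i. i < n \<Longrightarrow> word_value (F n) f (g i) = gen i"
    and gf: "\<And>i. i < n \<Longrightarrow> word_value (F n) g (f i) = gen i"
  shows "\<exists>\<alpha>\<in>auto (F n). \<forall>i<n. \<alpha> (gen i) = f i"
proof -
  note grp = group_free_group[of n, folded F_def]
  note univ = free_group_universal[OF grp, of n, folded F_def]
  have id: "word_value (F n) a (word_value (F n) b w) = w"
    if a: "\<And>i. i < n \<Longrightarrow> a i \<in> carrier (F n)" and b: "\<And>i. i < n \<Longrightarrow> b i \<in> carrier (F n)"
      and ab: "\<And>i. i < n \<Longrightarrow> word_value (F n) a (b i) = gen i" and w: "w \<in> carrier (F n)" for a b w
  proof -
    have gens: "gen i \<in> carrier (F n)" if "i < n" for i using that by (simp add: F_def)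
    have "word_value (F n) a \<circ> word_value (F n) b \<in> hom (F n) (F n)"
      using univ(1)[of a] univ(1)[of b] a b by (intro hom_compose) auto
    then have "(word_value (F n) a \<circ> word_value (F n) b) w = word_value (F n) gen w"
      using univ(3)[of gen "word_value (F n) a \<circ> word_value (F n) b" w] gens w ab univ(2)[of b] b by simp
    moreover have "w = word_value (F n) gen w"
      using univ(3)[of gen "\<lambda>w. w" w] gens w by (simp add: hom_def)
    ultimately show ?thesis by simp
  qed
  have closed: "word_value (F n) a w \<in> carrier (F n)"
    if "\<And>i. i < n \<Longrightarrow> a i \<in> carrier (F n)" "w \<in> carrier (F n)" for a w
    using univ(1)[of a] that by (auto intro: hom_in_carrier)
  let ?\<alpha> = "restrict (word_value (F n) f) (carrier (F n))"
  have "bij_betw (word_value (F n) f) (carrier (F n)) (carrier (F n))"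
    by (rule bij_betwI[where g = "word_value (F n) g"])
      (use closed id[of f g] id[of g f] f g fg gf in auto)
  then have "bij_betw ?\<alpha> (carrier (F n)) (carrier (F n))"
    by (simp cong: bij_betw_cong)
  moreover have "?\<alpha> \<in> hom (F n) (F n)"
    using univ(1)[of f] f monoid.m_closed[OF group.is_monoid[OF grp]] by (simp add: hom_def Pi_def)
  ultimately have "?\<alpha> \<in> auto (F n)" by (simp add: auto_def Bij_def)
  moreover have "?\<alpha> (gen i) = f i" if "i < n" for i
    using univ(2)[of f i] f that by (simp add: F_def)
  ultimately show ?thesis by blast
qed

lemma word_value_hom:
  assumes "\<And>i. i < n \<Longrightarrow> f i \<in> carrier (free_group n)"
  shows "group_hom (free_group n) (free_group n) (word_value (free_group n) f)"
  using free_group_universal(1)[OF group_free_group, of n f] assms group_free_group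
  by (simp add: group_hom_def group_hom_axioms_def)

text \<open>The exchange behind \<open>swap01\<close>, then the automorphism for the covering and
  the three for the disjoint translates; each comes with an explicit inverse.\<close>

lemma basis_changes:
  fixes n :: nat
  assumes n: "n \<ge> 2"
  defines "F \<equiv> free_group n"
  shows "\<exists>\<alpha>\<in>auto F. \<forall>i<n. \<alpha> (gen i) = (gen(0 := gen 1, 1 := gen 0)) i"
    and "\<exists>\<alpha>\<in>auto F. \<forall>i<n. \<alpha> (gen i) = (gen(1 := inv\<^bsub>F\<^esub> gen 1)) i"
    and "\<exists>\<alpha>\<in>auto F. \<forall>i<n. \<alpha> (gen i) = (gen(0 := gen 0 \<otimes>\<^bsub>F\<^esub> inv\<^bsub>F\<^esub> gen 1)) i"
    and "\<exists>\<alpha>\<in>auto F. \<forall>i<n. \<alpha> (gen i) = (gen(0 := gen 1 \<otimes>\<^bsub>F\<^esub> inv\<^bsub>F\<^esub> gen 0, 1 := gen 0)) i"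
    and "\<exists>\<alpha>\<in>auto F. \<forall>i<n. \<alpha> (gen i) = (gen(0 := gen 0 \<otimes>\<^bsub>F\<^esub> gen 1, 1 := inv\<^bsub>F\<^esub> gen 1)) i"
proof -
  interpret group F unfolding F_def by (rule group_free_group)
  have gens [simp]: "i < n \<Longrightarrow> gen i \<in> carrier F" for i by (simp add: F_def)
  have g01 [simp]: "gen 0 \<in> carrier F" "gen 1 \<in> carrier F" "gen (Suc 0) \<in> carrier F" using n by simp_all
  have h: "word_value F f (x \<otimes>\<^bsub>F\<^esub> y) = word_value F f x \<otimes>\<^bsub>F\<^esub> word_value F f y"
    if "\<And>i. i < n \<Longrightarrow> f i \<in> carrier F" "x \<in> carrier F" "y \<in> carrier F" for f x y
    using word_value_hom[of n f, folded F_def] that by (simp add: group_hom.hom_mult)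
  have h': "word_value F f (inv\<^bsub>F\<^esub> x) = inv\<^bsub>F\<^esub> word_value F f x"
    if "\<And>i. i < n \<Longrightarrow> f i \<in> carrier F" "x \<in> carrier F" for f x
    using word_value_hom[of n f, folded F_def] that by (simp add: group_hom.hom_inv)
  have val: "i < n \<Longrightarrow> word_value F f (gen i) = f i" if "\<And>i. i < n \<Longrightarrow> f i \<in> carrier F" for f i
    using free_group_universal(2)[OF is_group, of n f] that by auto
  have cancel: "x \<otimes>\<^bsub>F\<^esub> y \<otimes>\<^bsub>F\<^esub> inv\<^bsub>F\<^esub> y = x" "x \<otimes>\<^bsub>F\<^esub> inv\<^bsub>F\<^esub> y \<otimes>\<^bsub>F\<^esub> y = x"
    if "x \<in> carrier F" "y \<in> carrier F" for x y
    using that by (simp_all add: m_assoc)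
  note rules = free_group_auto[of n, folded F_def]
  show "\<exists>\<alpha>\<in>auto F. \<forall>i<n. \<alpha> (gen i) = (gen(0 := gen 1, 1 := gen 0)) i"
    by (rule rules[where g = "gen(0 := gen 1, 1 := gen 0)"]) (use n in \<open>auto simp: val\<close>)
  show "\<exists>\<alpha>\<in>auto F. \<forall>i<n. \<alpha> (gen i) = (gen(1 := inv\<^bsub>F\<^esub> gen 1)) i"
    by (rule rules[where g = "gen(1 := inv\<^bsub>F\<^esub> gen 1)"]) (use n in \<open>auto simp: val h h'\<close>)
  show "\<exists>\<alpha>\<in>auto F. \<forall>i<n. \<alpha> (gen i) = (gen(0 := gen 0 \<otimes>\<^bsub>F\<^esub> inv\<^bsub>F\<^esub> gen 1)) i"
    by (rule rules[where g = "gen(0 := gen 0 \<otimes>\<^bsub>F\<^esub> gen 1)"]) (use n in \<open>auto simp: val h h' cancel\<close>)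
  show "\<exists>\<alpha>\<in>auto F. \<forall>i<n. \<alpha> (gen i) = (gen(0 := gen 1 \<otimes>\<^bsub>F\<^esub> inv\<^bsub>F\<^esub> gen 0, 1 := gen 0)) i"
    by (rule rules[where g = "gen(0 := gen 1, 1 := gen 0 \<otimes>\<^bsub>F\<^esub> gen 1)"])
      (use n in \<open>auto simp: val h h' cancel\<close>)
  show "\<exists>\<alpha>\<in>auto F. \<forall>i<n. \<alpha> (gen i) = (gen(0 := gen 0 \<otimes>\<^bsub>F\<^esub> gen 1, 1 := inv\<^bsub>F\<^esub> gen 1)) i"
    by (rule rules[where g = "gen(0 := gen 0 \<otimes>\<^bsub>F\<^esub> gen 1, 1 := inv\<^bsub>F\<^esub> gen 1)"])
      (use n in \<open>auto simp: val h h' cancel\<close>)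
qed

context frequencies
begin

lemma chain_filt:
  assumes "y ` {..<n} \<subseteq> carrier F" "n \<ge> 2"
  shows "rho (chain F y r (n - 2)) - 1 \<in> filt (2 * (n - 1))"
proof -
  have "n - 2 + 1 = n - 1" "{..n - 2 + 1} = {..<n}" using assms(2) by auto
  then show ?thesis using leading_filt[OF leading_chain[of y "n - 2" r]] assms(1) by simp
qed

text \<open>In every context the test word shifts \<open>\<psi>\<close> by the same amount, the
  difference of two values that are \<open>c\<close> or \<open>- c\<close> according to a sign. As
  \<open>c \<noteq> 0\<close>, the shift is 0 exactly if the signs agree.\<close>

lemma test_word_kernel:
  assumes n: "n \<ge> 2" and \<theta>: "\<theta> 0 = 1"
    and height: "\<And>\<alpha> j. \<alpha> \<in> auto F \<Longrightarrow> j < n \<Longrightarrow> height (\<alpha> (gen j)) \<noteq> 0"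
  shows "\<exists>w N. w \<in> carrier F \<and> N \<lhd> F \<and>
    (\<forall>\<alpha>\<in>auto F. \<alpha> w \<in> N \<longleftrightarrow> (height (\<alpha> (gen 0)) > 0 \<longleftrightarrow> height (\<alpha> (gen 1)) > 0))"
proof -
  interpret F: group F by (rule group_free_group)
  define d where "d = n - 1"
  define r where "r = (if n = 2 then 1 else 2 * (n - 2))"
  define U where "U y = chain F y r (n - 2)" for y
  define \<psi> where "\<psi> u = fsum second_sum (corner d (rho u))" for u
  define N where "N = F.syntactic_kernel \<psi>"
  define w where "w = test_word F r (n - 2) gen"
  have h0: "height (\<alpha> (gen 0)) \<noteq> 0" if "\<alpha> \<in> auto F" for \<alpha>
    using height[OF that, of 0] n by simp
  obtain c :: int where c: "c \<noteq> 0" and val: "\<And>\<alpha>. \<alpha> \<in> auto F \<Longrightarrow>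
      fsum second_sum (corner d (rho (U (\<lambda>j. \<alpha> (gen j))) - 1)) = (if height (\<alpha> (gen 0)) > 0 then c else - c)"
    using chain_value[OF n \<theta>] h0 unfolding r_def d_def U_def by blast
  obtain \<sigma> where \<sigma>: "\<sigma> \<in> auto F" "\<And>i. i < n \<Longrightarrow> \<sigma> (gen i) = (gen(0 := gen 1, 1 := gen 0)) i"
    using basis_changes(1)[OF n] by blast
  have dim: "{..n - 2 + 1} = {..<n}" using n by auto
  have gens: "gen ` {..<n} \<subseteq> carrier F" "swap01 gen ` {..<n} \<subseteq> carrier F"
    using n by (auto simp: swap01_def)
  have Uc: "U y \<in> carrier F" if "y ` {..<n} \<subseteq> carrier F" for y
    unfolding U_def using F.chain_closed[of y "n - 2" r] that by (simp only: dim)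
  have wc: "w \<in> carrier F"
    unfolding w_def test_word_def U_def[symmetric] using Uc gens by simp
  have "\<alpha> w \<in> N \<longleftrightarrow> (height (\<alpha> (gen 0)) > 0 \<longleftrightarrow> height (\<alpha> (gen 1)) > 0)" if \<alpha>: "\<alpha> \<in> auto F" for \<alpha>
  proof -
    interpret \<alpha>: group_hom F F \<alpha> by (rule F.auto_group_hom[OF \<alpha>])
    \<comment> \<open>Exchanging the first two generators before applying \<open>\<alpha>\<close> is
      again an automorphism, so \<open>val\<close> evaluates the second chain as well.\<close>
    define \<alpha>' where "\<alpha>' = compose (carrier F) \<alpha> \<sigma>"
    have \<alpha>': "\<alpha>' \<in> auto F" unfolding \<alpha>'_def by (rule F.auto_compose[OF \<alpha> \<sigma>(1)])
    define y where "y = (\<lambda>j. \<alpha> (gen j))"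
    define y' where "y' = (\<lambda>j. \<alpha> (swap01 gen j))"
    have y: "y ` {..<n} \<subseteq> carrier F" "y' ` {..<n} \<subseteq> carrier F"
      using gens by (auto simp: y_def y'_def image_subset_iff)
    have yy: "y' j = \<alpha>' (gen j)" if "j < n" for j
      using that \<sigma>(2)[OF that] by (simp add: \<alpha>'_def compose_eq y'_def swap01_def)
    have chain_cong: "chain F a r k = chain F b r k" if "\<And>j. j \<le> k + 1 \<Longrightarrow> a j = b j" for a b k
      using that by (induction k) auto
    have "\<alpha> w = U y \<otimes>\<^bsub>F\<^esub> inv\<^bsub>F\<^esub> U y'"
      using \<alpha>.hom_chain[of gen "n - 2" r] \<alpha>.hom_chain[of "swap01 gen" "n - 2" r] gens Uc
      unfolding w_def test_word_def U_def dim by (simp add: y_def y'_def comp_def)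
    define A where "A = rho (U y) - 1"
    define B where "B = rho (U y') - 1"
    have AB: "A \<in> filt (2 * d)" "B \<in> filt (2 * d)"
      unfolding A_def B_def U_def d_def using chain_filt y n by auto
    have vA: "fsum second_sum (corner d A) = (if height (\<alpha> (gen 0)) > 0 then c else - c)"
      unfolding A_def y_def by (rule val[OF \<alpha>])
    \<comment> \<open>Agreement on indices below \<open>n\<close> suffices, as the chain reads no
      others.\<close>
    have "U y' = U (\<lambda>j. \<alpha>' (gen j))"
      unfolding U_def by (rule chain_cong) (use yy n in auto)
    moreover have "height (\<alpha>' (gen 0)) = height (\<alpha> (gen 1))"
      using yy[of 0] n by (simp add: y'_def swap01_def)
    ultimately have vB: "fsum second_sum (corner d B) = (if height (\<alpha> (gen 1)) > 0 then c else - c)"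
      unfolding B_def using val[OF \<alpha>'] by simp
    let ?i = "inv\<^bsub>F\<^esub> U y'"
    have rho: "rho (\<alpha> w) = 1 + (A - B) * rho ?i"
      unfolding \<open>\<alpha> w = _\<close> rho_mult A_def B_def
      using rho_inv(2)[OF Uc[OF y(2)]] by (simp add: left_diff_distrib)
    have \<psi>: "\<psi> (p \<otimes>\<^bsub>F\<^esub> \<alpha> w \<otimes>\<^bsub>F\<^esub> q) = \<psi> (p \<otimes>\<^bsub>F\<^esub> q) + (fsum second_sum (corner d A) - fsum second_sum (corner d B))"
      for p q
    proof -
      have "rho (p \<otimes>\<^bsub>F\<^esub> \<alpha> w \<otimes>\<^bsub>F\<^esub> q) = rho (p \<otimes>\<^bsub>F\<^esub> q) + rho p * (A - B) * rho (?i \<otimes>\<^bsub>F\<^esub> q)"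
        unfolding rho_mult rho by (simp add: algebra_simps)
      then show ?thesis
        using corner_rho[OF filt_diff[OF AB], of p "?i \<otimes>\<^bsub>F\<^esub> q"]
        by (simp add: \<psi>_def corner_add fsum_add corner_diff fsum_diff)
    qed
    have "\<alpha> w \<in> N \<longleftrightarrow> fsum second_sum (corner d A) = fsum second_sum (corner d B)"
      unfolding N_def F.syntactic_kernel_def using \<psi> \<alpha>.hom_closed[OF wc] by auto
    then show ?thesis unfolding vA vB using c by auto
  qed
  moreover have "N \<lhd> F" unfolding N_def by (rule F.syntactic_kernel_normal)
  ultimately show ?thesis using wc by blast
qed

text \<open>If all exponent sums of a primitive element were \<open>0\<close>, every homomorphism to the reals would vanish
  on it, but some homomorphism maps it to \<open>1\<close>.\<close>

lemma height_auto_nonzero: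
  assumes indep: "\<And>a :: nat \<Rightarrow> int. (\<Sum>i<n. real_of_int (a i) * \<theta> i) = 0 \<Longrightarrow> (\<forall>i<n. a i = 0)"
    and \<alpha>: "\<alpha> \<in> auto F" and j: "j < n"
  shows "height (\<alpha> (gen j)) \<noteq> 0"
proof
  assume 0: "height (\<alpha> (gen j)) = 0"
  interpret F: group F by (rule group_free_group)
  \<comment> \<open>The exponent sum of generator \<open>i\<close>, as the height for the indicator
    frequencies of \<open>i\<close>.\<close>
  define expo where "expo i w = frequencies.height (\<lambda>k. if k = i then 1 else 0) w" for i w
  have expo_mult: "expo i (u \<otimes>\<^bsub>F\<^esub> v) = expo i u + expo i v" for i u v
    unfolding expo_def by (rule frequencies.height_mult)
  have expo_inv: "u \<in> carrier F \<Longrightarrow> expo i (inv\<^bsub>F\<^esub> u) = - expo i u" for i u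
    unfolding expo_def by (rule frequencies.height_inv)
  have expo_gen: "expo i (gen k) = (if k = i then 1 else 0)" for i k
    by (simp add: expo_def frequencies.height_def frequencies.letter_height_def)
  have h0: "height [] = 0" "expo i [] = 0" for i
    by (simp_all add: height_def expo_def frequencies.height_def)
  have height_gen: "height (gen k) = \<theta> k" for k
    by (simp add: height_def letter_height_def)
  have "height w = (\<Sum>i<n. expo i w * \<theta> i) \<and> (\<forall>i. expo i w \<in> \<int>)" if "w \<in> carrier F" for w
    using that
  proof (induction w rule: free_group_induct)
    case (gen k w)
    then have "(\<Sum>i<n. (if k = i then 1 else 0) * \<theta> i) = \<theta> k" by (simp add: if_distrib[of "\<lambda>x. x * _"] cong: if_cong)
    then show ?case using gen
      by (auto simp: height_mult expo_mult expo_gen height_gen distrib_right sum.distrib)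
  next
    case (inv_gen k w)
    then have "(\<Sum>i<n. (if k = i then 1 else 0) * \<theta> i) = \<theta> k" by (simp add: if_distrib[of "\<lambda>x. x * _"] cong: if_cong)
    then show ?case using inv_gen
      by (auto simp: height_mult expo_mult expo_gen height_gen height_inv expo_inv left_diff_distrib
          distrib_right sum.distrib sum_negf sum_subtractf)
  qed (simp add: h0)
  moreover have v: "\<alpha> (gen j) \<in> carrier F" using j F.auto_closed[OF \<alpha>] by simp
  ultimately have e: "(\<Sum>i<n. expo i (\<alpha> (gen j)) * \<theta> i) = 0" "\<And>i. expo i (\<alpha> (gen j)) \<in> \<int>"
    using 0 by auto
  \<comment> \<open>The exponent sums are integers of type \<open>real\<close>; floors turn them
    into coefficients for \<open>indep\<close>.\<close>
  define a where "a i = \<lfloor>expo i (\<alpha> (gen j))\<rfloor>" for i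
  have a: "expo i (\<alpha> (gen j)) = a i" for i
    using e(2)[of i] by (auto simp: a_def elim: Ints_cases)
  have zero: "expo i (\<alpha> (gen j)) = 0" if "i < n" for i
  proof -
    have "(\<Sum>i<n. real_of_int (a i) * \<theta> i) = 0" using e(1) unfolding a .
    then have "\<forall>i<n. a i = 0" by (rule indep)
    then have "a i = 0" using that by simp
    then show ?thesis unfolding a by (simp only: of_int_0)
  qed
  obtain \<beta> where \<beta>: "\<beta> \<in> auto F" "\<And>x. x \<in> carrier F \<Longrightarrow> \<beta> (\<alpha> x) = x"
    using F.auto_inverse[OF \<alpha>] by blast
  interpret \<beta>: group_hom F F \<beta> by (rule F.auto_group_hom[OF \<beta>(1)])
  \<comment> \<open>A homomorphism to the reals is determined by the exponent sums. This one takes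
    the value 1 at \<open>\<alpha> (gen j)\<close>.\<close>
  have "expo j (\<beta> w) = (\<Sum>i<n. expo i w * expo j (\<beta> (gen i)))" if "w \<in> carrier F" for w
    using that
  proof (induction w rule: free_group_induct)
    case one
    have "\<beta> [] = []" using \<beta>.hom_one by (simp add: one_free_group)
    then show ?case by (simp add: h0)
  next
    case (gen k w)
    then have "(\<Sum>i<n. (if k = i then 1 else 0) * expo j (\<beta> (gen i))) = expo j (\<beta> (gen k))"
      by (simp add: if_distrib[of "\<lambda>x. x * _"] cong: if_cong)
    then show ?case using gen by (simp add: expo_mult expo_gen distrib_right sum.distrib)
  next
    case (inv_gen k w)
    then have "(\<Sum>i<n. (if k = i then 1 else 0) * expo j (\<beta> (gen i))) = expo j (\<beta> (gen k))"
      by (simp add: if_distrib[of "\<lambda>x. x * _"] cong: if_cong)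
    then show ?case using inv_gen
      by (simp add: expo_mult expo_gen expo_inv distrib_right sum.distrib left_diff_distrib sum_negf sum_subtractf)
  qed
  from this[OF v] show False
    using zero \<beta>(2)[of "gen j"] j by (simp add: expo_gen)
qed

end

text \<open>By countability some real lies outside the rational span of the previous ones and can be
  adjoined.\<close>

lemma rationally_independent_reals:
  "n \<ge> 1 \<Longrightarrow> \<exists>\<theta> :: nat \<Rightarrow> real. \<theta> 0 = 1 \<and> (\<forall>a :: nat \<Rightarrow> int. (\<Sum>i<n. real_of_int (a i) * \<theta> i) = 0 \<longrightarrow> (\<forall>i<n. a i = 0))"
proof (induction n rule: dec_induct)
  case base
  show ?case by (intro exI[of _ "\<lambda>_. 1"]) simp
next
  case (step n)
  obtain \<theta> :: "nat \<Rightarrow> real" where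
    th: "\<theta> 0 = 1 \<and> (\<forall>a :: nat \<Rightarrow> int. (\<Sum>i<n. real_of_int (a i) * \<theta> i) = 0 \<longrightarrow> (\<forall>i<n. a i = 0))"
    using step.IH by (rule exE)
  note \<theta> = conjunct1[OF th] conjunct2[OF th, rule_format]
  \<comment> \<open>This contains the rational span. Coding the coefficients by an integer list and
    a denominator makes countability a matter of types; short lists and \<open>b = 0\<close> do no
    harm.\<close>
  define C where "C = (\<lambda>(l :: int list, b :: int). (\<Sum>i<n. l ! i * \<theta> i) / b) ` UNIV"
  have "countable C" unfolding C_def by (intro countable_image countableI_type)
  then have "C \<noteq> UNIV" using uncountable_UNIV_real by auto
  then obtain x where x: "x \<notin> C" by blast
  let ?\<theta> = "\<theta>(n := x)"
  have "\<forall>i<Suc n. a i = 0" if a: "(\<Sum>i<Suc n. real_of_int (a i) * ?\<theta> i) = 0" for a :: "nat \<Rightarrow> int"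
  proof -
    have s: "(\<Sum>i<n. real_of_int (a i) * \<theta> i) + a n * x = 0" using a by simp
    have "a n = 0"
    proof (rule ccontr)
      assume an: "a n \<noteq> 0"
      have "(\<Sum>i<n. map a [0..<n] ! i * \<theta> i) = (\<Sum>i<n. real_of_int (a i) * \<theta> i)"
        by (rule sum.cong) auto
      then have "x = (\<Sum>i<n. map a [0..<n] ! i * \<theta> i) / (- a n)"
        using s an by (simp add: field_simps)
      then have "x \<in> C" unfolding C_def by (intro image_eqI[of _ _ "(map a [0..<n], - a n)"]) simp_all
      then show False using x by simp
    qed
    then show ?thesis using \<theta>(2)[of a] s by (simp add: less_Suc_eq)
  qed
  moreover have "?\<theta> 0 = 1" using step \<theta>(1) by simp
  ultimately show ?case by blast
qed

section \<open>The paradoxical colouring by signs of heights\<close>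

theorem corollary1p6:
  fixes n :: nat
  assumes "n \<ge> 2"
  shows "\<exists>Z. subsystem (OutGroup (free_group n)) (out_action (free_group n)) (marked_group_space n) Z \<and>
    \<not> (\<exists>\<mu>. invariant_prob_measure (OutGroup (free_group n)) (out_action (free_group n))
             (subtopology (marked_group_space n) Z) \<mu>)"
proof -
  let ?F = "free_group n"
  interpret F: group ?F by (rule group_free_group)
  obtain \<theta> :: "nat \<Rightarrow> real" where \<theta>: "\<theta> 0 = 1"
    and indep: "\<And>a :: nat \<Rightarrow> int. (\<Sum>i<n. real_of_int (a i) * \<theta> i) = 0 \<Longrightarrow> (\<forall>i<n. a i = 0)"
    using rationally_independent_reals[of n] assms by auto
  interpret frequencies \<theta> n .
  have nz: "\<alpha> \<in> auto ?F \<Longrightarrow> j < n \<Longrightarrow> height (\<alpha> (gen j)) \<noteq> 0" for \<alpha> j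
    by (rule height_auto_nonzero[OF indep])
  have "\<exists>w N. w \<in> carrier ?F \<and> N \<lhd> ?F \<and>
      (\<forall>\<alpha>\<in>auto ?F. \<alpha> w \<in> N \<longleftrightarrow> (height (\<alpha> (gen 0)) > 0 \<longleftrightarrow> height (\<alpha> (gen 1)) > 0))"
    by (rule test_word_kernel[OF assms \<theta>]) (rule nz)
  then obtain w N where w: "w \<in> carrier ?F" and N: "N \<lhd> ?F" and
    iff: "\<And>\<alpha>. \<alpha> \<in> auto ?F \<Longrightarrow> \<alpha> w \<in> N \<longleftrightarrow> (height (\<alpha> (gen 0)) > 0 \<longleftrightarrow> height (\<alpha> (gen 1)) > 0)"
    by blast
  have g: "gen 0 \<in> carrier ?F" "gen 1 \<in> carrier ?F" using assms by simp_all
  obtain \<sigma> where \<sigma>: "\<sigma> \<in> auto ?F" "\<forall>i<n. \<sigma> (gen i) = (gen(1 := inv\<^bsub>?F\<^esub> gen 1)) i"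
    using basis_changes(2)[OF assms] by (rule bexE)
  obtain \<beta>1 where \<beta>1: "\<beta>1 \<in> auto ?F"
    "\<forall>i<n. \<beta>1 (gen i) = (gen(0 := gen 0 \<otimes>\<^bsub>?F\<^esub> inv\<^bsub>?F\<^esub> gen 1)) i"
    using basis_changes(3)[OF assms] by (rule bexE)
  obtain \<beta>2 where \<beta>2: "\<beta>2 \<in> auto ?F"
    "\<forall>i<n. \<beta>2 (gen i) = (gen(0 := gen 1 \<otimes>\<^bsub>?F\<^esub> inv\<^bsub>?F\<^esub> gen 0, 1 := gen 0)) i"
    using basis_changes(4)[OF assms] by (rule bexE)
  obtain \<beta>3 where \<beta>3: "\<beta>3 \<in> auto ?F"
    "\<forall>i<n. \<beta>3 (gen i) = (gen(0 := gen 0 \<otimes>\<^bsub>?F\<^esub> gen 1, 1 := inv\<^bsub>?F\<^esub> gen 1)) i"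
    using basis_changes(5)[OF assms] by (rule bexE)
  note autos = \<sigma>(1) \<beta>1(1) \<beta>2(1) \<beta>3(1)
  have gens: "\<sigma> (gen 0) = gen 0" "\<sigma> (gen 1) = inv\<^bsub>?F\<^esub> gen 1"
    "\<beta>1 (gen 0) = gen 0 \<otimes>\<^bsub>?F\<^esub> inv\<^bsub>?F\<^esub> gen 1" "\<beta>1 (gen 1) = gen 1"
    "\<beta>2 (gen 0) = gen 1 \<otimes>\<^bsub>?F\<^esub> inv\<^bsub>?F\<^esub> gen 0" "\<beta>2 (gen 1) = gen 0"
    "\<beta>3 (gen 0) = gen 0 \<otimes>\<^bsub>?F\<^esub> gen 1" "\<beta>3 (gen 1) = inv\<^bsub>?F\<^esub> gen 1"
    using \<sigma>(2) \<beta>1(2) \<beta>2(2) \<beta>3(2) assms by auto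
  have vals:
    "\<alpha> (\<sigma> w) \<in> N \<longleftrightarrow> (a > 0 \<longleftrightarrow> - b > 0)"
    "\<alpha> (\<beta>1 w) \<in> N \<longleftrightarrow> (a - b > 0 \<longleftrightarrow> b > 0)"
    "\<alpha> (\<beta>2 w) \<in> N \<longleftrightarrow> (b - a > 0 \<longleftrightarrow> a > 0)"
    "\<alpha> (\<beta>3 w) \<in> N \<longleftrightarrow> (a + b > 0 \<longleftrightarrow> - b > 0)"
    "a \<noteq> 0" "b \<noteq> 0" "a - b \<noteq> 0" "a + b \<noteq> 0"
    if \<alpha>: "\<alpha> \<in> auto ?F" and a: "a = height (\<alpha> (gen 0))" and b: "b = height (\<alpha> (gen 1))" for \<alpha> a b
  proof -
    interpret \<alpha>: group_hom ?F ?F \<alpha> by (rule F.auto_group_hom[OF \<alpha>])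
    have comp: "\<alpha> (\<beta> w) \<in> N \<longleftrightarrow> (height (\<alpha> (\<beta> (gen 0))) > 0 \<longleftrightarrow> height (\<alpha> (\<beta> (gen 1))) > 0)"
      "height (\<alpha> (\<beta> (gen 0))) \<noteq> 0" if "\<beta> \<in> auto ?F" for \<beta>
      using iff[OF F.auto_compose[OF \<alpha> that]] nz[OF F.auto_compose[OF \<alpha> that], of 0] w g assms
      by (simp_all add: compose_eq)
    show "\<alpha> (\<sigma> w) \<in> N \<longleftrightarrow> (a > 0 \<longleftrightarrow> - b > 0)"
      "\<alpha> (\<beta>1 w) \<in> N \<longleftrightarrow> (a - b > 0 \<longleftrightarrow> b > 0)"
      "\<alpha> (\<beta>2 w) \<in> N \<longleftrightarrow> (b - a > 0 \<longleftrightarrow> a > 0)"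
      "\<alpha> (\<beta>3 w) \<in> N \<longleftrightarrow> (a + b > 0 \<longleftrightarrow> - b > 0)"
      "a - b \<noteq> 0" "a + b \<noteq> 0"
      using comp[OF autos(1)] comp[OF autos(2)] comp[OF autos(3)] comp[OF autos(4)] g
      unfolding gens a b by (simp_all add: height_mult height_inv \<alpha>.hom_closed)
    show "a \<noteq> 0" "b \<noteq> 0" using nz[OF \<alpha>] assms a b by auto
  qed
  show ?thesis
    unfolding marked_group_space_def
  proof (rule F.subsystem_without_invariant_measure[OF w N autos])
    fix \<alpha> assume \<alpha>: "\<alpha> \<in> auto ?F"
    \<comment> \<open>Let \<open>a\<close> and \<open>b\<close> be the heights of the images of the
      first two generators. Then \<open>\<beta>1\<close> asks for equal signs with \<open>a\<close>
      larger in absolute value, \<open>\<beta>2\<close> for equal signs with \<open>b\<close>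
      larger, and \<open>\<beta>3\<close> for opposite signs with \<open>a\<close> larger.\<close>
    note v = iff[OF \<alpha>] vals[OF \<alpha> refl refl]
    show "\<alpha> w \<in> N \<or> \<alpha> (\<sigma> w) \<in> N" using v by argo
    show "\<alpha> (\<beta>1 w) \<notin> N \<or> \<alpha> (\<beta>2 w) \<notin> N" using v by argo
    show "\<alpha> (\<beta>1 w) \<notin> N \<or> \<alpha> (\<beta>3 w) \<notin> N" using v by argo
    show "\<alpha> (\<beta>2 w) \<notin> N \<or> \<alpha> (\<beta>3 w) \<notin> N" using v by argo
  qed
qed

end
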